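(* Let $G$ be a graph with at most nine vertices. Then for every positive integer $s$ with $s\leq \mathrm{match}(G)$, we have $$\mathrm{reg}\big(I(G)^{[s]}\big)\leq \mathrm{match}(G)+s.$$
   Context: Let $\mathbb{K}$ be a field and $S=\mathbb{K}[x_1,\ldots,x_n]$ the standard graded polynomial ring. Graphs are finite and simple. For a graph $G$ with vertex set $V(G)=\{x_1,\ldots,x_n\}$ (vertices are identified with variables of $S$), the edge ideal is $I(G)=(x_ix_j : x_ix_j\in E(G))\subseteq S$. A matching is a set of pairwise disjoint edges, and $\mathrm{match}(G)$ is the maximum size of a matching of $G$. For a squarefree monomial ideal $I$, the $s$-th squarefree power $I^{[s]}$ is the ideal generated by the squarefree monomials belonging to $I^s$; thus $I(G)^{[s]}$ is generated by the products $e_1\cdots e_s$ with $\{e_1,\ldots,e_s\}$ a matching of $G$. For a finitely generated graded $S$-module $M$ with graded Betti numbers $\beta_{i,j}(M)$, the Castelnuovo--Mumford regularity is $\mathrm{reg}(M)=\max\{j-i : \beta_{i,j}(M)\neq 0\}$. *)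

theory Defs
  imports "HOL-Library.Poly_Mapping" "Jordan_Normal_Form.Matrix"
begin

section \<open>The polynomial ring\<close>

text \<open>
  The variables of \<open>S\<close> are the elements of a finite type \<open>'v\<close>, and \<open>n = card (UNIV :: 'v set)\<close>.
  A monomial is its exponent vector, and a polynomial maps exponent vectors to coefficients;
  the ring operations are those of \<^theory>\<open>HOL-Library.Poly_Mapping\<close>.
\<close>

type_synonym 'v monomial = "'v \<Rightarrow>\<^sub>0 nat"
type_synonym ('v, 'k) polynomial = "'v monomial \<Rightarrow>\<^sub>0 'k"

definition variable :: "'v \<Rightarrow> ('v, 'k::field) polynomial" where
  "variable x = Poly_Mapping.single (Poly_Mapping.single x 1) 1"

definition total_degree :: "'v::finite monomial \<Rightarrow> nat" where
  "total_degree m = (\<Sum>x\<in>UNIV. Poly_Mapping.lookup m x)"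

text \<open>The graded piece \<open>S\<^sub>d\<close>; it is zero for negative \<open>d\<close>.\<close>

definition homogeneous :: "int \<Rightarrow> ('v::finite, 'k::field) polynomial set" where
  "homogeneous d = {p. \<forall>m\<in>Poly_Mapping.keys p. int (total_degree m) = d}"

text \<open>
  A commutative ring is a module over itself: its ideals are the submodules
  (\<open>ideal.subspace\<close>), and \<open>ideal.span B\<close> is the ideal generated by \<open>B\<close>.
\<close>

interpretation ideal: Modules.module "times :: 'a::comm_ring_1 \<Rightarrow> 'a \<Rightarrow> 'a"
  by unfold_locales (simp_all add: algebra_simps)

definition irrelevant_ideal :: "('v, 'k::field) polynomial set" where
  "irrelevant_ideal = ideal.span (range variable)"

primrec ideal_power :: "'a::comm_ring_1 set \<Rightarrow> nat \<Rightarrow> 'a set" where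
  "ideal_power I 0 = UNIV"
| "ideal_power I (Suc s) = ideal.span {a * b | a b. a \<in> I \<and> b \<in> ideal_power I s}"

definition squarefree_power :: "('v, 'k::field) polynomial set \<Rightarrow> nat \<Rightarrow> ('v, 'k) polynomial set" where
  "squarefree_power I s = ideal.span
     {Poly_Mapping.single m 1 | m.
        (\<forall>x. Poly_Mapping.lookup m x \<le> 1) \<and> Poly_Mapping.single m 1 \<in> ideal_power I s}"

section \<open>Graded Betti numbers and regularity of an ideal\<close>

text \<open>
  A complex \<open>\<cdots> \<rightarrow> F\<^sub>2 \<rightarrow> F\<^sub>1 \<rightarrow> F\<^sub>0 \<rightarrow> I \<rightarrow> 0\<close> of graded free modules of finite rank is encoded as follows.
  The list \<open>D i\<close> holds the degrees of the basis elements of \<open>F\<^sub>i\<close>, that is,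
  \<open>F\<^sub>i\<close> is the direct sum of the \<open>S(- D i ! k)\<close>, with underlying module \<open>S\<^sup>r\<close> for \<open>r = length (D i)\<close>.
  The map \<open>F\<^sub>0 \<rightarrow> I\<close> sends the \<open>k\<close>-th basis element to \<open>g $ k\<close>, and \<open>\<phi> i\<close> is the matrix of
  \<open>F\<^bsub>i+1\<^esub> \<rightarrow> F\<^sub>i\<close>. All maps are homogeneous of degree 0. The resolved module is the ideal \<open>I\<close> itself,
  not \<open>S/I\<close>.
\<close>

definition graded_free_resolution ::
  "('v::finite, 'k::field) polynomial set \<Rightarrow> (nat \<Rightarrow> int list) \<Rightarrow>
   ('v, 'k) polynomial vec \<Rightarrow> (nat \<Rightarrow> ('v, 'k) polynomial mat) \<Rightarrow> bool" where
  "graded_free_resolution I D g \<phi> \<longleftrightarrow>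
     g \<in> carrier_vec (length (D 0)) \<and>
     (\<forall>k < length (D 0). g $ k \<in> homogeneous (D 0 ! k)) \<and>
     (\<forall>i. \<phi> i \<in> carrier_mat (length (D i)) (length (D (Suc i)))) \<and>
     (\<forall>i. \<forall>k < length (D i). \<forall>l < length (D (Suc i)).
        \<phi> i $$ (k, l) \<in> homogeneous (D (Suc i) ! l - D i ! k)) \<and>
     (\<lambda>v. g \<bullet> v) ` carrier_vec (length (D 0)) = I \<and>
     {v \<in> carrier_vec (length (D 0)). g \<bullet> v = 0} =
       (\<lambda>w. \<phi> 0 *\<^sub>v w) ` carrier_vec (length (D 1)) \<and>
     (\<forall>i. {v \<in> carrier_vec (length (D (Suc i))). \<phi> i *\<^sub>v v = 0\<^sub>v (length (D i))} =
       (\<lambda>w. \<phi> (Suc i) *\<^sub>v w) ` carrier_vec (length (D (Suc (Suc i)))))"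

definition minimal_graded_free_resolution ::
  "('v::finite, 'k::field) polynomial set \<Rightarrow> (nat \<Rightarrow> int list) \<Rightarrow>
   ('v, 'k) polynomial vec \<Rightarrow> (nat \<Rightarrow> ('v, 'k) polynomial mat) \<Rightarrow> bool" where
  "minimal_graded_free_resolution I D g \<phi> \<longleftrightarrow>
     graded_free_resolution I D g \<phi> \<and>
     (\<forall>i. \<forall>k < length (D i). \<forall>l < length (D (Suc i)). \<phi> i $$ (k, l) \<in> irrelevant_ideal)"

text \<open>
  \<open>\<beta>\<^bsub>i,j\<^esub>(I)\<close> is the number of basis elements of degree \<open>j\<close> in \<open>F\<^sub>i\<close>, for a minimal graded free
  resolution of the homogeneous ideal \<open>I\<close>; the number does not depend on which one is chosen.
\<close>

definition graded_betti ::
  "('v::finite, 'k::field) polynomial set \<Rightarrow> nat \<Rightarrow> int \<Rightarrow> nat" where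
  "graded_betti I i j =
     count_list ((SOME D. \<exists>g \<phi>. minimal_graded_free_resolution I D g \<phi>) i) j"

text \<open>
  For a nonzero homogeneous ideal the set is nonempty, and finite by Hilbert's syzygy theorem, so
  that \<^const>\<open>Max\<close> is a true maximum.
\<close>

definition regularity :: "('v::finite, 'k::field) polynomial set \<Rightarrow> int" where
  "regularity I = Max {j - int i | i j. graded_betti I i j \<noteq> 0}"

section \<open>Graphs\<close>

text \<open>A finite simple graph on the vertex set \<open>UNIV :: 'v set\<close>, given by its edges.\<close>

definition simple_graph :: "'v::finite set set \<Rightarrow> bool" where
  "simple_graph E \<longleftrightarrow> (\<forall>e\<in>E. card e = 2)"

definition matching :: "'v set set \<Rightarrow> 'v set set \<Rightarrow> bool" where
  "matching E M \<longleftrightarrow> M \<subseteq> E \<and> pairwise disjnt M"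

definition match_number :: "'v::finite set set \<Rightarrow> nat" where
  "match_number E = Max {card M | M. matching E M}"

definition edge_ideal :: "'v set set \<Rightarrow> ('v, 'k::field) polynomial set" where
  "edge_ideal E = ideal.span {variable x * variable y | x y. {x, y} \<in> E}"

end

theory Submission
  imports Defs "HOL-Library.Countable" "HOL-Library.Function_Algebras"
begin

text \<open>
  For the squarefree monomial ideal whose squarefree monomials form an up-set \<open>U\<close> of vertex sets,
  the Betti numbers of multidegree \<open>F\<close> are given by the homology of the complex of chains on the sets
  \<open>P \<subseteq> F\<close> with \<open>F - P \<in> U\<close>. Here \<open>U\<close> consists of the sets containing a matching of size \<open>s\<close>, and
  with \<open>\<nu>\<close> the matching number of the graph induced on \<open>F\<close> one needs vanishing in every degree
  \<open>p < card F - \<nu> - s\<close>. There are four cases. For \<open>s > \<nu>\<close> there is nothing to prove. For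
  \<open>s \<le> 2\<close> one deletes vertices by induction, using that the colon of the second power by an edge is
  again an edge ideal. For \<open>s = \<nu>\<close> the sets covered by maximum matchings are the bases of a matroid.
  For \<open>card F \<le> 2 * \<nu> + 1\<close> a set \<open>P\<close> of the relevant size destroys too few edges of a maximum
  matching, even after adding one suitable vertex, so that a cone construction applies. If
  \<open>3 \<le> s < \<nu>\<close> and \<open>card F \<le> 9\<close>, then \<open>\<nu> \<ge> 4\<close> and the last case applies.

  All syzygies of a squarefree monomial ideal are generated in squarefree multidegrees, so a minimal
  resolution can be built by linear algebra over the field; the degrees of any other minimal
  resolution are compared with it by lifting chain maps and a homotopy.
\<close>

(* The interpretation in Defs makes this the left-to-right rule a * (b * x) = (a * b) * x, which
   loops with mult.assoc. *)
declare ideal.scale_scale [simp del]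

section \<open>Homology of squarefree monomial ideals\<close>

text \<open>A basis element of degree \<open>card F\<close> in position \<open>p\<close> of a
  resolution counts \<open>card F - p\<close> towards the regularity; this is the source of the
  range of \<open>p\<close>. The matching number is taken inside \<open>F\<close> and not in the
  whole graph, which gives a bound that survives vertex deletion and allows the case split to be
  made for each \<open>F\<close> separately. Nine is where the split stops being exhaustive: for
  \<open>card F = 10\<close>, \<nu> = 4 and s = 3 none of the cases applies. On the algebraic side
  the obstacle is that \<open>graded_betti\<close> refers to an unspecified minimal resolution,
  about which homology says nothing until one minimal resolution with controlled degrees is
  available in the same encoding. The control comes from dimension shifting: vanishing for the ideal
  in position \<open>i + p\<close> passes to its i-th syzygy module in position \<open>p\<close>,
  and a minimal generator of degree \<open>F\<close> occurs only where position 0 fails to be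
  exact.\<close>

definition orientation :: "'v::countable \<Rightarrow> 'v set \<Rightarrow> 'k::comm_ring_1" where
  "orientation x P = (- 1) ^ card {y \<in> P. to_nat y < to_nat x}"

lemma orientation_square [simp]: "orientation x P * orientation x P = (1 :: 'k::comm_ring_1)"
  by (simp add: orientation_def flip: power_mult_distrib)

lemma orientation_square' [simp]: "orientation x P * (orientation x P * a) = (a :: 'k::comm_ring_1)"
  by (simp flip: mult.assoc)

lemma orientation_insert_less:
  assumes "finite P" "y \<notin> P" "to_nat y < to_nat x"
  shows "orientation x (insert y P) = - (orientation x P :: 'k::comm_ring_1)"
proof -
  have "{z \<in> insert y P. to_nat z < to_nat x} = insert y {z \<in> P. to_nat z < to_nat x}"
    using assms by auto
  then show ?thesis using assms by (simp add: orientation_def)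
qed

lemma orientation_insert_greater:
  assumes "to_nat x < to_nat y"
  shows "orientation x (insert y P) = (orientation x P :: 'k::comm_ring_1)"
proof -
  have "{z \<in> insert y P. to_nat z < to_nat x} = {z \<in> P. to_nat z < to_nat x}"
    using assms by auto
  then show ?thesis by (simp add: orientation_def)
qed

text \<open>\<open>orientation x P\<close> is the sign that sorts \<open>x\<close> into
  \<open>P\<close> in an exterior product; the order comes from \<open>to_nat\<close>, as
  \<open>'v\<close> carries none. The smaller of \<open>x\<close> and \<open>y\<close> flips the
  sign of the larger, but not conversely, so the two sides differ by one flip.\<close>

lemma orientation_swap:
  fixes x y :: "'v::finite"
  assumes "x \<noteq> y" "x \<notin> P" "y \<notin> P"
  shows "orientation x P * orientation y (insert x P) =
         - (orientation y P * orientation x (insert y P) :: 'k::comm_ring_1)"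
proof -
  have "to_nat x \<noteq> to_nat y" using assms(1) by simp
  then consider "to_nat x < to_nat y" | "to_nat y < to_nat x" by linarith
  then show ?thesis
    by cases (simp_all add: orientation_insert_less orientation_insert_greater assms mult.commute)
qed

lemma orientation_swap':
  fixes x y :: "'v::finite"
  assumes "x \<noteq> y" "x \<notin> P" "y \<notin> P"
  shows "orientation x (insert y P) * orientation y (insert x P) =
         - (orientation y P * orientation x P :: 'k::comm_ring_1)"
proof -
  have "to_nat x \<noteq> to_nat y" using assms(1) by simp
  then consider "to_nat x < to_nat y" | "to_nat y < to_nat x" by linarith
  then show ?thesis
    by cases (simp_all add: orientation_insert_less orientation_insert_greater assms mult.commute)
qed

text \<open>The Koszul differential in a fixed multidegree, written on coefficient functions:
  \<open>c P\<close> is the coefficient of the basis vector of \<open>P\<close>, and within one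
  multidegree the monomial factors are invisible.\<close>

definition boundary :: "('v::finite set \<Rightarrow> 'k::comm_ring_1) \<Rightarrow> 'v set \<Rightarrow> 'k" where
  "boundary c Q = (\<Sum>x\<in>- Q. orientation x Q * c (insert x Q))"

definition wedge :: "'v::finite \<Rightarrow> ('v set \<Rightarrow> 'k::comm_ring_1) \<Rightarrow> 'v set \<Rightarrow> 'k" where
  "wedge z c P = (if z \<in> P then orientation z (P - {z}) * c (P - {z}) else 0)"

lemma boundary_zero [simp]: "boundary (\<lambda>_. 0) = (\<lambda>_. 0)"
  by (simp add: boundary_def fun_eq_iff)

lemma boundary_add: "boundary (\<lambda>P. b P + c P) = (\<lambda>P. boundary b P + boundary c P)"
  by (simp add: boundary_def fun_eq_iff sum.distrib algebra_simps)

lemma boundary_diff: "boundary (\<lambda>P. b P - c P) = (\<lambda>P. boundary b P - boundary c P)"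
  by (simp add: boundary_def fun_eq_iff sum_subtractf algebra_simps)

lemma boundary_scale: "boundary (\<lambda>P. a * c P) = (\<lambda>P. a * boundary c P)"
  by (simp add: boundary_def fun_eq_iff sum_distrib_left algebra_simps)

lemma boundary_sum: "boundary (\<lambda>P. \<Sum>k\<in>A. c k P) = (\<lambda>P. \<Sum>k\<in>A. boundary (c k) P)"
  by (induction A rule: infinite_finite_induct) (simp_all add: boundary_add)

lemma boundary_boundary [simp]:
  fixes c :: "'v::finite set \<Rightarrow> 'k::comm_ring_1"
  shows "boundary (boundary c) = (\<lambda>_. 0)"
proof
  fix Q
  let ?t = "\<lambda>(x, y). orientation x Q * orientation y (insert x Q) * c (insert y (insert x Q))"
  let ?L = "{(x, y). x \<notin> Q \<and> y \<notin> Q \<and> to_nat x < to_nat y}"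
  let ?G = "{(x, y). x \<notin> Q \<and> y \<notin> Q \<and> to_nat y < to_nat x}"
  have "boundary (boundary c) Q = (\<Sum>x\<in>- Q. \<Sum>y\<in>- insert x Q. ?t (x, y))"
    by (simp add: boundary_def sum_distrib_left mult.assoc)
  also have "\<dots> = (\<Sum>p\<in>(SIGMA x:- Q. - insert x Q). ?t p)"
    by (subst sum.Sigma) (auto simp: split_def)
  \<comment> \<open>The ordered pairs are split by which entry is smaller; swapping the entries
    matches the two halves with opposite signs.\<close>
  also have "(SIGMA x:- Q. - insert x Q) = ?L \<union> ?G"
    by (auto simp: less_le)
  also have "sum ?t (?L \<union> ?G) = sum ?t ?L + sum ?t ?G"
    by (rule sum.union_disjoint) auto
  also have "sum ?t ?G = (\<Sum>p\<in>?L. - ?t p)"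
  proof (rule sum.reindex_bij_witness[of _ prod.swap prod.swap])
    fix p assume "p \<in> ?G"
    then obtain x y where p: "p = (x, y)" "x \<noteq> y" "x \<notin> Q" "y \<notin> Q" by auto
    then show "- ?t (prod.swap p) = ?t p"
      using orientation_swap[of x y Q, where 'k = 'k] by (simp add: insert_commute)
  qed auto
  finally show "boundary (boundary c) Q = 0" by (simp add: sum_negf)
qed

text \<open>Left exterior multiplication by \<open>z\<close> is a contracting homotopy. For
  \<open>z\<close> in \<open>P\<close> the summand of \<open>wedge z (boundary c)\<close> that puts
  \<open>z\<close> back gives \<open>c P\<close>, and all others cancel by
  \<open>orientation_swap'\<close>.\<close>

lemma boundary_wedge: "boundary (wedge z c) P + wedge z (boundary c) P = c P"
proof (cases "z \<in> P")
  case False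
  have "boundary (wedge z c) P = (\<Sum>x\<in>- P. if x = z then c P else 0)"
    unfolding boundary_def wedge_def using False by (intro sum.cong) (auto simp: insert_absorb)
  also have "\<dots> = c P" using False by simp
  finally show ?thesis using False by (simp add: wedge_def)
next
  case True
  define R where "R = P - {z}"
  have P: "P = insert z R" "z \<notin> R" using True by (auto simp: R_def)
  have C: "- R = insert z (- P)" "z \<notin> - P" using P by auto
  have "boundary (wedge z c) P = (\<Sum>x\<in>- P. - (orientation z R * (orientation x R * c (insert x R))))"
    unfolding boundary_def
  proof (rule sum.cong[OF refl])
    fix x assume "x \<in> - P"
    then have x: "x \<noteq> z" "x \<notin> R" using P by auto
    then have "insert x P - {z} = insert x R" using P by auto
    then have "orientation x P * wedge z c (insert x P) =
      (orientation x (insert z R) * orientation z (insert x R)) * c (insert x R)"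
      using P by (simp add: wedge_def mult.assoc)
    then show "orientation x P * wedge z c (insert x P) = - (orientation z R * (orientation x R * c (insert x R)))"
      using x P by (simp add: orientation_swap' mult.assoc)
  qed
  moreover have "wedge z (boundary c) P = c P + (\<Sum>x\<in>- P. orientation z R * (orientation x R * c (insert x R)))"
    using True P(2) by (simp add: wedge_def R_def[symmetric] boundary_def C sum_distrib_left distrib_left flip: P(1))
  ultimately show ?thesis by (simp add: sum_negf)
qed

text \<open>
  The chains of degree \<open>p\<close> are the degree \<open>F\<close> part of the \<open>p\<close>-th term of the Koszul complex of the
  squarefree monomial ideal with monomials \<open>U\<close>.
\<close>

definition chain :: "'v::finite set set \<Rightarrow> 'v set \<Rightarrow> nat \<Rightarrow> ('v set \<Rightarrow> 'k::zero) \<Rightarrow> bool" where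
  "chain U F p c \<longleftrightarrow> (\<forall>P. c P \<noteq> 0 \<longrightarrow> P \<subseteq> F \<and> card P = p \<and> F - P \<in> U)"

lemma chain_diff: "chain U F p b \<Longrightarrow> chain U F p c \<Longrightarrow> chain U F p (\<lambda>P. b P - c P :: 'k::ab_group_add)"
  unfolding chain_def by (metis diff_self)

text \<open>A set of size \<open>p\<close> is a face of dimension \<open>p - 1\<close> of the upper
  Koszul complex, so over a field this is the vanishing of the Betti number in position
  \<open>p\<close> and multidegree \<open>F\<close>. For an up-set \<open>U\<close> and
  \<open>p = 0\<close> it says that \<open>F\<close> is not a minimal member of
  \<open>U\<close>.\<close>

definition acyclic_at :: "'k::comm_ring_1 itself \<Rightarrow> 'v::finite set set \<Rightarrow> 'v set \<Rightarrow> nat \<Rightarrow> bool" where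
  "acyclic_at K U F p \<longleftrightarrow>
     (\<forall>c :: 'v set \<Rightarrow> 'k. chain U F p c \<longrightarrow> boundary c = (\<lambda>_. 0) \<longrightarrow>
        (\<exists>b. chain U F (Suc p) b \<and> boundary b = c))"

definition upclosed :: "'v set set \<Rightarrow> bool" where
  "upclosed U \<longleftrightarrow> (\<forall>A B. A \<in> U \<longrightarrow> A \<subseteq> B \<longrightarrow> B \<in> U)"

text \<open>The squarefree monomials of the colon ideal by the monomial of \<open>B\<close>. Sets
  meeting \<open>B\<close> are kept, so that the result is again an up-set.\<close>

definition colon :: "'v set set \<Rightarrow> 'v set \<Rightarrow> 'v set set" where
  "colon U B = {A. A \<union> B \<in> U}"

lemma upclosed_colon: "upclosed U \<Longrightarrow> upclosed (colon U B)"
  unfolding upclosed_def colon_def by (metis Un_mono mem_Collect_eq order_refl)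

text \<open>In degree \<open>p\<close> the complex looks like a cone with apex \<open>z\<close>,
  since each face can be joined with \<open>z\<close>. On a cycle the second term of
  \<open>boundary_wedge\<close> vanishes, and \<open>wedge z c\<close> is a filling.\<close>

lemma acyclic_at_cone:
  assumes "z \<in> F"
    and "\<And>P. P \<subseteq> F \<Longrightarrow> card P = p \<Longrightarrow> z \<notin> P \<Longrightarrow> F - P \<in> U \<Longrightarrow> F - insert z P \<in> U"
  shows "acyclic_at K U F p"
  unfolding acyclic_at_def
proof (intro allI impI)
  fix c :: "'a set \<Rightarrow> 'b" assume c: "chain U F p c" "boundary c = (\<lambda>_. 0)"
  have "chain U F (Suc p) (wedge z c)"
    unfolding chain_def
  proof (intro allI impI)
    fix P assume "wedge z c P \<noteq> 0"
    then have P: "z \<in> P" "c (P - {z}) \<noteq> 0" by (auto simp: wedge_def split: if_splits)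
    then have "P - {z} \<subseteq> F" "card (P - {z}) = p" "F - (P - {z}) \<in> U" using c by (auto simp: chain_def)
    then show "P \<subseteq> F \<and> card P = Suc p \<and> F - P \<in> U"
      using assms(1) assms(2)[of "P - {z}"] P(1) by (auto simp: insert_absorb dest: card_Suc_Diff1[OF finite])
  qed
  moreover have "boundary (wedge z c) = c"
    using boundary_wedge[of z c] unfolding c(2) by (auto simp: fun_eq_iff wedge_def if_distrib cong: if_cong)
  ultimately show "\<exists>b. chain U F (Suc p) b \<and> boundary b = c" by blast
qed

text \<open>
  The chains not containing \<open>v\<close> form a subcomplex isomorphic to the one of the colon ideal on
  \<open>F - {v}\<close>; the quotient is the complex on \<open>F - {v}\<close>, shifted by one.
\<close>

lemma acyclic_at_step:
  assumes up: "upclosed U" and v: "v \<in> F"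
    and lk: "acyclic_at K (colon U {v}) (F - {v}) p"
    and del: "p = 0 \<or> acyclic_at K U (F - {v}) (p - 1)"
  shows "acyclic_at (K :: 'k::comm_ring_1 itself) U F p"
  unfolding acyclic_at_def
proof (intro allI impI)
  fix c :: "'a set \<Rightarrow> 'k" assume c: "chain U F p c" "boundary c = (\<lambda>_. 0)"
  \<comment> \<open>The part of \<open>c\<close> on faces through \<open>v\<close>, with
    \<open>v\<close> removed and the sign corrected: a cycle one degree lower in the complex on
    \<open>F - {v}\<close>.\<close>
  define d :: "'a set \<Rightarrow> 'k" where "d = (\<lambda>P. if v \<in> P then 0 else orientation v P * c (insert v P))"
  have bd_d: "boundary d = (\<lambda>_. 0)"
  proof
    fix Q
    show "boundary d Q = 0"
    proof (cases "v \<in> Q")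
      case True then show ?thesis by (simp add: boundary_def d_def)
    next
      case False
      have C: "- Q = insert v (- insert v Q)" using False by auto
      have "boundary d Q = (\<Sum>x\<in>- insert v Q. orientation x Q * d (insert x Q))"
        unfolding boundary_def by (subst C, subst sum.insert) (auto simp: d_def)
      also have "\<dots> = (\<Sum>x\<in>- insert v Q. - (orientation v Q * (orientation x (insert v Q) * c (insert x (insert v Q)))))"
      proof (rule sum.cong[OF refl])
        fix x assume x: "x \<in> - insert v Q"
        then have "x \<noteq> v" by simp
          then have "orientation x Q * d (insert x Q) =
          (orientation x Q * orientation v (insert x Q)) * c (insert x (insert v Q))"
          using False by (simp add: d_def insert_commute mult.assoc)
        also have "\<dots> = - (orientation v Q * orientation x (insert v Q)) * c (insert x (insert v Q))"
          using x False by (subst orientation_swap) auto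
        finally show "orientation x Q * d (insert x Q) =
          - (orientation v Q * (orientation x (insert v Q) * c (insert x (insert v Q))))"
          by (simp add: mult.assoc)
      qed
      also have "\<dots> = - (orientation v Q * boundary c (insert v Q))"
        by (simp add: boundary_def sum_distrib_left sum_negf)
      finally show ?thesis using c(2) by simp
    qed
  qed
  obtain b :: "'a set \<Rightarrow> 'k" where b: "chain U (F - {v}) p b" "boundary b = d"
  proof (cases "p = 0")
    case True
    have "d = (\<lambda>_. 0)"
    proof
      fix P
      have "c (insert v P) = 0" using c(1) True unfolding chain_def by (metis card_0_eq finite insert_not_empty)
      then show "d P = 0" by (simp add: d_def)
    qed
    then show ?thesis using that[of "\<lambda>_. 0"] by (auto simp: chain_def)
  next
    case False
    have "chain U (F - {v}) (p - 1) d"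
      unfolding chain_def
    proof (intro allI impI)
      fix P assume "d P \<noteq> 0"
      then have P: "v \<notin> P" "c (insert v P) \<noteq> 0" by (auto simp: d_def split: if_splits)
      then have "insert v P \<subseteq> F" "card (insert v P) = p" "F - insert v P \<in> U"
        using c(1) by (auto simp: chain_def)
      moreover have "F - insert v P = F - {v} - P" by auto
      ultimately show "P \<subseteq> F - {v} \<and> card P = p - 1 \<and> F - {v} - P \<in> U"
        using P(1) by auto
    qed
    then have "\<exists>b. chain U (F - {v}) (Suc (p - 1)) b \<and> boundary b = d"
      using del False bd_d unfolding acyclic_at_def by metis
    then show ?thesis using that False by auto
  qed
  \<comment> \<open>Because \<open>boundary b = d\<close>, adding this boundary cancels
    \<open>c\<close> on every face through \<open>v\<close>; what remains lies in the subcomplex of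
    the colon ideal.\<close>
  define e where "e = (\<lambda>P. c P + boundary (wedge v b) P)"
  have b0: "b P = 0" if "v \<in> P" for P using b(1) that by (auto simp: chain_def)
  have e_eq: "e P = (if v \<in> P then 0 else c P + b P)" for P
  proof -
    have "boundary (wedge v b) P = b P - wedge v d P"
      using boundary_wedge[of v b P] b(2) by (simp add: algebra_simps)
    moreover have "wedge v d P = (if v \<in> P then c P else 0)"
      by (auto simp: wedge_def d_def insert_absorb)
    ultimately show ?thesis by (auto simp: e_def b0)
  qed
  have "chain (colon U {v}) (F - {v}) p e"
    unfolding chain_def
  proof (intro allI impI)
    fix P assume "e P \<noteq> 0"
    then have P: "v \<notin> P" "c P \<noteq> 0 \<or> b P \<noteq> 0" by (auto simp: e_eq split: if_splits)
    have eq: "(F - {v} - P) \<union> {v} = F - P" using v P(1) by auto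
    have "P \<subseteq> F \<and> card P = p \<and> F - P \<in> U"
      using P(2)
    proof
      assume "c P \<noteq> 0" then show ?thesis using c(1) by (auto simp: chain_def)
    next
      assume "b P \<noteq> 0"
      then have "P \<subseteq> F - {v}" "card P = p" "F - {v} - P \<in> U" using b(1) by (auto simp: chain_def)
      then show ?thesis using up unfolding upclosed_def by (meson Diff_mono Diff_subset order_refl subset_trans)
    qed
    then show "P \<subseteq> F - {v} \<and> card P = p \<and> F - {v} - P \<in> colon U {v}"
      using P(1) eq unfolding colon_def by auto
  qed
  moreover have "boundary e = (\<lambda>_. 0)"
    unfolding e_def using c(2) by (simp add: boundary_add)
  ultimately obtain w where w: "chain (colon U {v}) (F - {v}) (Suc p) w" "boundary w = e"
    using lk unfolding acyclic_at_def by metis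
  have jb: "chain U F (Suc p) (wedge v b)"
    unfolding chain_def
  proof (intro allI impI)
    fix P assume "wedge v b P \<noteq> 0"
    then have P: "v \<in> P" "b (P - {v}) \<noteq> 0" by (auto simp: wedge_def split: if_splits)
    then have "P - {v} \<subseteq> F - {v}" "card (P - {v}) = p" "F - {v} - (P - {v}) \<in> U"
      using b(1) unfolding chain_def by blast+
    moreover have "F - {v} - (P - {v}) = F - P" using P(1) by auto
    ultimately show "P \<subseteq> F \<and> card P = Suc p \<and> F - P \<in> U"
      using P(1) v card_Suc_Diff1[OF finite P(1)] by auto
  qed
  have ww: "chain U F (Suc p) w"
    unfolding chain_def
  proof (intro allI impI)
    fix P assume "w P \<noteq> 0"
    then have "P \<subseteq> F - {v}" "card P = Suc p" "F - {v} - P \<in> colon U {v}"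
      using w(1) unfolding chain_def by blast+
    moreover have "(F - {v} - P) \<union> {v} = F - P" using v calculation(1) by auto
    ultimately show "P \<subseteq> F \<and> card P = Suc p \<and> F - P \<in> U"
      unfolding colon_def by auto
  qed
  have "chain U F (Suc p) (\<lambda>P. w P - wedge v b P)"
    by (rule chain_diff[OF ww jb])
  moreover have "boundary (\<lambda>P. w P - wedge v b P) = c"
    by (simp add: boundary_diff w(2) e_def)
  ultimately show "\<exists>b. chain U F (Suc p) b \<and> boundary b = c" by blast
qed

text \<open>For squarefree monomial ideals this says that no multigraded Betti number \<open>\<beta>\<^bsub>p,F\<^esub>\<close> has \<open>card F - p > d\<close>.\<close>

definition regular_at :: "'k::comm_ring_1 itself \<Rightarrow> 'v::finite set set \<Rightarrow> 'v set \<Rightarrow> nat \<Rightarrow> bool" where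
  "regular_at K U F d \<longleftrightarrow> (\<forall>p. p + d < card F \<longrightarrow> acyclic_at K U F p)"

lemma regular_at_mono: "regular_at K U F d \<Longrightarrow> d \<le> e \<Longrightarrow> regular_at K U F e"
  by (auto simp: regular_at_def)

lemma regular_at_top:
  assumes "{} \<in> U" "upclosed U"
  shows "regular_at K U F d"
  unfolding regular_at_def
proof (intro allI impI)
  fix p assume "p + d < card F"
  then obtain z where "z \<in> F" by fastforce
  then show "acyclic_at K U F p"
    by (rule acyclic_at_cone) (use assms in \<open>auto simp: upclosed_def\<close>)
qed

lemma acyclic_at_empty:
  assumes "F \<notin> U" "upclosed U"
  shows "acyclic_at K U F p"
proof -
  have "F - P \<notin> U" for P using assms unfolding upclosed_def by blast
  then show ?thesis unfolding acyclic_at_def chain_def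
    by (metis boundary_zero ext)
qed

lemma regular_at_empty: "F \<notin> U \<Longrightarrow> upclosed U \<Longrightarrow> regular_at K U F d"
  by (simp add: regular_at_def acyclic_at_empty)

lemma acyclic_at_large: "card F < p \<Longrightarrow> acyclic_at K U F p"
  unfolding acyclic_at_def chain_def
  by (metis boundary_zero card_mono ext finite linorder_not_less)

text \<open>Both complexes live on one vertex fewer. For the colon \<open>p\<close> stays the same,
  so its bound has to be one better; for the deletion \<open>p\<close> drops as well, so its bound
  may stay.\<close>

lemma regular_at_step:
  assumes "upclosed U" "v \<in> F"
    and "regular_at K (colon U {v}) (F - {v}) d"
    and "regular_at K U (F - {v}) (Suc d)"
  shows "regular_at K U F (Suc d)"
  unfolding regular_at_def
proof (intro allI impI)
  fix p assume p: "p + Suc d < card F"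
  have c: "card F = Suc (card (F - {v}))" using assms(2) by (metis card_Suc_Diff1 finite)
  show "acyclic_at K U F p"
  proof (rule acyclic_at_step[OF assms(1,2)])
    show "acyclic_at K (colon U {v}) (F - {v}) p"
      using assms(3) p c by (simp add: regular_at_def)
    show "p = 0 \<or> acyclic_at K U (F - {v}) (p - 1)"
      using assms(4) p c by (cases p) (auto simp: regular_at_def)
  qed
qed

text \<open>When the ideal contains the variable \<open>y\<close>, the colon by \<open>y\<close> is
  the unit ideal and has no homology, so \<open>y\<close> can be put back without changing the
  bound. The induction puts \<open>Y\<close> back one vertex at a time; \<open>Z\<close> is the set
  of those already present.\<close>

lemma regular_at_remove:
  assumes "upclosed U" "\<And>y. y \<in> Y \<Longrightarrow> {y} \<in> U"
    and "regular_at K U (W - Y) (Suc d)"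
  shows "regular_at K U W (Suc d)"
proof -
  have "regular_at K U (W - (Y - Z)) (Suc d)" if "Z \<subseteq> Y" for Z
    using finite[of Z] that
  proof (induction Z rule: finite_induct)
    case empty then show ?case using assms(3) by simp
  next
    case (insert y Z)
    show ?case
    proof (cases "y \<in> W")
      case False
      then have "W - (Y - insert y Z) = W - (Y - Z)" by auto
      then show ?thesis using insert by simp
    next
      case True
      have eq: "W - (Y - insert y Z) - {y} = W - (Y - Z)" using insert by auto
      show ?thesis
      proof (rule regular_at_step[OF assms(1), of y])
        show "y \<in> W - (Y - insert y Z)" using True by auto
        show "regular_at K (colon U {y}) (W - (Y - insert y Z) - {y}) d"
          by (rule regular_at_top) (use assms insert in \<open>auto simp: upclosed_colon, simp add: colon_def\<close>)
        show "regular_at K U (W - (Y - insert y Z) - {y}) (Suc d)"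
          using insert eq by auto
      qed
    qed
  qed
  from this[of Y] show ?thesis by simp
qed

lemma acyclic_at_cong:
  fixes K :: "'k::comm_ring_1 itself" and F :: "'v::finite set"
  assumes "\<And>A. A \<subseteq> F \<Longrightarrow> A \<in> U \<longleftrightarrow> A \<in> U'"
  shows "acyclic_at K U F p = acyclic_at K U' F p"
proof -
  have "chain U F p (c :: 'v set \<Rightarrow> 'k) = chain U' F p c" for p c
    using assms unfolding chain_def by (metis Diff_subset)
  then show ?thesis by (simp add: acyclic_at_def)
qed

lemma regular_at_cong:
  assumes "\<And>A. A \<subseteq> F \<Longrightarrow> A \<in> U \<longleftrightarrow> A \<in> U'"
  shows "regular_at K U F d = regular_at K U' F d"
proof -
  have "acyclic_at K U F p = acyclic_at K U' F p" for p
    by (rule acyclic_at_cong) (rule assms)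
  then show ?thesis by (simp add: regular_at_def)
qed

section \<open>Matchings\<close>

lemma upclosed_colon_iff:
  "upclosed U \<Longrightarrow> A \<in> U \<Longrightarrow> A \<in> colon U B"
  unfolding upclosed_def colon_def by blast

text \<open>An ideal generated by the bases of a matroid has a linear resolution, because deletion
  and contraction lead to matroids again. Deletion only shrinks \<open>F\<close> and keeps the
  bases; contraction by an element \<open>v\<close> of some basis lowers the rank by one. Exchange
  is stated with the inserted element prescribed, as this is what moves \<open>v\<close> into a
  given basis.\<close>

lemma regular_at_matroid:
  fixes F :: "'v::finite set"
  assumes "\<And>B. B \<in> \<B> \<Longrightarrow> card B = r"
    and "\<And>B B' x. B \<in> \<B> \<Longrightarrow> B' \<in> \<B> \<Longrightarrow> x \<in> B - B' \<Longrightarrow> \<exists>y\<in>B' - B. insert x (B' - {y}) \<in> \<B>"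
  shows "regular_at K {A. \<exists>B\<in>\<B>. B \<subseteq> A} F r"
  using assms
proof (induction "card F" arbitrary: F r \<B> rule: less_induct)
  case less
  have up: "upclosed {A. \<exists>B\<in>\<C>. B \<subseteq> A}" for \<C> :: "'v set set" unfolding upclosed_def by blast
  show ?case
  proof (cases r)
    case 0
    show ?thesis
    proof (cases "\<B> = {}")
      case True
      then show ?thesis by (intro regular_at_empty[OF _ up]) auto
    next
      case False
      then have "{} \<in> \<B>" using less.prems(1) 0 by fastforce
      then show ?thesis by (intro regular_at_top[OF _ up]) auto
    qed
  next
    case (Suc q)
    show ?thesis
    proof (cases "\<exists>B\<in>\<B>. B \<subseteq> F")
      case False
      then show ?thesis by (intro regular_at_empty[OF _ up]) auto
    next
      case True
      then obtain B0 where B0: "B0 \<in> \<B>" "B0 \<subseteq> F" by auto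
      with less.prems(1)[of B0] Suc obtain v where v: "v \<in> B0" by fastforce
      let ?C = "{B - {v} | B. B \<in> \<B> \<and> v \<in> B}"
      have "card (F - {v}) < card F" using v B0 by (meson card_Diff1_less finite subsetD)
      note IH = less.hyps[OF this]
      have del: "regular_at K {A. \<exists>B\<in>\<B>. B \<subseteq> A} (F - {v}) (Suc q)"
        using IH[of \<B> r] less.prems Suc by simp
      have "regular_at K {A. \<exists>B\<in>?C. B \<subseteq> A} (F - {v}) q"
      proof (rule IH)
        fix B assume "B \<in> ?C"
        then show "card B = q" using less.prems(1) Suc by auto
      next
        fix B B' x assume a: "B \<in> ?C" "B' \<in> ?C" "x \<in> B - B'"
        then obtain C C' where C: "C \<in> \<B>" "v \<in> C" "B = C - {v}" "C' \<in> \<B>" "v \<in> C'" "B' = C' - {v}" by auto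
        then have "x \<in> C - C'" using a by auto
        from less.prems(2)[OF C(1) C(4) this] obtain y where y: "y \<in> C' - C" "insert x (C' - {y}) \<in> \<B>" by auto
        have "insert x (B' - {y}) = insert x (C' - {y}) - {v}" using C y a by auto
        moreover have "v \<in> insert x (C' - {y})" using C y by auto
        ultimately have "insert x (B' - {y}) \<in> ?C" using y(2) by blast
        then show "\<exists>y\<in>B' - B. insert x (B' - {y}) \<in> ?C" using y(1) C by blast
      qed
      moreover have "(\<exists>B\<in>?C. B \<subseteq> A) \<longleftrightarrow> (\<exists>B\<in>\<B>. B \<subseteq> A \<union> {v})" if "A \<subseteq> F - {v}" for A
      proof
        assume "\<exists>B\<in>?C. B \<subseteq> A" then show "\<exists>B\<in>\<B>. B \<subseteq> A \<union> {v}" by blast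
      next
        assume "\<exists>B\<in>\<B>. B \<subseteq> A \<union> {v}"
        then obtain B where B: "B \<in> \<B>" "B \<subseteq> A \<union> {v}" by auto
        show "\<exists>B\<in>?C. B \<subseteq> A"
        proof (cases "v \<in> B")
          case True
          then have "B - {v} \<in> ?C" using B(1) by blast
          moreover have "B - {v} \<subseteq> A" using B(2) by auto
          ultimately show ?thesis by (rule rev_bexI)
        next
          case False
          \<comment> \<open>A basis inside \<open>A \<union> {v}\<close> that misses
            \<open>v\<close> is exchanged against \<open>B0\<close> so as to contain
            \<open>v\<close>; hence the bases through \<open>v\<close> already generate the
            colon.\<close>
          from less.prems(2)[OF B0(1) B(1) DiffI[OF v False]]
          obtain y where y: "y \<in> B - B0" "insert v (B - {y}) \<in> \<B>" ..
          have "insert v (B - {y}) - {v} \<in> ?C"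
            using y(2) by (intro CollectI exI[of _ "insert v (B - {y})"] conjI) (rule refl, assumption, rule insertI1)
          moreover have "insert v (B - {y}) - {v} \<subseteq> A" using B(2) by auto
          ultimately show ?thesis by (rule rev_bexI)
        qed
      qed
      ultimately have lk: "regular_at K (colon {A. \<exists>B\<in>\<B>. B \<subseteq> A} {v}) (F - {v}) q"
        by (subst regular_at_cong[of _ _ "{A. \<exists>B\<in>?C. B \<subseteq> A}"]) (auto simp: colon_def)
      show ?thesis
        unfolding Suc by (rule regular_at_step[OF up _ lk del]) (use v B0 in auto)
    qed
  qed
qed

section \<open>Matchable sets and matching numbers\<close>

definition matchable :: "'v set set \<Rightarrow> nat \<Rightarrow> 'v set set" where
  "matchable E s = {A. \<exists>M. matching E M \<and> card M = s \<and> \<Union>M \<subseteq> A}"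

definition match_number_on :: "'v::finite set set \<Rightarrow> 'v set \<Rightarrow> nat" where
  "match_number_on E A = Max {card M | M. matching E M \<and> \<Union>M \<subseteq> A}"

lemma upclosed_matchable: "upclosed (matchable E s)"
  unfolding upclosed_def matchable_def by blast

lemma matching_subset: "matching E M \<Longrightarrow> N \<subseteq> M \<Longrightarrow> matching E N"
  unfolding matching_def by (meson pairwise_subset subset_trans)

lemma matching_insert:
  "matching E M \<Longrightarrow> e \<in> E \<Longrightarrow> e \<inter> \<Union>M = {} \<Longrightarrow> matching E (insert e M)"
  unfolding matching_def by (auto simp: pairwise_insert disjnt_def)

lemma matching_Union_Diff:
  "matching E M \<Longrightarrow> e \<in> M \<Longrightarrow> \<Union>(M - {e}) = \<Union>M - e"
  unfolding matching_def pairwise_def disjnt_def by blast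

text \<open>Subsets of matchings are matchings, so the sizes attained inside \<open>A\<close> are
  closed downwards and their maximum decides.\<close>

lemma matchable_iff:
  fixes E :: "'v::finite set set"
  shows "A \<in> matchable E s \<longleftrightarrow> s \<le> match_number_on E A"
proof -
  let ?S = "{card M | M. matching E M \<and> \<Union>M \<subseteq> A}"
  have "?S = card ` {M. matching E M \<and> \<Union>M \<subseteq> A}" by auto
  then have fin: "finite ?S" by simp
  have "matching E {}" by (simp add: matching_def)
  then have ne: "?S \<noteq> {}" by blast
  show ?thesis
  proof
    assume "A \<in> matchable E s"
    then have "s \<in> ?S" by (auto simp: matchable_def)
    then show "s \<le> match_number_on E A" unfolding match_number_on_def using fin by simp
  next
    assume s: "s \<le> match_number_on E A"
    have "match_number_on E A \<in> ?S" unfolding match_number_on_def using Max_in[OF fin ne] .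
    then obtain M where M: "matching E M" "\<Union>M \<subseteq> A" "match_number_on E A = card M" by auto
    then obtain N where "N \<subseteq> M" "card N = s" using s obtain_subset_with_card_n by metis
    then show "A \<in> matchable E s"
      unfolding matchable_def using matching_subset[OF M(1)] M(2) by blast
  qed
qed

lemma match_number_on_mono:
  fixes E :: "'v::finite set set"
  assumes "A \<subseteq> B" shows "match_number_on E A \<le> match_number_on E B"
  using matchable_iff[of A E "match_number_on E A"] matchable_iff[of B E "match_number_on E A"]
    upclosed_matchable[of E] assms unfolding upclosed_def by blast

lemma match_number_on_UNIV: "match_number_on E UNIV = match_number E"
  by (simp add: match_number_on_def match_number_def)

context
  fixes E :: "'v::finite set set"
  assumes graph: "simple_graph E"
begin

lemma edge_doubleton:
  assumes "e \<in> E" "x \<in> e" obtains y where "e = {x, y}" "x \<noteq> y"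
proof -
  have "card e = 2" using graph assms by (auto simp: simple_graph_def)
  then obtain a b where "e = {a, b}" "a \<noteq> b" by (auto simp: card_2_iff)
  then show ?thesis using that assms(2) by (cases "x = a") (auto simp: insert_commute)
qed

lemma edge_neq: "{x, y} \<in> E \<Longrightarrow> x \<noteq> y"
  using graph by (auto simp: simple_graph_def)

lemma edge_nonempty: "e \<in> E \<Longrightarrow> e \<noteq> {}"
  using graph by (auto simp: simple_graph_def)

lemma card_Union_matching:
  assumes "matching E M" shows "card (\<Union>M) = 2 * card M"
proof -
  have "card (\<Union>M) = (\<Sum>e\<in>M. card e)"
    using assms by (intro card_Union_disjoint) (auto simp: matching_def)
  also have "\<dots> = (\<Sum>e\<in>M. 2)"
    using assms graph by (intro sum.cong) (auto simp: matching_def simple_graph_def)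
  finally show ?thesis by simp
qed

lemma matchable_0 [simp]: "A \<in> matchable E 0"
  by (simp add: matchable_iff)

lemma matchable_Suc_iff: "A \<in> matchable E (Suc s) \<longleftrightarrow> (\<exists>e\<in>E. e \<subseteq> A \<and> A - e \<in> matchable E s)"
proof
  assume "A \<in> matchable E (Suc s)"
  then obtain M where M: "matching E M" "card M = Suc s" "\<Union>M \<subseteq> A" by (auto simp: matchable_def)
  then obtain e where e: "e \<in> M" by fastforce
  have "matching E (M - {e})" "card (M - {e}) = s" "\<Union>(M - {e}) \<subseteq> A - e"
    using M e matching_Union_Diff[OF M(1) e] matching_subset[OF M(1)] by auto
  then have "A - e \<in> matchable E s" unfolding matchable_def by blast
  moreover have "e \<in> E" "e \<subseteq> A" using M e by (auto simp: matching_def)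
  ultimately show "\<exists>e\<in>E. e \<subseteq> A \<and> A - e \<in> matchable E s" by blast
next
  assume "\<exists>e\<in>E. e \<subseteq> A \<and> A - e \<in> matchable E s"
  then obtain e where e: "e \<in> E" "e \<subseteq> A" "A - e \<in> matchable E s" by blast
  then obtain M where M: "e \<in> E" "e \<subseteq> A" "matching E M" "card M = s" "\<Union>M \<subseteq> A - e"
    unfolding matchable_def by blast
  have "e \<inter> \<Union>M = {}" using M(5) by blast
  then have "matching E (insert e M)" using matching_insert M by blast
  moreover have "e \<notin> M" using M(1,5) edge_nonempty by blast
  ultimately show "A \<in> matchable E (Suc s)"
    unfolding matchable_def using M by (intro CollectI exI[of _ "insert e M"]) auto
qed

section \<open>Edge ideals and second squarefree powers\<close>

lemma matchable_1_iff: "A \<in> matchable E (Suc 0) \<longleftrightarrow> (\<exists>e\<in>E. e \<subseteq> A)"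
  by (simp add: matchable_Suc_iff)

text \<open>The edge \<open>e\<close> extends every matching inside \<open>B\<close>. Each strict
  drop of the matching number in the inductions that follow comes from this.\<close>

lemma match_number_on_edge:
  assumes "e \<in> E" "e \<subseteq> A" "B \<subseteq> A - e"
  shows "match_number_on E B < match_number_on E A"
proof -
  have "B \<in> matchable E (match_number_on E B)" by (simp add: matchable_iff)
  then have "A - e \<in> matchable E (match_number_on E B)"
    using upclosed_matchable[of E] assms(3) unfolding upclosed_def by blast
  then have "A \<in> matchable E (Suc (match_number_on E B))"
    using assms matchable_Suc_iff by blast
  then show ?thesis by (simp add: matchable_iff Suc_le_eq)
qed

text \<open>For a vertex \<open>v\<close> of an edge \<open>{v, w}\<close>, the colon by
  \<open>v\<close> is generated by the neighbours of \<open>v\<close> and the edges avoiding them.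
  The neighbours can be removed at no cost, and losing \<open>v\<close> and \<open>w\<close> lowers
  the matching number, which pays for the better bound that the colon requires.\<close>

lemma regular_at_edges: "regular_at K (matchable E (Suc 0)) W (Suc (match_number_on E W))"
proof (induction "card W" arbitrary: W rule: less_induct)
  case less
  show ?case
  proof (cases "\<exists>e\<in>E. e \<subseteq> W")
    case False
    then show ?thesis by (intro regular_at_empty upclosed_matchable) (simp add: matchable_1_iff)
  next
    case True
    then obtain e v where e: "e \<in> E" "e \<subseteq> W" "v \<in> e" using edge_nonempty by blast
    then obtain w where w: "e = {v, w}" "v \<noteq> w" using edge_doubleton by blast
    have v: "v \<in> W" using e by auto
    define Y where "Y = {y. {v, y} \<in> E}"
    have lt: "match_number_on E (W - {v} - Y) < match_number_on E W"
      by (rule match_number_on_edge[OF e(1,2)]) (use e w in \<open>auto simp: Y_def\<close>)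
    then obtain m where m: "match_number_on E W = Suc m" by (cases "match_number_on E W") auto
    have del: "regular_at K (matchable E (Suc 0)) (W - {v}) (Suc (match_number_on E W))"
      using less[of "W - {v}"] v match_number_on_mono[of "W - {v}" W E]
      by (metis Diff_subset Suc_le_mono card_Diff1_less finite regular_at_mono)
    have "regular_at K (matchable E (Suc 0)) (W - {v} - Y) (Suc m)"
    proof (rule regular_at_mono)
      have "card (W - {v} - Y) < card W" by (rule psubset_card_mono) (use v in auto)
      then show "regular_at K (matchable E (Suc 0)) (W - {v} - Y) (Suc (match_number_on E (W - {v} - Y)))"
        by (rule less)
    qed (use lt m in simp)
    then have sub: "regular_at K (colon (matchable E (Suc 0)) {v}) (W - {v} - Y) (Suc m)"
    proof (subst regular_at_cong)
      fix A assume A: "A \<subseteq> W - {v} - Y"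
      have "e \<subseteq> A" if e: "e \<in> E" "e \<subseteq> A \<union> {v}" for e
      proof -
        have "v \<notin> e"
        proof
          assume "v \<in> e"
          then obtain u where "e = {v, u}" "v \<noteq> u" using edge_doubleton e by metis
          then show False using e A by (auto simp: Y_def)
        qed
        then show ?thesis using e(2) by auto
      qed
      then show "A \<in> colon (matchable E (Suc 0)) {v} \<longleftrightarrow> A \<in> matchable E (Suc 0)"
        by (auto simp: colon_def matchable_1_iff)
    qed
    have single: "{y} \<in> colon (matchable E (Suc 0)) {v}" if "y \<in> Y" for y
      unfolding colon_def mem_Collect_eq matchable_1_iff
      by (rule bexI[of _ "{v, y}"]) (use that in \<open>auto simp: Y_def\<close>)
    have lk: "regular_at K (colon (matchable E (Suc 0)) {v}) (W - {v}) (match_number_on E W)"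
      unfolding m by (rule regular_at_remove[OF upclosed_colon[OF upclosed_matchable] single sub])
    show ?thesis by (rule regular_at_step[OF upclosed_matchable v lk del])
  qed
qed

text \<open>
  The colon ideal of the second squarefree power by an edge is an edge ideal: its new edges are the
  pairs joined to the two ends of \<open>{a, b}\<close>.
\<close>

lemma matchable_2_edge_iff:
  assumes ab: "{a, b} \<in> E" and A: "a \<notin> A" "b \<notin> A"
  shows "A \<union> {a, b} \<in> matchable E 2 \<longleftrightarrow>
    (\<exists>e\<in>E. e \<subseteq> A) \<or> (\<exists>x\<in>A. \<exists>y\<in>A. x \<noteq> y \<and> {a, x} \<in> E \<and> {b, y} \<in> E)"
proof -
  have "A \<union> {a, b} \<in> matchable E 2 \<longleftrightarrow>
    (\<exists>e\<in>E. \<exists>f\<in>E. e \<subseteq> A \<union> {a, b} \<and> f \<subseteq> A \<union> {a, b} \<and> e \<inter> f = {})"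
  proof -
    have "f \<subseteq> X - e \<longleftrightarrow> f \<subseteq> X \<and> e \<inter> f = {}" for f e X :: "'v set" by blast
    then show ?thesis
      unfolding numeral_2_eq_2 matchable_Suc_iff[of _ "Suc 0"] matchable_1_iff by (simp only:) blast
  qed
  also have "\<dots> \<longleftrightarrow> (\<exists>e\<in>E. e \<subseteq> A) \<or> (\<exists>x\<in>A. \<exists>y\<in>A. x \<noteq> y \<and> {a, x} \<in> E \<and> {b, y} \<in> E)" (is "?L \<longleftrightarrow> ?R")
  proof
    assume ?L
    then obtain e f where ef: "e \<in> E" "f \<in> E" "e \<subseteq> A \<union> {a, b}" "f \<subseteq> A \<union> {a, b}" "e \<inter> f = {}" by blast
    show ?R
    proof (rule disjCI)
      assume n: "\<not> (\<exists>x\<in>A. \<exists>y\<in>A. x \<noteq> y \<and> {a, x} \<in> E \<and> {b, y} \<in> E)"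
      show "\<exists>e\<in>E. e \<subseteq> A"
      proof (rule ccontr)
        assume "\<not> ?thesis"
        then have "\<not> e \<subseteq> A" "\<not> f \<subseteq> A" using ef by auto
        then have "(a \<in> e \<and> b \<in> f) \<or> (a \<in> f \<and> b \<in> e)" using ef by blast
        then obtain g h where gh: "g \<in> E" "h \<in> E" "g \<subseteq> A \<union> {a, b}" "h \<subseteq> A \<union> {a, b}" "g \<inter> h = {}" "a \<in> g" "b \<in> h"
          using ef by (metis Int_commute)
        obtain x where x: "g = {a, x}" "a \<noteq> x" using edge_doubleton gh by blast
        obtain y where y: "h = {b, y}" "b \<noteq> y" using edge_doubleton gh by blast
        have "x \<in> A" "y \<in> A" "x \<noteq> y" using x y gh by auto
        then show False using n x y gh by blast
      qed
    qed
  next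
    assume ?R
    then show ?L
    proof
      assume "\<exists>e\<in>E. e \<subseteq> A"
      then obtain e where e: "e \<in> E" "e \<subseteq> A" by blast
      then have "e \<inter> {a, b} = {}" using A by auto
      then show ?L using e ab by blast
    next
      assume "\<exists>x\<in>A. \<exists>y\<in>A. x \<noteq> y \<and> {a, x} \<in> E \<and> {b, y} \<in> E"
      then obtain x y where xy: "x \<in> A" "y \<in> A" "x \<noteq> y" "{a, x} \<in> E" "{b, y} \<in> E" by blast
      have "{a, x} \<inter> {b, y} = {}" using xy A edge_neq[OF ab] by auto
      then show ?L using xy by (intro bexI[of _ "{a, x}"] bexI[of _ "{b, y}"]) auto
    qed
  qed
  finally show ?thesis .
qed

text \<open>The bound is two better than the one for the power itself. Without new edges the colon
  is an edge ideal on \<open>W\<close>, whose \<open>+ 1\<close> is paid for by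
  \<open>{a, b}\<close>, as this edge extends every matching in \<open>W\<close>. Otherwise an end
  \<open>x\<close> of a new edge is deleted, as for edge ideals.\<close>

lemma regular_at_colon_edge:
  assumes ab: "{a, b} \<in> E" and W: "a \<notin> W" "b \<notin> W"
  shows "regular_at K (colon (matchable E 2) {a, b}) W (match_number_on E (W \<union> {a, b}))"
  using W
proof (induction "card W" arbitrary: W rule: less_induct)
  case less
  note char = matchable_2_edge_iff[OF ab]
  let ?U = "colon (matchable E 2) {a, b}"
  show ?case
  proof (cases "\<exists>x\<in>W. \<exists>y\<in>W. x \<noteq> y \<and> {a, x} \<in> E \<and> {b, y} \<in> E")
    case False
    have "match_number_on E W < match_number_on E (W \<union> {a, b})"
      by (rule match_number_on_edge[OF ab]) (use less.prems in auto)
    then have "regular_at K (matchable E (Suc 0)) W (match_number_on E (W \<union> {a, b}))"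
      using regular_at_edges by (meson Suc_leI regular_at_mono)
    moreover have cong: "A \<in> ?U \<longleftrightarrow> A \<in> matchable E (Suc 0)" if "A \<subseteq> W" for A
      using char[of A] False that less.prems unfolding colon_def matchable_1_iff by blast
    ultimately show ?thesis by (subst regular_at_cong[OF cong])
  next
    case True
    then obtain x y where xy: "x \<in> W" "y \<in> W" "x \<noteq> y" "{a, x} \<in> E" "{b, y} \<in> E" by blast
    define Y where "Y = {z. {z, x} \<in> ?U}"
    \<comment> \<open>As \<open>x\<close> is joined to \<open>a\<close>, every other neighbour of
      \<open>b\<close> in \<open>W\<close> forms a new edge with \<open>x\<close>; for a neighbour
      of \<open>a\<close> the same follows when \<open>x\<close> is joined to \<open>b\<close>
      too.\<close>
    have yx: "{z, x} \<in> ?U"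
      if "z \<in> W" "{z, x} \<in> E \<or> z \<noteq> x \<and> {b, z} \<in> E \<or> z \<noteq> x \<and> {a, z} \<in> E \<and> {b, x} \<in> E" for z
    proof -
      have n: "a \<notin> {z, x}" "b \<notin> {z, x}" using that(1) less.prems xy(1) by auto
      show ?thesis
        unfolding colon_def mem_Collect_eq char[OF n] using that(2)
      proof (elim disjE conjE)
        assume "{z, x} \<in> E" then show "(\<exists>e\<in>E. e \<subseteq> {z, x}) \<or>
          (\<exists>x'\<in>{z, x}. \<exists>y'\<in>{z, x}. x' \<noteq> y' \<and> {a, x'} \<in> E \<and> {b, y'} \<in> E)" by blast
      qed (use xy(4) in auto)
    qed
    \<comment> \<open>The edges \<open>{a, x}\<close> and \<open>{b, y}\<close> both miss what is
      left, so the matching number drops by two: one unit pays for the \<open>+ 1\<close> of an edge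
      ideal, the other for the colon by \<open>x\<close>.\<close>
    have l1: "match_number_on E (W - {x} - Y) < match_number_on E (W \<union> {b} - {x})"
      by (rule match_number_on_edge[OF xy(5)])
        (use xy yx[of y] less.prems in \<open>auto simp: Y_def\<close>)
    have l2: "match_number_on E (W \<union> {b} - {x}) < match_number_on E (W \<union> {a, b})"
      by (rule match_number_on_edge[OF xy(4)]) (use xy less.prems edge_neq[OF ab] in auto)
    define m where "m = match_number_on E (W \<union> {a, b}) - 2"
    have m: "match_number_on E (W \<union> {a, b}) = Suc (Suc m)" "match_number_on E (W - {x} - Y) \<le> m"
      using l1 l2 by (auto simp: m_def)
    have del: "regular_at K ?U (W - {x}) (Suc (Suc m))"
    proof -
      have "card (W - {x}) < card W" using xy(1) by (meson card_Diff1_less finite)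
      from less.hyps[OF this] have "regular_at K ?U (W - {x}) (match_number_on E (W - {x} \<union> {a, b}))"
        using less.prems by auto
      moreover have "match_number_on E (W - {x} \<union> {a, b}) \<le> Suc (Suc m)"
        unfolding m(1)[symmetric] by (rule match_number_on_mono) auto
      ultimately show ?thesis by (rule regular_at_mono)
    qed
    have "regular_at K (matchable E (Suc 0)) (W - {x} - Y) (Suc m)"
      using regular_at_edges m(2) by (meson Suc_le_mono regular_at_mono)
    \<comment> \<open>No new edge survives outside \<open>Y\<close>: its end joined to
      \<open>b\<close> lies in \<open>Y\<close> unless that end is \<open>x\<close>, and then the
      other end lies in \<open>Y\<close>. Old edges through \<open>x\<close> end in \<open>Y\<close>
      as well.\<close>
    moreover have cong: "A \<in> colon ?U {x} \<longleftrightarrow> A \<in> matchable E (Suc 0)" if A: "A \<subseteq> W - {x} - Y" for A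
    proof
      assume "A \<in> matchable E (Suc 0)"
      then obtain e where "e \<in> E" "e \<subseteq> A" by (auto simp: matchable_1_iff)
      then have "insert x A \<union> {a, b} \<in> matchable E 2"
        using char[of "insert x A"] less.prems xy A by blast
      then show "A \<in> colon ?U {x}" by (simp add: colon_def)
    next
      assume "A \<in> colon ?U {x}"
      then have "insert x A \<union> {a, b} \<in> matchable E 2" by (simp add: colon_def)
      moreover have "a \<notin> insert x A" "b \<notin> insert x A" using A less.prems xy(1) by auto
      ultimately consider e where "e \<in> E" "e \<subseteq> insert x A"
        | x' y' where "x' \<in> insert x A" "y' \<in> insert x A" "x' \<noteq> y'" "{a, x'} \<in> E" "{b, y'} \<in> E"
        using char[of "insert x A"] by blast
      then show "A \<in> matchable E (Suc 0)"
      proof cases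
        case 1
        have "x \<notin> e"
        proof
          assume "x \<in> e"
          then obtain z where z: "e = {x, z}" "x \<noteq> z" using edge_doubleton 1 by blast
          then have "z \<in> A" using 1 by auto
          moreover have "{z, x} \<in> ?U" using yx[of z] z 1 A by (auto simp: insert_commute)
          ultimately show False using A by (auto simp: Y_def)
        qed
        then show ?thesis using 1 by (auto simp: matchable_1_iff)
      next
        case 2
        have "y' \<in> A \<Longrightarrow> False" using yx[of y'] 2 A by (auto simp: Y_def)
        then have "y' = x" using 2 by auto
        then have "x' \<in> A" using 2 by auto
        then show ?thesis using yx[of x'] 2 A \<open>y' = x\<close> by (auto simp: Y_def)
      qed
    qed
    ultimately have sub: "regular_at K (colon ?U {x}) (W - {x} - Y) (Suc m)"
      by (subst regular_at_cong[OF cong])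
    have single: "{y} \<in> colon ?U {x}" if "y \<in> Y" for y
      using that by (simp add: Y_def colon_def insert_commute)
    have lk: "regular_at K (colon ?U {x}) (W - {x}) (Suc m)"
      by (rule regular_at_remove[OF upclosed_colon[OF upclosed_colon[OF upclosed_matchable]] single sub])
    show ?thesis
      unfolding m(1) by (rule regular_at_step[OF _ xy(1) lk del]) (intro upclosed_colon upclosed_matchable)
  qed
qed

text \<open>Two nested inductions. For the colon by \<open>v\<close>, the neighbours
  \<open>u\<close> of \<open>v\<close> are deleted one by one, and each further colon by
  \<open>u\<close> is the colon by the edge \<open>{v, u}\<close>. When none is left,
  \<open>v\<close> cannot take part in a matching and the outer hypothesis applies; it is kept for
  all \<open>X \<subseteq> W - {v}\<close> because the inner induction may stop at any of
  them.\<close>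

lemma regular_at_two_edges: "regular_at K (matchable E 2) W (match_number_on E W + 2)"
proof (induction "card W" arbitrary: W rule: less_induct)
  case less
  show ?case
  proof (cases "\<exists>e\<in>E. e \<subseteq> W")
    case False
    then show ?thesis by (intro regular_at_empty upclosed_matchable) (auto simp: numeral_2_eq_2 matchable_Suc_iff)
  next
    case True
    then obtain e v where e: "e \<in> E" "e \<subseteq> W" "v \<in> e" using edge_nonempty by blast
    then obtain w where w: "e = {v, w}" "v \<noteq> w" using edge_doubleton by blast
    have v: "v \<in> W" using e by auto
    let ?n = "match_number_on E W"
    let ?U = "colon (matchable E 2) {v}"
    have IH: "regular_at K (matchable E 2) X (match_number_on E X + 2)" if "X \<subseteq> W - {v}" for X
      by (rule less) (use that v in \<open>auto intro!: psubset_card_mono\<close>)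
    have lk: "regular_at K ?U X (Suc ?n)" if "X \<subseteq> W - {v}" for X
      using that
    proof (induction "card X" arbitrary: X rule: less_induct)
      case (less X)
      show ?case
      proof (cases "\<exists>u\<in>X. {v, u} \<in> E")
        case True
        then obtain u where u: "u \<in> X" "{v, u} \<in> E" by blast
        have "regular_at K (colon (matchable E 2) {v, u}) (X - {u}) (match_number_on E (X - {u} \<union> {v, u}))"
          by (rule regular_at_colon_edge[OF u(2)]) (use less.prems in auto)
        moreover have "match_number_on E (X - {u} \<union> {v, u}) \<le> ?n"
          by (rule match_number_on_mono) (use less.prems u v in auto)
        moreover have "colon (matchable E 2) {v, u} = colon ?U {u}"
          by (simp add: colon_def insert_commute)
        ultimately have lk: "regular_at K (colon ?U {u}) (X - {u}) ?n"
          by (metis regular_at_mono)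
        have del: "regular_at K ?U (X - {u}) (Suc ?n)"
          by (rule less.hyps) (use u less.prems card_Diff1_less[OF finite u(1)] in auto)
        show ?thesis by (rule regular_at_step[OF _ u(1) lk del]) (intro upclosed_colon upclosed_matchable)
      next
        case False
        \<comment> \<open>Being a neighbour of \<open>v\<close>, the vertex \<open>w\<close> is
          outside \<open>X\<close>, so \<open>e\<close> extends every matching inside
          \<open>X\<close>. This makes up for the missing unit in the bound
          \<open>Suc ?n\<close>.\<close>
        have "match_number_on E X < ?n"
          by (rule match_number_on_edge[OF e(1,2)]) (use less.prems w False e in auto)
        then have "regular_at K (matchable E 2) X (Suc ?n)"
          using IH[OF less.prems] by (elim regular_at_mono) simp
        moreover have cong: "A \<in> ?U \<longleftrightarrow> A \<in> matchable E 2" if A: "A \<subseteq> X" for A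
        proof
          assume "A \<in> ?U"
          then have "A \<union> {v} \<in> matchable E 2" by (simp add: colon_def)
          then obtain M where M: "matching E M" "card M = 2" "\<Union>M \<subseteq> A \<union> {v}" by (auto simp: matchable_def)
          have "v \<notin> f" if "f \<in> M" for f
          proof
            assume "v \<in> f"
            have f: "f \<in> E" using M(1) that by (auto simp: matching_def)
            obtain u where u: "f = {v, u}" "v \<noteq> u" by (rule edge_doubleton[OF f \<open>v \<in> f\<close>])
            then have "u \<in> A" using M(3) that by auto
            then show False using False A f u(1) by auto
          qed
          then have "\<Union>M \<subseteq> A" using M(3) by blast
          then show "A \<in> matchable E 2" using M by (auto simp: matchable_def)
        qed (rule upclosed_colon_iff[OF upclosed_matchable])
        ultimately show ?thesis by (subst regular_at_cong[OF cong])
      qed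
    qed
    have del: "regular_at K (matchable E 2) (W - {v}) (Suc (Suc ?n))"
      using IH[of "W - {v}"] match_number_on_mono[of "W - {v}" W E] by (auto elim: regular_at_mono)
    have "regular_at K (matchable E 2) W (Suc (Suc ?n))"
      by (rule regular_at_step[OF upclosed_matchable v lk del]) simp
    then show ?thesis by simp
  qed
qed

section \<open>Near-perfect matchings and the matching matroid\<close>

lemma matching_avoiding:
  assumes "matching E M" shows "card M - card P \<le> card {e \<in> M. e \<inter> P = {}}"
proof -
  let ?f = "\<lambda>e. SOME x. x \<in> e \<inter> P"
  have f: "?f e \<in> e \<inter> P" if "e \<in> M" "e \<inter> P \<noteq> {}" for e
    using someI_ex[of "\<lambda>x. x \<in> e \<inter> P"] that by auto
  have "card {e \<in> M. e \<inter> P \<noteq> {}} \<le> card P"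
  proof (rule card_inj_on_le[of ?f])
    show "inj_on ?f {e \<in> M. e \<inter> P \<noteq> {}}"
    proof (rule inj_onI)
      fix e e' assume a: "e \<in> {e \<in> M. e \<inter> P \<noteq> {}}" "e' \<in> {e \<in> M. e \<inter> P \<noteq> {}}" "?f e = ?f e'"
      then have "?f e \<in> e" "?f e \<in> e'" using f[of e] f[of e'] by auto
      then show "e = e'" using a assms unfolding matching_def pairwise_def disjnt_def by blast
    qed
  qed (use f in auto)
  moreover have "card M = card {e \<in> M. e \<inter> P \<noteq> {}} + card {e \<in> M. e \<inter> P = {}}"
    by (subst card_Un_disjoint[symmetric]) (auto intro: arg_cong[of _ _ card])
  ultimately show ?thesis by linarith
qed

lemma regular_at_near_perfect:
  assumes "card F \<le> 2 * match_number_on E F + 1"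
  shows "regular_at K (matchable E s) F (match_number_on E F + s)"
  unfolding regular_at_def
proof (intro allI impI)
  let ?n = "match_number_on E F"
  fix p assume p: "p + (?n + s) < card F"
  have "F \<in> matchable E ?n" by (simp add: matchable_iff)
  then obtain M where M: "matching E M" "card M = ?n" "\<Union>M \<subseteq> F" by (auto simp: matchable_def)
  have key: "F - Q \<in> matchable E s" if "card (Q \<inter> \<Union>M) + s \<le> ?n" for Q
  proof -
    define L where "L = {e \<in> M. e \<inter> (Q \<inter> \<Union>M) = {}}"
    have "s \<le> card L"
      using matching_avoiding[OF M(1), of "Q \<inter> \<Union>M"] that M(2) unfolding L_def by linarith
    moreover have L: "matching E L" "\<Union>L \<subseteq> F - Q"
      using M matching_subset[OF M(1)] unfolding L_def by auto
    ultimately obtain N where N: "N \<subseteq> L" "card N = s" by (metis obtain_subset_with_card_n)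
    moreover have "matching E N" by (rule matching_subset[OF L(1) N(1)])
    moreover have "\<Union>N \<subseteq> F - Q" using Union_mono[OF N(1)] L(2) by (rule order_trans)
    ultimately show ?thesis unfolding matchable_def by blast
  qed
  show "acyclic_at K (matchable E s) F p"
  proof (cases "\<Union>M = F")
    case True
    then have c: "card F = 2 * ?n" using card_Union_matching[OF M(1)] M(2) by simp
    \<comment> \<open>Here \<open>card F = 2 * ?n\<close> gives \<open>p + s < ?n\<close>, which
      leaves room for one more destroyed edge, so any apex will do.\<close>
    obtain z where z: "z \<in> F" using p by fastforce
    show ?thesis
    proof (rule acyclic_at_cone[OF z])
      fix P :: "'v set" assume P: "card P = p"
      have "card (insert z P \<inter> \<Union>M) \<le> Suc p"
        using P card_mono[of "insert z P" "insert z P \<inter> \<Union>M"] card_insert_le_m1[of "Suc p" P z] by auto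
      then show "F - insert z P \<in> matchable E s" by (intro key) (use p c in linarith)
    qed
  next
    case False
    \<comment> \<open>Now only \<open>p + s \<le> ?n\<close> is known, which suffices because an
      apex outside the matching destroys no edge.\<close>
    then obtain z where z: "z \<in> F" "z \<notin> \<Union>M" using M(3) by auto
    show ?thesis
    proof (rule acyclic_at_cone[OF z(1)])
      fix P :: "'v set" assume P: "card P = p"
      have "insert z P \<inter> \<Union>M \<subseteq> P" using z by auto
      then have "card (insert z P \<inter> \<Union>M) \<le> p" using P by (metis card_mono finite)
      then show "F - insert z P \<in> matchable E s" by (intro key) (use p assms in linarith)
    qed
  qed
qed

text \<open>
  The dual form of basis exchange in the matching matroid: the element to be inserted is given.
  The alternating path is followed by deleting its first edge \<open>e\<close> together with both ends.
\<close>

lemma matching_exchange: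
  assumes "matching E M" "matching E M'" "card M = n" "card M' = n" "\<Union>M \<subseteq> F" "\<Union>M' \<subseteq> F"
    and "F \<notin> matchable E (Suc n)" and "x \<in> \<Union>M - \<Union>M'"
  shows "\<exists>y\<in>\<Union>M' - \<Union>M. \<exists>N. matching E N \<and> card N = n \<and> \<Union>N = insert x (\<Union>M' - {y})"
  using assms
proof (induction n arbitrary: M M' F x)
  case 0
  then show ?case by auto
next
  case (Suc n)
  obtain e where e: "e \<in> M" "x \<in> e" using Suc.prems by auto
  have eE: "e \<in> E" using e Suc.prems(1) by (auto simp: matching_def)
  obtain x1 where x1: "e = {x, x1}" "x \<noteq> x1" using edge_doubleton[OF eE e(2)] by blast
  \<comment> \<open>Otherwise \<open>e\<close> together with \<open>M'\<close> would be a matching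
    of size \<open>Suc (Suc n)\<close> inside \<open>F\<close>.\<close>
  have "x1 \<in> \<Union>M'"
  proof (rule ccontr)
    assume "x1 \<notin> \<Union>M'"
    then have "\<Union>M' \<subseteq> F - e" using x1 Suc.prems by auto
    then have "F - e \<in> matchable E (Suc n)" using Suc.prems by (auto simp: matchable_def)
    then have "F \<in> matchable E (Suc (Suc n))"
      using matchable_Suc_iff[of F "Suc n"] eE e Suc.prems(5) by blast
    then show False using Suc.prems(7) by simp
  qed
  then obtain e' where e': "e' \<in> M'" "x1 \<in> e'" by auto
  have e'E: "e' \<in> E" using e' Suc.prems(2) by (auto simp: matching_def)
  obtain x2 where x2: "e' = {x1, x2}" "x1 \<noteq> x2" using edge_doubleton[OF e'E e'(2)] by blast
  have U': "\<Union>(M' - {e'}) = \<Union>M' - e'" by (rule matching_Union_Diff[OF Suc.prems(2) e'(1)])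
  have U: "\<Union>(M - {e}) = \<Union>M - e" by (rule matching_Union_Diff[OF Suc.prems(1) e(1)])
  have m': "matching E (M' - {e'})" "card (M' - {e'}) = n"
    using Suc.prems e' matching_subset[OF Suc.prems(2)] by auto
  have m: "matching E (M - {e})" "card (M - {e}) = n"
    using Suc.prems e matching_subset[OF Suc.prems(1)] by auto
  have x2x: "x2 \<noteq> x" "x2 \<in> \<Union>M'" "x1 \<in> \<Union>M'" using x2 e' Suc.prems(8) by auto
  have ext: "\<exists>N. matching E N \<and> card N = Suc n \<and> \<Union>N = \<Union>L \<union> e"
    if "matching E L" "card L = n" "\<Union>L \<inter> e = {}" for L
  proof -
    have "e \<notin> L" using that(3) e by auto
    moreover have "matching E (insert e L)" using matching_insert[OF that(1) eE] that(3) by auto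
    ultimately show ?thesis using that by (intro exI[of _ "insert e L"]) auto
  qed
  show ?case
  proof (cases "x2 \<in> \<Union>M")
    \<comment> \<open>The alternating path ends at \<open>x2\<close>: replacing \<open>e'\<close> by
      \<open>e\<close> in \<open>M'\<close> trades \<open>x2\<close> for \<open>x\<close>.\<close>
    case False
    have "\<Union>(M' - {e'}) \<inter> e = {}" unfolding U' using x1 x2 Suc.prems(8) by auto
    from ext[OF m' this] obtain N where N: "matching E N" "card N = Suc n" "\<Union>N = \<Union>(M' - {e'}) \<union> e" by blast
    have "S - {x1, x2} \<union> {x, x1} = insert x (S - {x2})" if "x1 \<in> S" for S using x2(2) that by blast
    from this[OF x2x(3)] have "\<Union>M' - e' \<union> e = insert x (\<Union>M' - {x2})" unfolding x1(1) x2(1) .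
    then have "\<Union>N = insert x (\<Union>M' - {x2})" unfolding N(3) U' .
    then show ?thesis using N(1,2) False x2x(2) by blast
  next
    case True
    \<comment> \<open>The vertex \<open>x2\<close> takes over the role of \<open>x\<close> inside
      \<open>F - e\<close>. Maximality is inherited, since \<open>e\<close> would extend a larger
      matching of \<open>F - e\<close>.\<close>
    have "\<exists>y\<in>\<Union>(M' - {e'}) - \<Union>(M - {e}). \<exists>N. matching E N \<and> card N = n \<and> \<Union>N = insert x2 (\<Union>(M' - {e'}) - {y})"
    proof (rule Suc.IH[OF m(1) m'(1) m(2) m'(2), of "F - e"])
      show "\<Union>(M - {e}) \<subseteq> F - e" unfolding U using Suc.prems(5) by auto
      show "\<Union>(M' - {e'}) \<subseteq> F - e" unfolding U' using Suc.prems(6,8) x1 x2 by auto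
      show "F - e \<notin> matchable E (Suc n)"
        using matchable_Suc_iff[of F "Suc n"] eE e Suc.prems(5,7) by blast
      show "x2 \<in> \<Union>(M - {e}) - \<Union>(M' - {e'})" unfolding U U' using True x1 x2 x2x by auto
    qed
    then obtain y N where y: "y \<in> \<Union>(M' - {e'}) - \<Union>(M - {e})"
      and N: "matching E N" "card N = n" "\<Union>N = insert x2 (\<Union>(M' - {e'}) - {y})" by blast
    have "\<Union>N \<inter> e = {}" unfolding N(3) U' using x1 x2 x2x Suc.prems(8) by auto
    from ext[OF N(1,2) this] obtain L where L: "matching E L" "card L = Suc n" "\<Union>L = \<Union>N \<union> e" by blast
    have "insert x2 (S - {x1, x2} - {y}) \<union> {x, x1} = insert x (S - {y})"
      if "x1 \<in> S" "x2 \<in> S" "y \<notin> {x1, x2}" for S using that by blast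
    moreover have "y \<notin> {x1, x2}" using y[unfolded U'] x2(1) by blast
    ultimately have "insert x2 (\<Union>M' - e' - {y}) \<union> e = insert x (\<Union>M' - {y})"
      unfolding x1(1) x2(1) using x2x(2,3) by blast
    then have "\<Union>L = insert x (\<Union>M' - {y})" unfolding L(3) N(3) U' .
    moreover have "y \<in> \<Union>M' - \<Union>M" using y[unfolded U U'] x1 x2 Suc.prems(8) by auto
    ultimately show ?thesis using L(1,2) by blast
  qed
qed

text \<open>The generators are the vertex sets of maximum matchings, that is, the bases of a matroid
  of rank \<open>2 * match_number_on E F\<close>; this rank is the desired bound exactly when s
  equals the matching number.\<close>

lemma regular_at_maximum: "regular_at K (matchable E (match_number_on E F)) F (2 * match_number_on E F)"
proof -
  let ?n = "match_number_on E F"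
  let ?B = "{\<Union>M | M. matching E M \<and> card M = ?n \<and> \<Union>M \<subseteq> F}"
  have max: "F \<notin> matchable E (Suc ?n)" by (simp add: matchable_iff)
  have "regular_at K {A. \<exists>B\<in>?B. B \<subseteq> A} F (2 * ?n)"
  proof (rule regular_at_matroid)
    fix B assume "B \<in> ?B"
    then show "card B = 2 * ?n" using card_Union_matching by auto
  next
    fix B B' x assume a: "B \<in> ?B" "B' \<in> ?B" "x \<in> B - B'"
    then obtain M M' where M: "B = \<Union>M" "matching E M" "card M = ?n" "\<Union>M \<subseteq> F"
      "B' = \<Union>M'" "matching E M'" "card M' = ?n" "\<Union>M' \<subseteq> F" by auto
    obtain y N where "y \<in> \<Union>M' - \<Union>M" "matching E N" "card N = ?n" "\<Union>N = insert x (\<Union>M' - {y})"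
      using matching_exchange[OF M(2,6,3,7,4,8) max, of x] a(3) M(1,5) by blast
    moreover have "insert x (B' - {y}) \<subseteq> F" using a(3) M by auto
    ultimately show "\<exists>y\<in>B' - B. insert x (B' - {y}) \<in> ?B"
      unfolding M(1,5) by (metis (mono_tags, lifting) mem_Collect_eq)
  qed
  then show ?thesis
    by (subst regular_at_cong[of _ _ "{A. \<exists>B\<in>?B. B \<subseteq> A}"]) (auto simp: matchable_def, blast)
qed

theorem regular_at_matchable:
  assumes "card F \<le> 9" "1 \<le> s"
  shows "regular_at K (matchable E s) F (match_number_on E F + s)"
proof -
  let ?n = "match_number_on E F"
  consider "s > ?n" | "s = 1" | "s = 2" | "s = ?n" | "3 \<le> s" "s < ?n" using assms by linarith
  then show ?thesis
  proof cases
    case 1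
    then show ?thesis by (intro regular_at_empty upclosed_matchable) (simp add: matchable_iff)
  next
    case 2 then show ?thesis using regular_at_edges by simp
  next
    case 3 then show ?thesis using regular_at_two_edges by simp
  next
    case 4 then show ?thesis using regular_at_maximum[of K F] by (simp add: mult_2)
  next
    case 5 then show ?thesis using assms by (intro regular_at_near_perfect) linarith
  qed
qed

end

section \<open>Squarefree syzygies\<close>

text \<open>Coordinate vectors are functions on \<open>nat\<close> whose support is bounded
  separately, so that the free modules of all homological positions share one type.\<close>

interpretation coords: vector_space "\<lambda>(a::'k::field) (f::nat \<Rightarrow> 'k) k. a * f k"
  by unfold_locales (simp_all add: fun_eq_iff algebra_simps)

lemma sum_apply: "(\<Sum>i\<in>A. f i) x = (\<Sum>i\<in>A. f i x)" for f :: "'i \<Rightarrow> 'x \<Rightarrow> 'k::comm_monoid_add"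
  by (induction A rule: infinite_finite_induct) simp_all

text \<open>
  A submodule of a multigraded free module generated in squarefree degrees is given by its
  squarefree components, a monotone family of subspaces of the coordinate space.
\<close>

definition subspace_family :: "nat \<Rightarrow> ('v set \<Rightarrow> (nat \<Rightarrow> 'k::field) set) \<Rightarrow> bool" where
  "subspace_family r Z \<longleftrightarrow>
     (\<forall>F. coords.subspace (Z F)) \<and> (\<forall>F G. F \<subseteq> G \<longrightarrow> Z F \<subseteq> Z G) \<and> (\<forall>F. \<forall>z\<in>Z F. \<forall>k\<ge>r. z k = 0)"

text \<open>The map from the free module on \<open>L\<close> to the module that it generates. Within
  one multidegree its monomial factors are determined, so only scalars remain.\<close>

definition combine :: "('v set \<times> (nat \<Rightarrow> 'k::field)) list \<Rightarrow> (nat \<Rightarrow> 'k) \<Rightarrow> nat \<Rightarrow> 'k" where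
  "combine L v k = (\<Sum>l<length L. v l * snd (L ! l) k)"

definition free_part :: "('v set \<times> (nat \<Rightarrow> 'k::field)) list \<Rightarrow> 'v set \<Rightarrow> (nat \<Rightarrow> 'k) set" where
  "free_part L F = {v. \<forall>l. v l \<noteq> 0 \<longrightarrow> l < length L \<and> fst (L ! l) \<subseteq> F}"

definition syzygies :: "('v set \<times> (nat \<Rightarrow> 'k::field)) list \<Rightarrow> 'v set \<Rightarrow> (nat \<Rightarrow> 'k) set" where
  "syzygies L F = {v \<in> free_part L F. combine L v = (\<lambda>_. 0)}"

definition generates :: "('v set \<times> (nat \<Rightarrow> 'k::field)) list \<Rightarrow> ('v set \<Rightarrow> (nat \<Rightarrow> 'k) set) \<Rightarrow> bool" where
  "generates L Z \<longleftrightarrow> (\<forall>F. Z F = combine L ` free_part L F)"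

text \<open>Only in its own degree can generator \<open>l\<close> have a scalar as coefficient
  instead of a multiple of a variable; a nonzero scalar there would make the generator
  redundant.\<close>

definition minimal_generators :: "('v set \<times> (nat \<Rightarrow> 'k::field)) list \<Rightarrow> bool" where
  "minimal_generators L \<longleftrightarrow> (\<forall>l<length L. \<forall>v\<in>syzygies L (fst (L ! l)). v l = 0)"

definition family_chain ::
  "('v::finite set \<Rightarrow> (nat \<Rightarrow> 'k::field) set) \<Rightarrow> 'v set \<Rightarrow> nat \<Rightarrow> (nat \<Rightarrow> 'v set \<Rightarrow> 'k) \<Rightarrow> bool" where
  "family_chain Z F p c \<longleftrightarrow>
     (\<forall>P. (\<lambda>k. c k P) \<in> Z (F - P) \<and> (\<forall>k. c k P \<noteq> 0 \<longrightarrow> P \<subseteq> F \<and> card P = p))"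

text \<open>Vanishing of the Koszul homology of the submodule, hence of Tor with the residue field,
  in position \<open>p\<close> and multidegree \<open>F\<close>.\<close>

definition family_acyclic :: "('v::finite set \<Rightarrow> (nat \<Rightarrow> 'k::field) set) \<Rightarrow> 'v set \<Rightarrow> nat \<Rightarrow> bool" where
  "family_acyclic Z F p \<longleftrightarrow>
     (\<forall>c. family_chain Z F p c \<longrightarrow> (\<forall>k. boundary (c k) = (\<lambda>_. 0)) \<longrightarrow>
        (\<exists>b. family_chain Z F (Suc p) b \<and> (\<forall>k. boundary (b k) = c k)))"

section \<open>Minimal generators and dimension shifting\<close>

lemma zero_in_subspace_family: "subspace_family r Z \<Longrightarrow> (\<lambda>_. 0) \<in> Z F"
  unfolding subspace_family_def using coords.subspace_0[of "Z F"] by (simp add: zero_fun_def)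

lemma combine_add: "combine L (\<lambda>l. v l + w l) k = combine L v k + combine L w k"
  by (simp add: combine_def algebra_simps sum.distrib)

lemma combine_diff: "combine L (\<lambda>l. v l - w l) k = combine L v k - combine L w k"
  by (simp add: combine_def algebra_simps sum_subtractf)

lemma combine_scale: "combine L (\<lambda>l. a * v l) k = a * combine L v k"
  by (simp add: combine_def sum_distrib_left mult.assoc)

lemma combine_zero: "combine L (\<lambda>_. 0) = (\<lambda>_. 0)"
  by (simp add: combine_def fun_eq_iff)

lemma subspace_free_part: "coords.subspace (free_part L F)"
proof (rule coords.subspaceI)
  fix x y assume xy: "x \<in> free_part L F" "y \<in> free_part L F"
  have "l < length L \<and> fst (L ! l) \<subseteq> F" if "(x + y) l \<noteq> 0" for l
  proof -
    have "x l \<noteq> 0 \<or> y l \<noteq> 0" using that by auto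
    then show ?thesis using xy unfolding free_part_def by blast
  qed
  then show "x + y \<in> free_part L F" unfolding free_part_def by blast
qed (auto simp: free_part_def)

lemma free_part_mono: "F \<subseteq> G \<Longrightarrow> free_part L F \<subseteq> free_part L G"
  unfolding free_part_def by blast

lemma subspace_combine: "coords.subspace (combine L ` free_part L F)"
  unfolding coords.subspace_def
proof (intro conjI ballI allI)
  have z: "(0 :: nat \<Rightarrow> 'a) = combine L (\<lambda>_. 0)" by (simp add: combine_zero zero_fun_def)
  show "0 \<in> combine L ` free_part L F"
    unfolding z by (rule imageI) (simp add: free_part_def)
next
  fix x y assume "x \<in> combine L ` free_part L F" "y \<in> combine L ` free_part L F"
  then obtain v w where vw: "v \<in> free_part L F" "w \<in> free_part L F" "x = combine L v" "y = combine L w" by auto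
  have "v + w \<in> free_part L F" using coords.subspace_add[OF subspace_free_part] vw by blast
  moreover have "x + y = combine L (v + w)"
    using vw by (simp add: fun_eq_iff combine_add plus_fun_def)
  ultimately show "x + y \<in> combine L ` free_part L F" by blast
next
  fix a x assume "x \<in> combine L ` free_part L F"
  then obtain v where v: "v \<in> free_part L F" "x = combine L v" by auto
  have "(\<lambda>k. a * v k) \<in> free_part L F" using coords.subspace_scale[OF subspace_free_part v(1)] by blast
  moreover have "(\<lambda>k. a * x k) = combine L (\<lambda>k. a * v k)" using v by (simp add: fun_eq_iff combine_scale)
  ultimately show "(\<lambda>k. a * x k) \<in> combine L ` free_part L F" by blast
qed

lemma combine_unit: "l < length L \<Longrightarrow> combine L (\<lambda>j. if j = l then 1 else 0) = snd (L ! l)"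
  by (simp add: combine_def fun_eq_iff if_distrib[of "\<lambda>x. x * _"] cong: if_cong)

lemma unit_in_free_part: "l < length L \<Longrightarrow> fst (L ! l) \<subseteq> F \<Longrightarrow> (\<lambda>j. if j = l then 1 else 0) \<in> free_part L F"
  by (simp add: free_part_def)

lemma combine_fun: "combine L v = (\<Sum>l<length L. (\<lambda>k. v l * snd (L ! l) k))"
  by (simp add: fun_eq_iff combine_def sum_apply)

lemma subspace_family_syzygies: "subspace_family (length L) (syzygies L)"
  unfolding subspace_family_def
proof (intro conjI allI impI ballI)
  fix F
  show "coords.subspace (syzygies L F)"
    using subspace_free_part[of L F] unfolding coords.subspace_def syzygies_def
    by (auto simp: fun_eq_iff combine_add combine_scale plus_fun_def zero_fun_def combine_zero)
next
  fix F G :: "'a set" assume "F \<subseteq> G"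
  from free_part_mono[OF this, of L] show "syzygies L F \<subseteq> syzygies L G" unfolding syzygies_def by blast
next
  fix F z k assume "z \<in> syzygies L F" "length L \<le> k"
  then show "z k = 0" unfolding syzygies_def free_part_def using not_le by blast
qed

text \<open>A graded Nakayama argument carried out degree by degree. \<open>W F\<close> is what
  smaller degrees contribute in degree \<open>F\<close>; a basis of \<open>Z F\<close> is built over
  a spanning set \<open>B0 F\<close> of \<open>W F\<close>, and its new members \<open>G F\<close>
  are the generators of degree \<open>F\<close>.\<close>

lemma minimal_generators_exist:
  fixes Z :: "'v::finite set \<Rightarrow> (nat \<Rightarrow> 'k::field) set"
  assumes Z: "subspace_family r Z"
  shows "\<exists>L. generates L Z \<and> minimal_generators L \<and> (\<forall>F\<in>fst ` set L. \<not> family_acyclic Z F 0)"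
proof -
  have sub: "coords.subspace (Z F)" and mono: "F \<subseteq> G \<Longrightarrow> Z F \<subseteq> Z G"
    and supp: "z \<in> Z F \<Longrightarrow> k \<ge> r \<Longrightarrow> z k = 0" for F G z k
    using Z unfolding subspace_family_def by simp_all
  define W where "W = (\<lambda>F. coords.span (\<Union>x\<in>F. Z (F - {x})))"
  have WZ: "W F \<subseteq> Z F" for F
    unfolding W_def by (rule coords.span_minimal[OF _ sub]) (use mono in blast)
  have "\<exists>B0 B1. B0 \<subseteq> W F \<and> W F \<subseteq> coords.span B0 \<and> B0 \<subseteq> B1 \<and> B1 \<subseteq> Z F
      \<and> coords.independent B1 \<and> Z F \<subseteq> coords.span B1" for F
  proof -
    obtain B0 where B0: "B0 \<subseteq> W F" "coords.independent B0" "W F \<subseteq> coords.span B0"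
      using coords.maximal_independent_subset[of "W F"] by blast
    then have "B0 \<subseteq> Z F" using WZ by blast
    from coords.maximal_independent_subset_extend[OF this B0(2)]
    obtain B1 where "B0 \<subseteq> B1" "B1 \<subseteq> Z F" "coords.independent B1" "Z F \<subseteq> coords.span B1" by blast
    then show ?thesis using B0 by blast
  qed
  then obtain B0 B1 where B: "\<And>F. B0 F \<subseteq> W F" "\<And>F. W F \<subseteq> coords.span (B0 F)" "\<And>F. B0 F \<subseteq> B1 F"
    "\<And>F. B1 F \<subseteq> Z F" "\<And>F. coords.independent (B1 F)" "\<And>F. Z F \<subseteq> coords.span (B1 F)"
    by metis
  have fin: "finite (B1 F)" for F
  proof -
    let ?e = "\<lambda>i j. if j = i then 1 else (0::'k)"
    have "B1 F \<subseteq> coords.span (?e ` {..<r})"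
    proof
      fix z assume "z \<in> B1 F"
      then have z: "z \<in> Z F" using B(4) by blast
      have "z = (\<Sum>i<r. (\<lambda>k. z i * ?e i k))"
      proof
        fix k
        have "(\<Sum>i<r. z i * ?e i k) = (if k < r then z k else 0)"
          by (simp add: if_distrib[of "\<lambda>x. _ * x"] cong: if_cong)
        also have "\<dots> = z k" using supp[OF z] by (auto simp: not_less)
        finally show "z k = (\<Sum>i<r. (\<lambda>k. z i * ?e i k)) k" by (simp only: sum_apply)
      qed
      moreover have "(\<Sum>i<r. (\<lambda>k. z i * ?e i k)) \<in> coords.span (?e ` {..<r})"
        by (intro coords.span_sum coords.span_scale coords.span_base imageI) simp
      ultimately show "z \<in> coords.span (?e ` {..<r})" by simp
    qed
    then show ?thesis using coords.independent_span_bound[OF _ B(5)] by blast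
  qed
  define G where "G = (\<lambda>F. B1 F - B0 F)"
  have "finite (Sigma UNIV G)" using fin by (intro finite_SigmaI) (auto simp: G_def)
  then obtain L where L: "set L = Sigma UNIV G" "distinct L" using finite_distinct_list by blast
  have L_in: "snd (L ! l) \<in> G (fst (L ! l))" if "l < length L" for l
    using nth_mem[OF that] unfolding L(1) by (cases "L ! l") simp
  have snd_in: "snd (L ! l) \<in> Z (fst (L ! l))" if "l < length L" for l
    using L_in[OF that] B(4) unfolding G_def by blast
  have gen: "Z F = combine L ` free_part L F" for F
  proof
    show "combine L ` free_part L F \<subseteq> Z F"
    proof
      fix z assume "z \<in> combine L ` free_part L F"
      then obtain v where v: "v \<in> free_part L F" "z = combine L v" by blast
      have "(\<lambda>k. v l * snd (L ! l) k) \<in> Z F" if "l < length L" for l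
      proof (cases "v l = 0")
        case True then show ?thesis using zero_in_subspace_family[OF Z] by simp
      next
        case False
        then have "fst (L ! l) \<subseteq> F" using v by (simp add: free_part_def)
        then have "snd (L ! l) \<in> Z F" using snd_in[OF that] mono by blast
        then show ?thesis by (rule coords.subspace_scale[OF sub])
      qed
      then show "z \<in> Z F" unfolding v(2) combine_fun by (intro coords.subspace_sum[OF sub]) simp
    qed
    show "Z F \<subseteq> combine L ` free_part L F"
    proof (induction "card F" arbitrary: F rule: less_induct)
      case less
      let ?R = "combine L ` free_part L F"
      have "Z (F - {x}) \<subseteq> ?R" if "x \<in> F" for x
      proof -
        have "Z (F - {x}) \<subseteq> combine L ` free_part L (F - {x})"
          by (rule less) (use that card_Diff1_less[of F x] in simp)
        also have "\<dots> \<subseteq> ?R" by (intro image_mono free_part_mono) auto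
        finally show ?thesis .
      qed
      then have "W F \<subseteq> ?R" unfolding W_def by (intro coords.span_minimal[OF _ subspace_combine]) blast
      moreover have "G F \<subseteq> ?R"
      proof
        fix z assume "z \<in> G F"
        then have "(F, z) \<in> set L" using L by simp
        then obtain l where l: "l < length L" "L ! l = (F, z)" by (auto simp: in_set_conv_nth)
        then have "z = combine L (\<lambda>j. if j = l then 1 else 0)" using combine_unit[OF l(1)] by simp
        then show "z \<in> ?R" using unit_in_free_part[OF l(1), of F] l(2) by auto
      qed
      ultimately have "B1 F \<subseteq> ?R" using B(1)[of F] unfolding G_def by blast
      then have "coords.span (B1 F) \<subseteq> ?R" by (rule coords.span_minimal[OF _ subspace_combine])
      then show ?case using B(6) by blast
    qed
  qed
  \<comment> \<open>Dividing by \<open>v l\<close> would express \<open>?z\<close> through the rest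
    of the basis \<open>B1 F\<close>: other generators of degree \<open>F\<close> belong to that
    rest, and those of smaller degree lie in \<open>W F\<close>, which \<open>B0 F\<close>
    spans.\<close>
  have min: "v l = 0" if l: "l < length L" and v: "v \<in> syzygies L (fst (L ! l))" for l v
  proof (rule ccontr)
    assume v0: "v l \<noteq> 0"
    define F where "F = fst (L ! l)"
    let ?z = "snd (L ! l)"
    let ?t = "\<lambda>j. (\<lambda>k. v j * snd (L ! j) k)"
    have zG: "?z \<in> B1 F" "?z \<notin> B0 F" using L_in[OF l] by (auto simp: G_def F_def)
    have other: "?t j \<in> coords.span (B1 F - {?z})" if j: "j < length L" "j \<noteq> l" for j
    proof (cases "v j = 0")
      case True then show ?thesis using coords.span_zero[of "B1 F - {?z}"] by (simp add: zero_fun_def)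
    next
      case False
      then have sF: "fst (L ! j) \<subseteq> F" using v by (simp add: syzygies_def free_part_def F_def)
      have "snd (L ! j) \<in> coords.span (B1 F - {?z})"
      proof (cases "fst (L ! j) = F")
        case True
        then have "snd (L ! j) \<noteq> ?z" using L(2) j l F_def by (metis nth_eq_iff_index_eq prod_eqI)
        moreover have "snd (L ! j) \<in> B1 F" using L_in[OF j(1)] True by (simp add: G_def)
        ultimately show ?thesis by (intro coords.span_base) simp
      next
        case False
        then obtain x where x: "x \<in> F" "x \<notin> fst (L ! j)" using sF by blast
        then have "fst (L ! j) \<subseteq> F - {x}" using sF by blast
        then have "snd (L ! j) \<in> Z (F - {x})" using snd_in[OF j(1)] mono by blast
        then have "snd (L ! j) \<in> W F" unfolding W_def using x(1) by (intro coords.span_base) blast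
        then have "snd (L ! j) \<in> coords.span (B0 F)" using B(2) by blast
        moreover have "B0 F \<subseteq> B1 F - {?z}" using B(3)[of F] zG by blast
        ultimately show ?thesis using coords.span_mono by blast
      qed
      then show ?thesis by (rule coords.span_scale)
    qed
    have "combine L v = (\<lambda>_. 0)" using v by (simp add: syzygies_def)
    then have "?t l + (\<Sum>j\<in>{..<length L} - {l}. ?t j) = 0"
      unfolding combine_fun zero_fun_def using l by (subst (asm) sum.remove[of _ l]) auto
    then have "?t l = - (\<Sum>j\<in>{..<length L} - {l}. ?t j)" by (rule eq_neg_iff_add_eq_0[THEN iffD2])
    moreover have "- (\<Sum>j\<in>{..<length L} - {l}. ?t j) \<in> coords.span (B1 F - {?z})"
      by (intro coords.span_neg coords.span_sum other) auto
    ultimately have "?t l \<in> coords.span (B1 F - {?z})" by simp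
    from coords.span_scale[OF this, of "inverse (v l)"]
    have "?z \<in> coords.span (B1 F - {?z})" using v0 by (simp add: mult.assoc[symmetric])
    then show False using B(5)[of F] zG(1) unfolding coords.dependent_def by blast
  qed
  have "\<not> family_acyclic Z F 0" if F: "F \<in> fst ` set L" for F
  proof
    assume ac: "family_acyclic Z F 0"
    have "Z F \<subseteq> W F"
    proof
      fix z assume z: "z \<in> Z F"
      \<comment> \<open>The vector \<open>z\<close> placed on the empty face. A boundary on that
        face is a sum of elements of the \<open>Z (F - {x})\<close>, so exactness in position 0 puts
        \<open>z\<close> into \<open>W F\<close>.\<close>
      define c where "c = (\<lambda>k (P::'v set). if P = {} then z k else 0)"
      have "family_chain Z F 0 c"
        unfolding family_chain_def
      proof (intro allI conjI impI)
        fix P show "(\<lambda>k. c k P) \<in> Z (F - P)"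
          using z zero_in_subspace_family[OF Z] by (cases "P = {}") (simp_all add: c_def)
      qed (auto simp: c_def split: if_splits)
      moreover have "boundary (c k) = (\<lambda>_. 0)" for k
        by (simp add: boundary_def c_def fun_eq_iff)
      ultimately obtain b where b: "family_chain Z F (Suc 0) b" "\<And>k. boundary (b k) = c k"
        using ac unfolding family_acyclic_def by blast
      have "z k = (\<Sum>x\<in>UNIV. b k {x})" for k
        using fun_cong[OF b(2), of k "{}"] by (simp add: c_def boundary_def orientation_def)
      then have "z = (\<Sum>x\<in>UNIV. (\<lambda>k. b k {x}))" by (simp add: fun_eq_iff sum_apply)
      moreover have "(\<lambda>k. b k {x}) \<in> W F" for x
      proof (cases "x \<in> F")
        case True
        then show ?thesis using b(1) unfolding family_chain_def W_def
          by (intro coords.span_base) blast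
      next
        case False
        then have "(\<lambda>k. b k {x}) = 0" using b(1) unfolding family_chain_def zero_fun_def by blast
        then show ?thesis unfolding W_def by (simp add: coords.span_zero)
      qed
      ultimately show "z \<in> W F" unfolding W_def by (auto intro: coords.span_sum)
    qed
    obtain z where z: "z \<in> G F" using F unfolding L(1) by auto
    then have "z \<in> coords.span (B0 F)" using \<open>Z F \<subseteq> W F\<close> B(2,4) unfolding G_def by blast
    moreover have "B0 F \<subseteq> B1 F - {z}" using B(3)[of F] z unfolding G_def by blast
    ultimately have "z \<in> coords.span (B1 F - {z})" using coords.span_mono by blast
    then show False using B(5)[of F] z unfolding coords.dependent_def G_def by blast
  qed
  moreover have "generates L Z" unfolding generates_def by (intro allI gen)
  moreover have "minimal_generators L" unfolding minimal_generators_def by (intro allI impI ballI min)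
  ultimately show ?thesis by (intro exI[of _ L] conjI ballI)
qed

text \<open>Dimension shifting along \<open>0 \<rightarrow> syzygies L \<rightarrow> free_part L \<rightarrow> Z \<rightarrow> 0\<close>.\<close>

lemma family_acyclic_syzygies:
  fixes Z :: "'v::finite set \<Rightarrow> (nat \<Rightarrow> 'k::field) set"
  assumes gen: "generates L Z" and min: "minimal_generators L" and ac: "family_acyclic Z F (Suc p)"
  shows "family_acyclic (syzygies L) F p"
  unfolding family_acyclic_def
proof (intro allI impI)
  fix c assume c: "family_chain (syzygies L) F p c" and cyc: "\<forall>k. boundary (c k) = (\<lambda>_. 0)"
  have c_syz: "(\<lambda>l. c l P) \<in> syzygies L (F - P)" for P using c by (simp add: family_chain_def)
  have c_supp: "P \<subseteq> F \<and> card P = p \<and> l < length L \<and> fst (L ! l) \<subseteq> F - P" if "c l P \<noteq> 0" for l P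
    using c that c_syz[of P] unfolding family_chain_def syzygies_def free_part_def by blast
  \<comment> \<open>In degree \<open>F\<close> the generator \<open>l\<close> contributes the full
    simplex on \<open>F - fst (L ! l)\<close>. It is a cone unless this set is empty, and in that
    case minimality makes \<open>c l\<close> vanish.\<close>
  have "\<exists>b. boundary b = c l \<and>
      (\<forall>P. b P \<noteq> 0 \<longrightarrow> P \<subseteq> F \<and> card P = Suc p \<and> l < length L \<and> fst (L ! l) \<subseteq> F - P)" for l
  proof (cases "c l = (\<lambda>_. 0)")
    case True
    then show ?thesis by (intro exI[of _ "\<lambda>_. 0"]) simp
  next
    case False
    then obtain P0 where P0: "c l P0 \<noteq> 0" by blast
    have "fst (L ! l) \<noteq> F"
    proof
      assume eq: "fst (L ! l) = F"
      then have "P0 = {}" using c_supp[OF P0] by blast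
      then have "c l P0 = 0"
        using c_syz[of P0] min c_supp[OF P0] eq unfolding minimal_generators_def by auto
      then show False using P0 by simp
    qed
    then obtain z where z: "z \<in> F" "z \<notin> fst (L ! l)" using c_supp[OF P0] by blast
    show ?thesis
    proof (intro exI[of _ "wedge z (c l)"] conjI allI impI)
      show "boundary (wedge z (c l)) = c l"
      proof
        fix P show "boundary (wedge z (c l)) P = c l P"
          using boundary_wedge[of z "c l" P] cyc by (cases "z \<in> P") (simp_all add: wedge_def)
      qed
      fix P assume "wedge z (c l) P \<noteq> 0"
      then have P: "z \<in> P" "c l (P - {z}) \<noteq> 0" by (auto simp: wedge_def split: if_splits)
      from c_supp[OF P(2)] z P(1) card_Suc_Diff1[OF finite P(1)]
      show "P \<subseteq> F" "card P = Suc p" "l < length L" "fst (L ! l) \<subseteq> F - P" by auto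
    qed
  qed
  then obtain b where b: "\<And>l. boundary (b l) = c l"
    and b_supp: "\<And>l P. b l P \<noteq> 0 \<Longrightarrow> P \<subseteq> F \<and> card P = Suc p \<and> l < length L \<and> fst (L ! l) \<subseteq> F - P"
    by metis
  have b_free: "(\<lambda>l. b l P) \<in> free_part L (F - P)" for P using b_supp by (simp add: free_part_def)
  have bc: "boundary (\<lambda>P. combine L (\<lambda>l. a l P) k) = (\<lambda>P. combine L (\<lambda>l. boundary (a l) P) k)"
    for a :: "nat \<Rightarrow> 'v set \<Rightarrow> 'k" and k
    unfolding combine_def boundary_sum by (simp add: mult.commute[of _ "snd _ _"] boundary_scale)
  \<comment> \<open>The connecting map: the filling \<open>b\<close> need not consist of syzygies,
    and its image \<open>y\<close> measures the failure. Filling \<open>y\<close> in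
    \<open>Z\<close> and lifting the result gives the correction of \<open>b\<close>.\<close>
  define y where "y = (\<lambda>k P. combine L (\<lambda>l. b l P) k)"
  have "family_chain Z F (Suc p) y"
    unfolding family_chain_def
  proof (intro allI conjI impI)
    fix P show "(\<lambda>k. y k P) \<in> Z (F - P)"
      using gen b_free unfolding generates_def y_def by (auto simp: eta_contract_eq)
    fix k assume "y k P \<noteq> 0"
    then have "\<exists>l. b l P \<noteq> 0" by (rule contrapos_np) (simp add: y_def combine_def)
    then obtain l where "b l P \<noteq> 0" ..
    then show "P \<subseteq> F" "card P = Suc p" using b_supp by blast+
  qed
  moreover have "boundary (y k) = (\<lambda>_. 0)" for k
  proof -
    have "boundary (y k) = (\<lambda>P. combine L (\<lambda>l. c l P) k)" unfolding y_def bc b ..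
    also have "\<dots> = (\<lambda>_. 0)" using c_syz by (simp add: syzygies_def fun_eq_iff)
    finally show ?thesis .
  qed
  ultimately obtain w where w: "family_chain Z F (Suc (Suc p)) w" "\<And>k. boundary (w k) = y k"
    using ac unfolding family_acyclic_def by blast
  \<comment> \<open>The lift is taken to be zero where \<open>w\<close> is, which keeps it on the
    faces of size \<open>Suc (Suc p)\<close>.\<close>
  have "\<exists>u. u \<in> free_part L (F - P) \<and> combine L u = (\<lambda>k. w k P) \<and>
      (\<forall>l. u l \<noteq> 0 \<longrightarrow> P \<subseteq> F \<and> card P = Suc (Suc p))" for P
  proof (cases "(\<lambda>k. w k P) = (\<lambda>_. 0)")
    case True
    then show ?thesis
      by (intro exI[of _ "\<lambda>_. 0"]) (simp add: combine_zero free_part_def)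
  next
    case False
    then obtain k where "w k P \<noteq> 0" by blast
    then have "P \<subseteq> F \<and> card P = Suc (Suc p)" using w(1) by (auto simp: family_chain_def)
    moreover have "(\<lambda>k. w k P) \<in> combine L ` free_part L (F - P)"
      using w(1) gen unfolding family_chain_def generates_def by blast
    ultimately show ?thesis by auto
  qed
  then obtain u where u: "\<And>P. u P \<in> free_part L (F - P)" "\<And>P. combine L (u P) = (\<lambda>k. w k P)"
    "\<And>P l. u P l \<noteq> 0 \<Longrightarrow> P \<subseteq> F \<and> card P = Suc (Suc p)"
    by metis
  define b' where "b' = (\<lambda>l P. b l P - boundary (\<lambda>P. u P l) P)"
  have bu: "P \<subseteq> F \<and> card P = Suc p \<and> l < length L \<and> fst (L ! l) \<subseteq> F - P" if nz: "boundary (\<lambda>P. u P l) P \<noteq> 0" for l P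
  proof -
    have "\<exists>x\<in>- P. u (insert x P) l \<noteq> 0"
      using nz by (rule contrapos_np) (simp add: boundary_def)
    then obtain x where x: "x \<in> - P" "u (insert x P) l \<noteq> 0" ..
    then have "insert x P \<subseteq> F" "card (insert x P) = Suc (Suc p)" "l < length L" "fst (L ! l) \<subseteq> F - insert x P"
      using u(1)[of "insert x P"] u(3) unfolding free_part_def by blast+
    then show ?thesis using x(1) by auto
  qed
  have b'_supp: "P \<subseteq> F \<and> card P = Suc p \<and> l < length L \<and> fst (L ! l) \<subseteq> F - P" if "b' l P \<noteq> 0" for l P
  proof -
    have "b l P \<noteq> 0 \<or> boundary (\<lambda>P. u P l) P \<noteq> 0" using that unfolding b'_def by auto
    then show ?thesis using bu b_supp by blast
  qed
  have "family_chain (syzygies L) F (Suc p) b'"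
    unfolding family_chain_def
  proof (intro allI conjI impI)
    fix P
    have "combine L (\<lambda>l. b' l P) k = 0" for k
    proof -
      have "combine L (\<lambda>l. b' l P) k = y k P - combine L (\<lambda>l. boundary (\<lambda>P. u P l) P) k"
        by (simp add: b'_def combine_diff y_def)
      also have "combine L (\<lambda>l. boundary (\<lambda>P. u P l) P) k = boundary (w k) P"
        using fun_cong[OF bc[of "\<lambda>l P. u P l" k], of P] u(2) by (simp add: eta_contract_eq)
      finally show ?thesis using w(2) by simp
    qed
    then show "(\<lambda>k. b' k P) \<in> syzygies L (F - P)"
      using b'_supp by (auto simp: syzygies_def free_part_def)
  next
    fix P k assume "b' k P \<noteq> 0"
    then show "P \<subseteq> F" "card P = Suc p" using b'_supp by blast+
  qed
  moreover have "boundary (b' l) = c l" for l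
    unfolding b'_def by (simp add: boundary_diff b)
  ultimately show "\<exists>b. family_chain (syzygies L) F (Suc p) b \<and> (\<forall>k. boundary (b k) = c k)" by blast
qed

section \<open>Iterated syzygies of a squarefree monomial ideal\<close>

definition principal_family :: "'v set set \<Rightarrow> 'v set \<Rightarrow> (nat \<Rightarrow> 'k::field) set" where
  "principal_family U F = {f. \<forall>k. f k \<noteq> 0 \<longrightarrow> k = 0 \<and> F \<in> U}"

lemma subspace_family_principal: "upclosed U \<Longrightarrow> subspace_family 1 (principal_family U)"
  unfolding subspace_family_def principal_family_def coords.subspace_def upclosed_def
  by (auto, metis add.right_neutral add_0)

lemma family_acyclic_principal:
  assumes "acyclic_at (K :: 'k::field itself) U F p" "upclosed U"
  shows "family_acyclic (principal_family U :: _ \<Rightarrow> (nat \<Rightarrow> 'k) set) F p"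
  unfolding family_acyclic_def
proof (intro allI impI)
  fix c :: "nat \<Rightarrow> 'a set \<Rightarrow> 'k"
  assume c: "family_chain (principal_family U) F p c" and cyc: "\<forall>k. boundary (c k) = (\<lambda>_. 0)"
  have supp: "k = 0 \<and> F - P \<in> U \<and> P \<subseteq> F \<and> card P = p" if "c k P \<noteq> 0" for k P
    using c that unfolding family_chain_def principal_family_def by blast
  have "chain U F p (c 0)" using supp by (auto simp: chain_def)
  then obtain b where b: "chain U F (Suc p) b" "boundary b = c 0"
    using assms(1) cyc unfolding acyclic_at_def by metis
  show "\<exists>b. family_chain (principal_family U) F (Suc p) b \<and> (\<forall>k. boundary (b k) = c k)"
  proof (intro exI[of _ "\<lambda>k. if k = 0 then b else (\<lambda>_. 0)"] conjI allI)
    show "family_chain (principal_family U) F (Suc p) (\<lambda>k. if k = 0 then b else (\<lambda>_. 0))"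
      using b(1) unfolding family_chain_def principal_family_def chain_def by auto
    fix k
    have "c k = (\<lambda>_. 0)" if "k \<noteq> 0" using supp that by blast
    then show "boundary (if k = 0 then b else (\<lambda>_. 0)) = c k" using b(2) by simp
  qed
qed

theorem squarefree_resolution:
  fixes U :: "'v::finite set set"
  assumes U: "upclosed U"
  obtains L :: "nat \<Rightarrow> ('v set \<times> (nat \<Rightarrow> 'k::field)) list"
  where "generates (L 0) (principal_family U)" "\<And>i. generates (L (Suc i)) (syzygies (L i))"
    "\<And>i. minimal_generators (L i)"
    "\<And>i F. F \<in> fst ` set (L i) \<Longrightarrow> \<not> acyclic_at TYPE('k) U F i"
proof -
  \<comment> \<open>Exactness of the ideal in position \<open>i + p\<close> is carried over to the
    i-th syzygies in position \<open>p\<close>. A generator of degree \<open>F\<close> contradicts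
    exactness at \<open>p = 0\<close>, so \<open>U\<close> has homology in position \<open>i\<close>
    there.\<close>
  define good where "good = (\<lambda>i (ZL :: ('v set \<Rightarrow> (nat \<Rightarrow> 'k) set) \<times> ('v set \<times> (nat \<Rightarrow> 'k)) list).
    (\<forall>F p. acyclic_at TYPE('k) U F (i + p) \<longrightarrow> family_acyclic (fst ZL) F p) \<and>
    generates (snd ZL) (fst ZL) \<and> minimal_generators (snd ZL) \<and>
    (\<forall>F\<in>fst ` set (snd ZL). \<not> family_acyclic (fst ZL) F 0) \<and>
    (i = 0 \<longrightarrow> fst ZL = principal_family U))"
  have base: "\<exists>ZL. good 0 ZL"
  proof -
    obtain L :: "('v set \<times> (nat \<Rightarrow> 'k)) list" where
      "generates L (principal_family U)" "minimal_generators L"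
      "\<forall>F\<in>fst ` set L. \<not> family_acyclic (principal_family U :: _ \<Rightarrow> (nat \<Rightarrow> 'k) set) F 0"
      using minimal_generators_exist[OF subspace_family_principal[OF U]] by blast
    then have "good 0 (principal_family U, L)"
      using family_acyclic_principal[OF _ U] unfolding good_def by auto
    then show ?thesis by blast
  qed
  have step: "\<exists>ZL'. good (Suc i) ZL' \<and> fst ZL' = syzygies (snd ZL)" if g: "good i ZL" for i ZL
  proof -
    let ?Z = "syzygies (snd ZL)"
    obtain L where L: "generates L ?Z" "minimal_generators L" "\<forall>F\<in>fst ` set L. \<not> family_acyclic ?Z F 0"
      using minimal_generators_exist[OF subspace_family_syzygies] by blast
    have "family_acyclic ?Z F p" if a: "acyclic_at TYPE('k) U F (Suc i + p)" for F p
    proof (rule family_acyclic_syzygies)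
      show "generates (snd ZL) (fst ZL)" "minimal_generators (snd ZL)" using g by (auto simp: good_def)
      have "acyclic_at TYPE('k) U F (i + Suc p)" using a by simp
      then show "family_acyclic (fst ZL) F (Suc p)" using g unfolding good_def by blast
    qed
    then have "good (Suc i) (?Z, L)" using L unfolding good_def by auto
    then show ?thesis by (intro exI[of _ "(?Z, L)"]) simp
  qed
  obtain f where f: "\<And>i. good i (f i)" "\<And>i. fst (f (Suc i)) = syzygies (snd (f i))"
    using dependent_nat_choice[of good "\<lambda>i x y. fst y = syzygies (snd x)"] base step by blast
  show ?thesis
  proof (rule that[of "\<lambda>i. snd (f i)"])
    show "generates (snd (f 0)) (principal_family U)" using f(1)[of 0] unfolding good_def by metis
    show "generates (snd (f (Suc i))) (syzygies (snd (f i)))" for i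
      using f(1)[of "Suc i"] f(2)[of i] unfolding good_def by metis
    show "minimal_generators (snd (f i))" for i using f(1)[of i] by (simp add: good_def)
    show "\<not> acyclic_at TYPE('k) U F i" if "F \<in> fst ` set (snd (f i))" for F i
    proof
      assume "acyclic_at TYPE('k) U F i"
      then have "family_acyclic (fst (f i)) F 0" using f(1)[of i] unfolding good_def by (metis add.right_neutral)
      then show False using f(1)[of i] that unfolding good_def by blast
    qed
  qed
qed

section \<open>Minimal resolutions of squarefree monomial ideals\<close>

definition squarefree_monomial :: "'v::finite set \<Rightarrow> 'v monomial" where
  "squarefree_monomial F = (\<Sum>x\<in>F. Poly_Mapping.single x 1)"

lemma lookup_squarefree_monomial [simp]:
  "Poly_Mapping.lookup (squarefree_monomial F) x = (if x \<in> F then 1 else 0)"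
proof -
  have "Poly_Mapping.lookup (squarefree_monomial F) x = (\<Sum>y\<in>F. if y = x then 1 else 0)"
    unfolding squarefree_monomial_def lookup_sum by (intro sum.cong) (auto simp: lookup_single when_def)
  then show ?thesis by simp
qed

lemma keys_squarefree_monomial [simp]: "Poly_Mapping.keys (squarefree_monomial F) = F"
  by (auto simp: in_keys_iff split: if_splits)

lemma squarefree_monomial_empty [simp]: "squarefree_monomial {} = 0"
  by (simp add: squarefree_monomial_def)

lemma squarefree_monomial_add_diff:
  assumes "F \<subseteq> Poly_Mapping.keys a"
  shows "squarefree_monomial F + (a - squarefree_monomial F) = a"
proof (rule poly_mapping_eqI)
  fix x
  have "x \<in> F \<Longrightarrow> Poly_Mapping.lookup a x \<ge> 1" using assms by (force simp: in_keys_iff)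
  then show "Poly_Mapping.lookup (squarefree_monomial F + (a - squarefree_monomial F)) x = Poly_Mapping.lookup a x"
    by (simp add: lookup_add lookup_minus)
qed

lemma keys_monomial_add: "Poly_Mapping.keys (a + b) = Poly_Mapping.keys a \<union> Poly_Mapping.keys b"
  for a b :: "'v \<Rightarrow>\<^sub>0 nat"
  by (auto simp: in_keys_iff lookup_add)

lemma total_degree_add: "total_degree (a + b) = total_degree a + total_degree b"
  by (simp add: total_degree_def lookup_add sum.distrib)

lemma total_degree_squarefree_monomial: "total_degree (squarefree_monomial F) = card F"
proof -
  have "total_degree (squarefree_monomial F) = (\<Sum>x\<in>UNIV \<inter> F. 1)"
    by (subst sum.inter_restrict) (simp_all add: total_degree_def)
  then show ?thesis by simp
qed

lemma lookup_single_mult: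
  fixes p :: "('v, 'k::field) polynomial"
  shows "Poly_Mapping.lookup (Poly_Mapping.single m c * p) (m + b) = c * Poly_Mapping.lookup p b"
proof -
  have "Poly_Mapping.lookup (Poly_Mapping.single m c * p) (m + b) =
    (\<Sum>l. (c * (\<Sum>q. Poly_Mapping.lookup p q when m + b = l + q)) when l = m)"
    unfolding lookup_mult lookup_single
    by (rule arg_cong[of _ _ Sum_any]) (auto simp: fun_eq_iff when_def)
  also have "\<dots> = c * (\<Sum>q. Poly_Mapping.lookup p q when m + b = m + q)" by simp
  also have "\<dots> = c * Poly_Mapping.lookup p b" by simp
  finally show ?thesis .
qed

lemma lookup_single_mult_not_dvd:
  fixes p :: "('v, 'k::field) polynomial"
  assumes "\<And>b. a \<noteq> m + b"
  shows "Poly_Mapping.lookup (Poly_Mapping.single m c * p) a = 0"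
proof (rule ccontr)
  assume "Poly_Mapping.lookup (Poly_Mapping.single m c * p) a \<noteq> 0"
  then have "a \<in> Poly_Mapping.keys (Poly_Mapping.single m c * p)" by (simp add: in_keys_iff)
  then show False using keys_mult[of "Poly_Mapping.single m c" p] assms by (auto split: if_splits)
qed

text \<open>
  A list \<open>L\<close> stands for the free module with basis elements of multidegrees \<open>fst (L ! k)\<close>;
  \<open>component L v a\<close> is the part of multidegree \<open>a\<close> of its element \<open>v\<close>.
\<close>

definition component ::
  "('v::finite set \<times> (nat \<Rightarrow> 'k::field)) list \<Rightarrow> ('v, 'k::field) polynomial vec \<Rightarrow> 'v monomial \<Rightarrow> nat \<Rightarrow> 'k" where
  "component L v a k =
     (if k < length L \<and> fst (L ! k) \<subseteq> Poly_Mapping.keys a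
      then Poly_Mapping.lookup (v $ k) (a - squarefree_monomial (fst (L ! k))) else 0)"

text \<open>For generators lying in \<open>free_part L'\<close> a nonzero coefficient forces
  \<open>fst (L' ! k) \<subseteq> fst (L ! l)\<close>, and then the set difference is the quotient
  of the two squarefree monomials.\<close>

definition syzygy_matrix ::
  "('v::finite set \<times> (nat \<Rightarrow> 'k::field)) list \<Rightarrow> ('v set \<times> (nat \<Rightarrow> 'k::field)) list \<Rightarrow> ('v, 'k) polynomial mat" where
  "syzygy_matrix L' L = mat (length L') (length L) (\<lambda>(k, l).
     Poly_Mapping.single (squarefree_monomial (fst (L ! l) - fst (L' ! k))) (snd (L ! l) k))"

lemma syzygy_matrix_carrier [simp]: "syzygy_matrix L' L \<in> carrier_mat (length L') (length L)"
  by (simp add: syzygy_matrix_def)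

lemma syzygy_matrix_mult_carrier [simp]: "syzygy_matrix L' L *\<^sub>v v \<in> carrier_vec (length L')"
  by (rule carrier_vecI) (simp add: syzygy_matrix_def)

lemma component_free_part: "component L v a \<in> free_part L (Poly_Mapping.keys a)"
  by (auto simp: component_def free_part_def split: if_splits)

lemma component_eqI:
  fixes v w :: "('v::finite, 'k::field) polynomial vec"
  assumes "v \<in> carrier_vec (length L)" "w \<in> carrier_vec (length L)" "\<And>a. component L v a = component L w a"
  shows "v = w"
proof (rule eq_vecI)
  fix k assume k: "k < dim_vec w"
  show "v $ k = w $ k"
  proof (rule poly_mapping_eqI)
    fix m
    let ?a = "squarefree_monomial (fst (L ! k)) + m"
    have "component L u ?a k = Poly_Mapping.lookup (u $ k) m" for u :: "('v, 'k) polynomial vec"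
      using k assms(2) by (simp add: component_def keys_monomial_add)
    then show "Poly_Mapping.lookup (v $ k) m = Poly_Mapping.lookup (w $ k) m"
      using assms(3)[of ?a] by metis
  qed
qed (use assms in auto)

lemma component_zero: "component L (0\<^sub>v (length L)) a = (\<lambda>_. 0)"
  by (auto simp: component_def fun_eq_iff)

lemma finite_component: "finite {a. component L v a \<noteq> (\<lambda>_. 0)}"
proof (rule finite_subset)
  show "{a. component L v a \<noteq> (\<lambda>_. 0)} \<subseteq>
    (\<Union>k<length L. (\<lambda>m. squarefree_monomial (fst (L ! k)) + m) ` Poly_Mapping.keys (v $ k))"
  proof
    fix a assume "a \<in> {a. component L v a \<noteq> (\<lambda>_. 0)}"
    then obtain k where "component L v a k \<noteq> 0" by auto
    then have k: "k < length L" "fst (L ! k) \<subseteq> Poly_Mapping.keys a"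
      "a - squarefree_monomial (fst (L ! k)) \<in> Poly_Mapping.keys (v $ k)"
      by (auto simp: component_def in_keys_iff split: if_splits)
    show "a \<in> (\<Union>k<length L. (\<lambda>m. squarefree_monomial (fst (L ! k)) + m) ` Poly_Mapping.keys (v $ k))"
      by (rule UN_I[of k], simp add: k(1), rule image_eqI[OF _ k(3)])
        (simp add: squarefree_monomial_add_diff[OF k(2)])
  qed
qed simp

text \<open>Vectors correspond to finitely supported choices of components; finiteness is what makes
  each entry a polynomial. Uniqueness is \<open>component_eqI\<close>.\<close>

lemma component_realize:
  fixes u :: "'v::finite monomial \<Rightarrow> nat \<Rightarrow> 'k::field"
  assumes "\<And>a. u a \<in> free_part L (Poly_Mapping.keys a)" "finite {a. u a \<noteq> (\<lambda>_. 0)}"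
  shows "\<exists>v\<in>carrier_vec (length L). \<forall>a. component L v a = u a"
proof -
  define f where "f = (\<lambda>k m. u (squarefree_monomial (fst (L ! k)) + m) k)"
  have fin: "finite {m. f k m \<noteq> 0}" for k
  proof (rule finite_imageD)
    show "finite ((\<lambda>m. squarefree_monomial (fst (L ! k)) + m) ` {m. f k m \<noteq> 0})"
      by (rule finite_subset[OF _ assms(2)]) (auto simp: f_def fun_eq_iff)
  qed (simp add: inj_on_def)
  define v where "v = vec (length L) (\<lambda>k. Abs_poly_mapping (f k))"
  have "component L v a k = u a k" for a k
  proof (cases "k < length L \<and> fst (L ! k) \<subseteq> Poly_Mapping.keys a")
    case True
    then have "squarefree_monomial (fst (L ! k)) + (a - squarefree_monomial (fst (L ! k))) = a"
      by (intro squarefree_monomial_add_diff) simp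
    then have "f k (a - squarefree_monomial (fst (L ! k))) = u a k" unfolding f_def by (simp only:)
    then show ?thesis using fin True by (simp add: component_def v_def)
  next
    case False
    then have "u a k = 0" using assms(1)[of a] unfolding free_part_def by blast
    then show ?thesis using False by (auto simp: component_def)
  qed
  then show ?thesis by (intro bexI[of _ v]) (auto simp: v_def)
qed

text \<open>In each multidegree \<open>a\<close>, squarefree or not, the matrix acts as the scalar
  map \<open>combine L\<close>. Exactness in degree \<open>a\<close> therefore depends only on the
  support of \<open>a\<close>, and the squarefree components control the whole module.\<close>

lemma component_syzygy_matrix:
  assumes gen: "generates L Z" and Z: "\<And>F. Z F \<subseteq> free_part L' F" and w: "w \<in> carrier_vec (length L)"
  shows "component L' (syzygy_matrix L' L *\<^sub>v w) a = combine L (component L w a)"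
proof
  fix k
  have sub: "k < length L' \<and> fst (L' ! k) \<subseteq> fst (L ! l)" if "l < length L" "snd (L ! l) k \<noteq> 0" for l
  proof -
    have "snd (L ! l) \<in> Z (fst (L ! l))"
      using combine_unit[OF that(1)] unit_in_free_part[OF that(1) order_refl] gen
      unfolding generates_def by (metis imageI)
    then show ?thesis using that(2) Z unfolding free_part_def by blast
  qed
  let ?F = "\<lambda>l. fst (L ! l)" and ?G = "fst (L' ! k)"
  show "component L' (syzygy_matrix L' L *\<^sub>v w) a k = combine L (component L w a) k"
  proof (cases "k < length L' \<and> ?G \<subseteq> Poly_Mapping.keys a")
    case False
    have "component L w a l * snd (L ! l) k = 0" if "l < length L" for l
      using sub[OF that] False by (auto simp: component_def)
    then have "combine L (component L w a) k = 0" unfolding combine_def by (intro sum.neutral) simp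
    then show ?thesis using False by (auto simp: component_def)
  next
    case True
    have "(syzygy_matrix L' L *\<^sub>v w) $ k = (\<Sum>l<length L. syzygy_matrix L' L $$ (k, l) * w $ l)"
      using True w by (simp add: syzygy_matrix_def scalar_prod_def atLeast0LessThan)
    also have "\<dots> = (\<Sum>l<length L. Poly_Mapping.single (squarefree_monomial (?F l - ?G)) (snd (L ! l) k) * w $ l)"
      using True by (intro sum.cong) (simp_all add: syzygy_matrix_def)
    finally have "component L' (syzygy_matrix L' L *\<^sub>v w) a k = (\<Sum>l<length L.
      Poly_Mapping.lookup (Poly_Mapping.single (squarefree_monomial (?F l - ?G)) (snd (L ! l) k) * w $ l)
        (a - squarefree_monomial ?G))"
      using True by (simp add: component_def lookup_sum)
    also have "\<dots> = (\<Sum>l<length L. component L w a l * snd (L ! l) k)"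
    proof (rule sum.cong[OF refl])
      fix l assume "l \<in> {..<length L}"
      then have l: "l < length L" by simp
      let ?m = "squarefree_monomial (?F l - ?G)" and ?c = "snd (L ! l) k"
      show "Poly_Mapping.lookup (Poly_Mapping.single ?m ?c * w $ l) (a - squarefree_monomial ?G) =
        component L w a l * ?c"
      proof (cases "?c = 0")
        case True then show ?thesis by simp
      next
        case False
        then have GF: "?G \<subseteq> ?F l" using sub l by blast
        have split: "squarefree_monomial (?F l) = squarefree_monomial ?G + ?m"
          by (rule poly_mapping_eqI) (use GF in \<open>auto simp: lookup_add\<close>)
        show ?thesis
        proof (cases "?F l \<subseteq> Poly_Mapping.keys a")
          case True
          define b where "b = a - squarefree_monomial (?F l)"
          have "a = squarefree_monomial ?G + (?m + b)"
            using squarefree_monomial_add_diff[OF True] unfolding split b_def by (simp add: add.assoc)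
          then have "a - squarefree_monomial ?G = ?m + b" by (simp only: add_diff_cancel_left')
          then show ?thesis using True l by (simp add: lookup_single_mult component_def b_def)
        next
          case F: False
          have "a - squarefree_monomial ?G \<noteq> ?m + b" for b
          proof
            assume "a - squarefree_monomial ?G = ?m + b"
            then have "a = squarefree_monomial (?F l) + b"
              using squarefree_monomial_add_diff[of ?G a] \<open>k < length L' \<and> ?G \<subseteq> Poly_Mapping.keys a\<close>
              unfolding split by (simp add: add.assoc)
            then show False using F by (auto simp: keys_monomial_add)
          qed
          then show ?thesis using F by (simp add: lookup_single_mult_not_dvd component_def)
        qed
      qed
    qed
    also have "\<dots> = combine L (component L w a) k" by (simp add: combine_def)
    finally show ?thesis .
  qed
qed

lemma image_syzygy_matrix:
  assumes gen: "generates L Z" and Z: "\<And>F. Z F \<subseteq> free_part L' F"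
  shows "(\<lambda>w. syzygy_matrix L' L *\<^sub>v w) ` carrier_vec (length L) =
    {v \<in> carrier_vec (length L'). \<forall>a. component L' v a \<in> Z (Poly_Mapping.keys a)}" (is "?A = ?B")
proof
  note comp = component_syzygy_matrix[OF gen Z]
  show "?A \<subseteq> ?B"
  proof
    fix v assume "v \<in> ?A"
    then obtain w where w: "w \<in> carrier_vec (length L)" "v = syzygy_matrix L' L *\<^sub>v w" by auto
    have "component L' v a \<in> Z (Poly_Mapping.keys a)" for a
      unfolding w(2) comp[OF w(1)] using gen component_free_part unfolding generates_def by blast
    then show "v \<in> ?B" using w by auto
  qed
  show "?B \<subseteq> ?A"
  proof
    fix v assume v: "v \<in> ?B"
    \<comment> \<open>Preimages are chosen zero wherever the target is zero; otherwise
      \<open>u\<close> might have infinite support and come from no vector.\<close>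
    have "\<exists>u. u \<in> free_part L (Poly_Mapping.keys a) \<and> combine L u = component L' v a \<and>
      (component L' v a = (\<lambda>_. 0) \<longrightarrow> u = (\<lambda>_. 0))" for a
    proof (cases "component L' v a = (\<lambda>_. 0)")
      case True
      then show ?thesis by (intro exI[of _ "\<lambda>_. 0"]) (simp add: free_part_def combine_zero)
    next
      case False
      have "component L' v a \<in> combine L ` free_part L (Poly_Mapping.keys a)"
        using v gen unfolding generates_def by blast
      then show ?thesis using False by auto
    qed
    then obtain u where u: "\<And>a. u a \<in> free_part L (Poly_Mapping.keys a)"
      "\<And>a. combine L (u a) = component L' v a" "\<And>a. component L' v a = (\<lambda>_. 0) \<Longrightarrow> u a = (\<lambda>_. 0)"
      by metis
    have "finite {a. u a \<noteq> (\<lambda>_. 0)}"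
      by (rule finite_subset[OF _ finite_component[of L' v]]) (use u(3) in auto)
    then obtain w where w: "w \<in> carrier_vec (length L)" "\<And>a. component L w a = u a"
      using component_realize[of u L] u(1) by blast
    have "syzygy_matrix L' L *\<^sub>v w = v"
      by (rule component_eqI[of _ L'])
        (use v w(1) in \<open>auto simp: comp w(2) u(2)\<close>)
    then show "v \<in> ?A" using w(1) by blast
  qed
qed

lemma kernel_syzygy_matrix:
  assumes gen: "generates L Z" and Z: "\<And>F. Z F \<subseteq> free_part L' F"
  shows "{v \<in> carrier_vec (length L). syzygy_matrix L' L *\<^sub>v v = 0\<^sub>v (length L')} =
    {v \<in> carrier_vec (length L). \<forall>a. component L v a \<in> syzygies L (Poly_Mapping.keys a)}"
proof -
  have "syzygy_matrix L' L *\<^sub>v v = 0\<^sub>v (length L') \<longleftrightarrow>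
    (\<forall>a. component L v a \<in> syzygies L (Poly_Mapping.keys a))" if v: "v \<in> carrier_vec (length L)" for v
  proof -
    have "syzygy_matrix L' L *\<^sub>v v = 0\<^sub>v (length L') \<longleftrightarrow>
      (\<forall>a. component L' (syzygy_matrix L' L *\<^sub>v v) a = component L' (0\<^sub>v (length L')) a)"
    proof
      assume "\<forall>a. component L' (syzygy_matrix L' L *\<^sub>v v) a = component L' (0\<^sub>v (length L')) a"
      then show "syzygy_matrix L' L *\<^sub>v v = 0\<^sub>v (length L')"
        by (intro component_eqI[of _ L']) auto
    qed simp
    also have "\<dots> \<longleftrightarrow> (\<forall>a. combine L (component L v a) = (\<lambda>_. 0))"
      by (simp add: component_syzygy_matrix[OF gen Z v] component_zero)
    also have "\<dots> \<longleftrightarrow> (\<forall>a. component L v a \<in> syzygies L (Poly_Mapping.keys a))"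
      by (simp add: syzygies_def component_free_part)
    finally show ?thesis .
  qed
  then show ?thesis by auto
qed

lemma syzygies_free_part: "syzygies L F \<subseteq> free_part L F"
  by (auto simp: syzygies_def)

lemma syzygy_matrix_homogeneous:
  assumes gen: "generates L Z" and Z: "\<And>F. Z F \<subseteq> free_part L' F" and kl: "k < length L'" "l < length L"
  shows "syzygy_matrix L' L $$ (k, l) \<in> homogeneous (int (card (fst (L ! l))) - int (card (fst (L' ! k))))"
proof (cases "snd (L ! l) k = 0")
  case True
  then show ?thesis using kl by (simp add: syzygy_matrix_def homogeneous_def)
next
  case False
  have "snd (L ! l) \<in> Z (fst (L ! l))"
    using combine_unit[OF kl(2)] unit_in_free_part[OF kl(2) order_refl] gen
    unfolding generates_def by (metis imageI)
  then have "fst (L' ! k) \<subseteq> fst (L ! l)" using False Z unfolding free_part_def by blast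
  then have "int (card (fst (L ! l) - fst (L' ! k))) = int (card (fst (L ! l))) - int (card (fst (L' ! k)))"
    by (simp add: card_Diff_subset card_mono of_nat_diff)
  then show ?thesis
    using kl False by (simp add: syzygy_matrix_def homogeneous_def total_degree_squarefree_monomial)
qed

lemma single_in_irrelevant_ideal:
  assumes "x \<in> Poly_Mapping.keys m"
  shows "Poly_Mapping.single m c \<in> (irrelevant_ideal :: ('v, 'k::field) polynomial set)"
proof -
  have m: "m - Poly_Mapping.single x 1 + Poly_Mapping.single x 1 = m"
    using assms by (intro poly_mapping_eqI) (auto simp: lookup_add lookup_minus lookup_single when_def in_keys_iff)
  have "Poly_Mapping.single m c = Poly_Mapping.single (m - Poly_Mapping.single x 1) c * variable x"
    unfolding variable_def mult_single m by simp
  then show ?thesis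
    unfolding irrelevant_ideal_def by (simp add: ideal.span_scale ideal.span_base)
qed

text \<open>Minimality of \<open>L'\<close> excludes a nonzero scalar at \<open>k\<close> in a
  syzygy of degree \<open>fst (L' ! k)\<close>. So the two degrees differ whenever the coefficient
  is nonzero, and the monomial of the entry contains a variable.\<close>

lemma syzygy_matrix_irrelevant:
  assumes gen: "generates L (syzygies L')" and min: "minimal_generators L'" and kl: "k < length L'" "l < length L"
  shows "syzygy_matrix L' L $$ (k, l) \<in> irrelevant_ideal"
proof (cases "snd (L ! l) k = 0")
  case True
  then show ?thesis using kl by (simp add: syzygy_matrix_def irrelevant_ideal_def ideal.span_zero)
next
  case False
  have z: "snd (L ! l) \<in> syzygies L' (fst (L ! l))"
    using combine_unit[OF kl(2)] unit_in_free_part[OF kl(2) order_refl] gen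
    unfolding generates_def by (metis imageI)
  then have "fst (L' ! k) \<subseteq> fst (L ! l)" using False unfolding syzygies_def free_part_def by blast
  moreover have "fst (L' ! k) \<noteq> fst (L ! l)"
    using z False min kl(1) unfolding minimal_generators_def by metis
  ultimately obtain x where "x \<in> fst (L ! l) - fst (L' ! k)" by blast
  then show ?thesis using kl by (simp add: syzygy_matrix_def single_in_irrelevant_ideal)
qed

section \<open>Assembling the resolution\<close>

definition monomial_ideal :: "'v::finite set set \<Rightarrow> ('v, 'k::field) polynomial set" where
  "monomial_ideal U = {p. \<forall>a\<in>Poly_Mapping.keys p. Poly_Mapping.keys a \<in> U}"

theorem minimal_resolution_monomial_ideal:
  fixes U :: "'v::finite set set"
  assumes U: "upclosed U"
  obtains D g \<phi> where "minimal_graded_free_resolution (monomial_ideal U :: ('v, 'k::field) polynomial set) D g \<phi>"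
    "\<And>i j. j \<in> set (D i) \<Longrightarrow> \<exists>F. j = int (card F) \<and> \<not> acyclic_at TYPE('k) U F i"
proof -
  obtain L :: "nat \<Rightarrow> ('v set \<times> (nat \<Rightarrow> 'k)) list" where
    L: "generates (L 0) (principal_family U)" "\<And>i. generates (L (Suc i)) (syzygies (L i))"
      "\<And>i. minimal_generators (L i)" "\<And>i F. F \<in> fst ` set (L i) \<Longrightarrow> \<not> acyclic_at TYPE('k) U F i"
    using squarefree_resolution[OF U] by blast
  \<comment> \<open>The ring itself as a free module on one generator of degree \<open>{}\<close>.
    With it the augmentation is a syzygy matrix too, and the general image and kernel lemmas
    apply.\<close>
  define L0 :: "('v set \<times> (nat \<Rightarrow> 'k)) list" where "L0 = [({}, \<lambda>_. 0)]"
  define D where "D = (\<lambda>i. map (\<lambda>p. int (card (fst p))) (L i))"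
  define M where "M = syzygy_matrix L0 (L 0)"
  define g where "g = row M 0"
  define \<phi> where "\<phi> = (\<lambda>i. syzygy_matrix (L i) (L (Suc i)))"
  have P: "(principal_family U F :: (nat \<Rightarrow> 'k) set) \<subseteq> free_part L0 F" for F
    by (auto simp: principal_family_def free_part_def L0_def)
  have len [simp]: "length (D i) = length (L i)" for i by (simp add: D_def)
  have len0 [simp]: "length L0 = 1" by (simp add: L0_def)
  have M: "M \<in> carrier_mat 1 (length (L 0))" by (simp add: M_def syzygy_matrix_def)
  have g: "g \<in> carrier_vec (length (L 0))" unfolding g_def using M by (intro row_carrier_vec) auto
  have Mg: "M *\<^sub>v v = vec 1 (\<lambda>_. g \<bullet> v)" for v
    using M by (intro eq_vecI) (auto simp: g_def)
  have res: "graded_free_resolution (monomial_ideal U) D g \<phi>"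
    unfolding graded_free_resolution_def
  proof (intro conjI allI impI)
    show "g \<in> carrier_vec (length (D 0))" using g by simp
    show "g $ k \<in> homogeneous (D 0 ! k)" if k: "k < length (D 0)" for k
    proof -
      have "M $$ (0, k) \<in> homogeneous (int (card (fst (L 0 ! k))) - int (card (fst (L0 ! 0))))"
        unfolding M_def by (rule syzygy_matrix_homogeneous[OF L(1) P]) (use k in auto)
      then show ?thesis using k M by (simp add: g_def D_def L0_def)
    qed
    show "\<phi> i \<in> carrier_mat (length (D i)) (length (D (Suc i)))" for i by (simp add: \<phi>_def)
    show "\<phi> i $$ (k, l) \<in> homogeneous (D (Suc i) ! l - D i ! k)"
      if "k < length (D i)" "l < length (D (Suc i))" for i k l
      using syzygy_matrix_homogeneous[OF L(2) syzygies_free_part, of k i l] that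
      by (simp add: \<phi>_def D_def)
    show "(\<lambda>v. g \<bullet> v) ` carrier_vec (length (D 0)) = monomial_ideal U"
    proof -
      have "(p \<in> (\<lambda>v. g \<bullet> v) ` carrier_vec (length (D 0))) = (p \<in> monomial_ideal U)" for p
      proof -
        have "p \<in> (\<lambda>v. g \<bullet> v) ` carrier_vec (length (D 0)) \<longleftrightarrow>
          vec 1 (\<lambda>_. p) \<in> (\<lambda>w. M *\<^sub>v w) ` carrier_vec (length (L 0))"
        proof -
          have "vec 1 (\<lambda>_. p) = vec 1 (\<lambda>_. q) \<longleftrightarrow> p = q" for q
          proof
            assume "vec 1 (\<lambda>_. p) = vec 1 (\<lambda>_. q)"
            then have "vec 1 (\<lambda>_. p) $ 0 = vec 1 (\<lambda>_. q) $ 0" by (simp only:)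
            then show "p = q" by (simp only: index_vec zero_less_one)
          qed simp
          then show ?thesis unfolding Mg by (auto simp: image_iff)
        qed
        also have "\<dots> \<longleftrightarrow> (\<forall>a. component L0 (vec 1 (\<lambda>_. p)) a \<in> principal_family U (Poly_Mapping.keys a))"
          unfolding M_def image_syzygy_matrix[OF L(1) P] by simp
        also have "\<dots> \<longleftrightarrow> p \<in> monomial_ideal U"
          by (auto simp: component_def principal_family_def L0_def monomial_ideal_def in_keys_iff)
        finally show ?thesis .
      qed
      then show ?thesis by blast
    qed
    show "{v \<in> carrier_vec (length (D 0)). g \<bullet> v = 0} = (\<lambda>w. \<phi> 0 *\<^sub>v w) ` carrier_vec (length (D 1))"
    proof -
      have "g \<bullet> v = 0 \<longleftrightarrow> M *\<^sub>v v = 0\<^sub>v (length L0)" for v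
        unfolding Mg by (auto simp: vec_eq_iff)
      then have "{v \<in> carrier_vec (length (D 0)). g \<bullet> v = 0} =
        {v \<in> carrier_vec (length (L 0)). M *\<^sub>v v = 0\<^sub>v (length L0)}" by simp
      also have "\<dots> = {v \<in> carrier_vec (length (L 0)). \<forall>a. component (L 0) v a \<in> syzygies (L 0) (Poly_Mapping.keys a)}"
        unfolding M_def by (rule kernel_syzygy_matrix[OF L(1) P])
      also have "\<dots> = (\<lambda>w. \<phi> 0 *\<^sub>v w) ` carrier_vec (length (L 1))"
        using image_syzygy_matrix[OF L(2) syzygies_free_part, of 0] by (simp add: \<phi>_def)
      finally show ?thesis by simp
    qed
    show "{v \<in> carrier_vec (length (D (Suc i))). \<phi> i *\<^sub>v v = 0\<^sub>v (length (D i))} =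
       (\<lambda>w. \<phi> (Suc i) *\<^sub>v w) ` carrier_vec (length (D (Suc (Suc i))))" for i
      using kernel_syzygy_matrix[OF L(2) syzygies_free_part, of i]
        image_syzygy_matrix[OF L(2) syzygies_free_part, of "Suc i"] by (simp add: \<phi>_def)
  qed
  show ?thesis
  proof (rule that[of D g \<phi>])
    have "\<phi> i $$ (k, l) \<in> irrelevant_ideal" if "k < length (D i)" "l < length (D (Suc i))" for i k l
      using syzygy_matrix_irrelevant[OF L(2) L(3)] that by (simp add: \<phi>_def)
    then show "minimal_graded_free_resolution (monomial_ideal U) D g \<phi>"
      using res unfolding minimal_graded_free_resolution_def by blast
    fix i j assume "j \<in> set (D i)"
    then obtain p where "p \<in> set (L i)" "j = int (card (fst p))" by (auto simp: D_def)
    then show "\<exists>F. j = int (card F) \<and> \<not> acyclic_at TYPE('k) U F i" using L(4) by blast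
  qed
qed

section \<open>Comparison of resolutions\<close>

definition homogeneous_part :: "int \<Rightarrow> ('v::finite, 'k::field) polynomial \<Rightarrow> ('v, 'k) polynomial" where
  "homogeneous_part d p =
     Abs_poly_mapping (\<lambda>m. if int (total_degree m) = d then Poly_Mapping.lookup p m else 0)"

lemma lookup_homogeneous_part:
  "Poly_Mapping.lookup (homogeneous_part d p) m =
     (if int (total_degree m) = d then Poly_Mapping.lookup p m else 0)"
proof -
  have "finite {m. (if int (total_degree m) = d then Poly_Mapping.lookup p m else 0) \<noteq> 0}"
    by (rule finite_subset[OF _ finite_keys[of p]]) (auto simp: in_keys_iff)
  then show ?thesis by (simp add: homogeneous_part_def)
qed

lemma homogeneous_part_in: "homogeneous_part d p \<in> homogeneous d"
  by (auto simp: homogeneous_def in_keys_iff lookup_homogeneous_part split: if_splits)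

lemma homogeneous_part_id:
  assumes "p \<in> homogeneous d" shows "homogeneous_part d p = p"
proof (rule poly_mapping_eqI)
  fix m
  show "Poly_Mapping.lookup (homogeneous_part d p) m = Poly_Mapping.lookup p m"
    using assms by (auto simp: lookup_homogeneous_part homogeneous_def in_keys_iff)
qed

lemma homogeneous_part_sum: "homogeneous_part d (\<Sum>i\<in>A. p i) = (\<Sum>i\<in>A. homogeneous_part d (p i))"
  by (rule poly_mapping_eqI) (simp add: lookup_homogeneous_part lookup_sum)

lemma homogeneous_part_add: "homogeneous_part d (p + q) = homogeneous_part d p + homogeneous_part d q"
  by (rule poly_mapping_eqI) (simp add: lookup_homogeneous_part lookup_add)

lemma homogeneous_mult: "p \<in> homogeneous d \<Longrightarrow> q \<in> homogeneous e \<Longrightarrow> p * q \<in> homogeneous (d + e)"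
  using keys_mult[of p q] unfolding homogeneous_def by (force simp: total_degree_add)

text \<open>The terms of \<open>q\<close> outside degree \<open>e\<close> only produce terms of the
  product outside degree \<open>d + e\<close>.\<close>

lemma homogeneous_part_mult:
  assumes p: "p \<in> homogeneous d"
  shows "homogeneous_part (d + e) (p * q) = p * homogeneous_part e q"
proof -
  have "homogeneous_part (d + e) (p * (q - homogeneous_part e q)) = 0"
  proof (rule poly_mapping_eqI)
    fix m
    have "Poly_Mapping.lookup (p * (q - homogeneous_part e q)) m = 0" if m: "int (total_degree m) = d + e"
    proof (rule ccontr)
      assume "Poly_Mapping.lookup (p * (q - homogeneous_part e q)) m \<noteq> 0"
      then have "m \<in> Poly_Mapping.keys (p * (q - homogeneous_part e q))" by (simp add: in_keys_iff)
      then obtain a b where ab: "m = a + b" "a \<in> Poly_Mapping.keys p" "b \<in> Poly_Mapping.keys (q - homogeneous_part e q)"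
        using keys_mult by blast
      have "int (total_degree a) = d" using p ab(2) by (simp add: homogeneous_def)
      then have "int (total_degree b) = e" using m ab(1) by (simp add: total_degree_add)
      then show False using ab(3) by (simp add: in_keys_iff lookup_minus lookup_homogeneous_part)
    qed
    then show "Poly_Mapping.lookup (homogeneous_part (d + e) (p * (q - homogeneous_part e q))) m
        = Poly_Mapping.lookup 0 m"
      by (simp add: lookup_homogeneous_part)
  qed
  moreover have "homogeneous_part (d + e) (p * homogeneous_part e q) = p * homogeneous_part e q"
    by (intro homogeneous_part_id homogeneous_mult p homogeneous_part_in)
  moreover have "homogeneous_part (d + e) (p * q) = homogeneous_part (d + e) (p * homogeneous_part e q) +
    homogeneous_part (d + e) (p * (q - homogeneous_part e q))"
    by (simp flip: homogeneous_part_add distrib_left)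
  ultimately show ?thesis by simp
qed

section \<open>Reduction modulo the irrelevant ideal\<close>

lemma constant_coeff_mult:
  fixes p q :: "('v, 'k::field) polynomial"
  shows "Poly_Mapping.lookup (p * q) 0 = Poly_Mapping.lookup p 0 * Poly_Mapping.lookup q 0"
proof -
  define c where "c = Poly_Mapping.lookup p 0"
  define p' where "p' = p - Poly_Mapping.single 0 c"
  have p: "p = Poly_Mapping.single 0 c + p'" by (simp add: p'_def)
  have "Poly_Mapping.lookup p' 0 = 0" by (simp add: p'_def lookup_minus c_def)
  have "Poly_Mapping.lookup (p' * q) 0 = 0"
  proof (rule ccontr)
    assume "Poly_Mapping.lookup (p' * q) 0 \<noteq> 0"
    then have "0 \<in> Poly_Mapping.keys (p' * q)" by (simp add: in_keys_iff)
    then obtain a b where ab: "0 = a + b" "a \<in> Poly_Mapping.keys p'" using keys_mult by blast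
    have "Poly_Mapping.keys a \<union> Poly_Mapping.keys b = {}"
      unfolding keys_monomial_add[symmetric] ab(1)[symmetric] by simp
    then have "a = 0" by (intro poly_mapping_eqI) (auto simp: in_keys_iff)
    then show False using ab(2) \<open>Poly_Mapping.lookup p' 0 = 0\<close> by (simp add: in_keys_iff)
  qed
  moreover have "Poly_Mapping.lookup (Poly_Mapping.single 0 c * q) 0 = c * Poly_Mapping.lookup q 0"
    using lookup_single_mult[of 0 c q 0] by simp
  ultimately show ?thesis unfolding c_def[symmetric]
    by (subst p) (simp add: distrib_right lookup_add)
qed

lemma irrelevant_ideal_constant_coeff:
  assumes "p \<in> (irrelevant_ideal :: ('v, 'k::field) polynomial set)"
  shows "Poly_Mapping.lookup p 0 = 0"
proof -
  have "ideal.span (range variable) \<subseteq> {p :: ('v, 'k) polynomial. Poly_Mapping.lookup p 0 = 0}"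
  proof (rule ideal.span_minimal)
    have "Poly_Mapping.single x (1::nat) \<noteq> 0" for x :: 'v
      by (metis lookup_single_eq lookup_zero zero_neq_one)
    then show "range variable \<subseteq> {p :: ('v, 'k) polynomial. Poly_Mapping.lookup p 0 = 0}"
      by (auto simp: variable_def lookup_single)
    show "ideal.subspace {p :: ('v, 'k) polynomial. Poly_Mapping.lookup p 0 = 0}"
      by (rule ideal.subspaceI) (simp_all add: lookup_add constant_coeff_mult)
  qed
  then show ?thesis using assms unfolding irrelevant_ideal_def by blast
qed

lemma irrelevant_ideal_sum:
  "(\<And>i. i \<in> A \<Longrightarrow> p i \<in> irrelevant_ideal) \<Longrightarrow> (\<Sum>i\<in>A. p i) \<in> irrelevant_ideal"
  unfolding irrelevant_ideal_def by (rule ideal.span_sum)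

lemma irrelevant_ideal_mult:
  "p \<in> irrelevant_ideal \<Longrightarrow> q * p \<in> irrelevant_ideal" "p \<in> irrelevant_ideal \<Longrightarrow> p * q \<in> irrelevant_ideal"
  unfolding irrelevant_ideal_def using ideal.span_scale[of p _ q] by (simp_all add: mult.commute)

section \<open>Lifting matrices\<close>

lemma mult_mat_index:
  assumes "A \<in> carrier_mat a b" "B \<in> carrier_mat b c" "i < a" "j < c"
  shows "(A * B) $$ (i, j) = (\<Sum>k<b. A $$ (i, k) * B $$ (k, j))"
  using assms by (simp add: scalar_prod_def atLeast0LessThan)

lemma mat_eq_by_mult_vec:
  fixes A B :: "'a::comm_ring_1 mat"
  assumes "A \<in> carrier_mat a b" "B \<in> carrier_mat a b" "\<And>v. v \<in> carrier_vec b \<Longrightarrow> A *\<^sub>v v = B *\<^sub>v v"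
  shows "A = B"
proof (rule eq_matI)
  fix i j assume ij: "i < dim_row B" "j < dim_col B"
  have "(A *\<^sub>v unit_vec b j) $ i = (B *\<^sub>v unit_vec b j) $ i" using assms(3) by simp
  then show "A $$ (i, j) = B $$ (i, j)" using assms(1,2) ij by (auto simp: scalar_prod_right_unit)
qed (use assms in auto)

text \<open>Free modules are projective: the columns of the lift are preimages of the columns of
  \<open>B\<close>.\<close>

lemma mat_lift:
  fixes A :: "'a::comm_ring_1 mat"
  assumes A: "A \<in> carrier_mat a b" and B: "B \<in> carrier_mat a c"
    and im: "\<And>v. v \<in> carrier_vec c \<Longrightarrow> B *\<^sub>v v \<in> (\<lambda>w. A *\<^sub>v w) ` carrier_vec b"
  shows "\<exists>C\<in>carrier_mat b c. A * C = B"
proof -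
  have "\<exists>w\<in>carrier_vec b. B *\<^sub>v unit_vec c j = A *\<^sub>v w" for j using im[of "unit_vec c j"] by auto
  then obtain w where w: "\<And>j. w j \<in> carrier_vec b" "\<And>j. B *\<^sub>v unit_vec c j = A *\<^sub>v w j" by metis
  define C where "C = mat b c (\<lambda>(i, j). w j $ i)"
  have C: "C \<in> carrier_mat b c" by (simp add: C_def)
  have "A * C = B"
  proof (rule eq_matI)
    fix i j assume ij: "i < dim_row B" "j < dim_col B"
    have "col C j = w j" using ij w(1)[of j] B by (intro eq_vecI) (auto simp: C_def)
    then have "(A * C) $$ (i, j) = (A *\<^sub>v w j) $ i" using A B C ij by simp
    also have "\<dots> = B $$ (i, j)" unfolding w(2)[symmetric] using B ij by (simp add: scalar_prod_right_unit)
    finally show "(A * C) $$ (i, j) = B $$ (i, j)" .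
  qed (use A B C in auto)
  then show ?thesis using C by blast
qed

definition graded_matrix :: "int list \<Rightarrow> int list \<Rightarrow> ('v::finite, 'k::field) polynomial mat \<Rightarrow> bool" where
  "graded_matrix d e A \<longleftrightarrow> A \<in> carrier_mat (length d) (length e) \<and>
     (\<forall>k<length d. \<forall>l<length e. A $$ (k, l) \<in> homogeneous (e ! l - d ! k))"

lemma homogeneous_sum: "(\<And>i. i \<in> A \<Longrightarrow> p i \<in> homogeneous d) \<Longrightarrow> (\<Sum>i\<in>A. p i) \<in> homogeneous d"
proof -
  assume h: "\<And>i. i \<in> A \<Longrightarrow> p i \<in> homogeneous d"
  have "homogeneous_part d (\<Sum>i\<in>A. p i) = (\<Sum>i\<in>A. p i)"
    unfolding homogeneous_part_sum using homogeneous_part_id[OF h] by (intro sum.cong) auto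
  then show ?thesis using homogeneous_part_in by metis
qed

lemma graded_matrix_mult:
  assumes A: "graded_matrix d e A" and B: "graded_matrix e f B"
  shows "graded_matrix d f (A * B)"
  unfolding graded_matrix_def
proof (intro conjI allI impI)
  have car: "A \<in> carrier_mat (length d) (length e)" "B \<in> carrier_mat (length e) (length f)"
    using A B by (auto simp: graded_matrix_def)
  then show "A * B \<in> carrier_mat (length d) (length f)" by simp
  fix k l assume kl: "k < length d" "l < length f"
  have "A $$ (k, j) * B $$ (j, l) \<in> homogeneous (f ! l - d ! k)" if "j < length e" for j
    using homogeneous_mult[of "A $$ (k, j)" "e ! j - d ! k" "B $$ (j, l)" "f ! l - e ! j"] A B kl that
    by (simp add: graded_matrix_def)
  then show "(A * B) $$ (k, l) \<in> homogeneous (f ! l - d ! k)"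
    unfolding mult_mat_index[OF car kl] by (intro homogeneous_sum) simp
qed

text \<open>Preimages obtained column by column need not be homogeneous. Since \<open>A\<close> and
  \<open>B\<close> are, replacing each entry of a lift by its part of the prescribed degree yields a
  lift again.\<close>

lemma graded_mat_lift:
  assumes A: "graded_matrix d e A" and B: "graded_matrix d f B"
    and im: "\<And>v. v \<in> carrier_vec (length f) \<Longrightarrow> B *\<^sub>v v \<in> (\<lambda>w. A *\<^sub>v w) ` carrier_vec (length e)"
  shows "\<exists>C. graded_matrix e f C \<and> A * C = B"
proof -
  have car: "A \<in> carrier_mat (length d) (length e)" "B \<in> carrier_mat (length d) (length f)"
    using A B by (auto simp: graded_matrix_def)
  obtain C where C: "C \<in> carrier_mat (length e) (length f)" "A * C = B"
    using mat_lift[OF car im] by blast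
  define C' where "C' = mat (length e) (length f) (\<lambda>(l, j). homogeneous_part (f ! j - e ! l) (C $$ (l, j)))"
  have C': "C' \<in> carrier_mat (length e) (length f)" by (simp add: C'_def)
  have "A * C' = B"
  proof (rule eq_matI)
    fix k j assume "k < dim_row B" "j < dim_col B"
    then have kj: "k < length d" "j < length f" using car by auto
    have "(A * C') $$ (k, j) = (\<Sum>l<length e. A $$ (k, l) * homogeneous_part (f ! j - e ! l) (C $$ (l, j)))"
      unfolding mult_mat_index[OF car(1) C' kj] using kj by (intro sum.cong) (simp_all add: C'_def)
    also have "\<dots> = (\<Sum>l<length e. homogeneous_part (f ! j - d ! k) (A $$ (k, l) * C $$ (l, j)))"
    proof (rule sum.cong[OF refl])
      fix l assume "l \<in> {..<length e}"
      then have "A $$ (k, l) \<in> homogeneous (e ! l - d ! k)" using A kj by (simp add: graded_matrix_def)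
      from homogeneous_part_mult[OF this, of "f ! j - e ! l" "C $$ (l, j)"]
      show "A $$ (k, l) * homogeneous_part (f ! j - e ! l) (C $$ (l, j)) =
        homogeneous_part (f ! j - d ! k) (A $$ (k, l) * C $$ (l, j))" by simp
    qed
    also have "\<dots> = homogeneous_part (f ! j - d ! k) (B $$ (k, j))"
      unfolding C(2)[symmetric] mult_mat_index[OF car(1) C(1) kj] homogeneous_part_sum ..
    also have "\<dots> = B $$ (k, j)" using B kj by (intro homogeneous_part_id) (simp add: graded_matrix_def)
    finally show "(A * C') $$ (k, j) = B $$ (k, j)" .
  qed (use car C' in auto)
  moreover have "graded_matrix e f C'"
    by (auto simp: graded_matrix_def C'_def homogeneous_part_in)
  ultimately show ?thesis by blast
qed

definition matrix_in :: "'a set \<Rightarrow> 'a mat \<Rightarrow> bool" where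
  "matrix_in J A \<longleftrightarrow> (\<forall>i<dim_row A. \<forall>j<dim_col A. A $$ (i, j) \<in> J)"

lemma matrix_in_mult:
  assumes "matrix_in irrelevant_ideal A \<or> matrix_in irrelevant_ideal B"
    and "A \<in> carrier_mat a b" "B \<in> carrier_mat b c"
  shows "matrix_in irrelevant_ideal (A * B)"
  unfolding matrix_in_def
proof (intro allI impI)
  fix i j assume "i < dim_row (A * B)" "j < dim_col (A * B)"
  then have ij: "i < a" "j < c" using assms by auto
  have "A $$ (i, k) * B $$ (k, j) \<in> irrelevant_ideal" if "k < b" for k
    using assms(1)
  proof
    assume "matrix_in irrelevant_ideal A"
    then have "A $$ (i, k) \<in> irrelevant_ideal" using assms(2) ij that by (auto simp: matrix_in_def)
    then show ?thesis by (rule irrelevant_ideal_mult)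
  next
    assume "matrix_in irrelevant_ideal B"
    then have "B $$ (k, j) \<in> irrelevant_ideal" using assms(3) ij that by (auto simp: matrix_in_def)
    then show ?thesis by (rule irrelevant_ideal_mult)
  qed
  then show "(A * B) $$ (i, j) \<in> irrelevant_ideal"
    unfolding mult_mat_index[OF assms(2,3) ij] by (intro irrelevant_ideal_sum) simp
qed

lemma matrix_in_add:
  assumes "matrix_in irrelevant_ideal A" "matrix_in irrelevant_ideal B" "A \<in> carrier_mat a b" "B \<in> carrier_mat a b"
  shows "matrix_in irrelevant_ideal (A + B)"
  using assms unfolding matrix_in_def irrelevant_ideal_def by (auto intro!: ideal.span_add)

text \<open>
  All indices are shifted by one: \<open>d 0\<close> is the augmentation, with target \<open>S\<close> and image the ideal.
\<close>

definition augmented_resolution ::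
  "('v::finite, 'k::field) polynomial set \<Rightarrow> (nat \<Rightarrow> int list) \<Rightarrow> (nat \<Rightarrow> ('v, 'k) polynomial mat) \<Rightarrow> bool" where
  "augmented_resolution I D d \<longleftrightarrow> D 0 = [0] \<and>
     (\<forall>i. graded_matrix (D i) (D (Suc i)) (d i)) \<and>
     (\<lambda>v. d 0 *\<^sub>v v) ` carrier_vec (length (D 1)) = {vec 1 (\<lambda>_. p) | p. p \<in> I} \<and>
     (\<forall>i. {v \<in> carrier_vec (length (D (Suc i))). d i *\<^sub>v v = 0\<^sub>v (length (D i))} =
       (\<lambda>w. d (Suc i) *\<^sub>v w) ` carrier_vec (length (D (Suc (Suc i)))))"

lemma augmented_resolutionI:
  assumes "graded_free_resolution I D g \<phi>"
  shows "augmented_resolution I (case_nat [0] D) (case_nat (mat_of_row g) \<phi>)"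
proof -
  have g: "g \<in> carrier_vec (length (D 0))" using assms by (simp add: graded_free_resolution_def)
  have row: "mat_of_row g *\<^sub>v v = vec 1 (\<lambda>_. g \<bullet> v)" for v
    by (intro eq_vecI) auto
  have zero: "mat_of_row g *\<^sub>v v = 0\<^sub>v 1 \<longleftrightarrow> g \<bullet> v = 0" for v
    unfolding row by (auto simp: vec_eq_iff)
  show ?thesis
    unfolding augmented_resolution_def
  proof (intro conjI allI)
    fix i
    show "graded_matrix (case_nat [0] D i) (case_nat [0] D (Suc i)) (case_nat (mat_of_row g) \<phi> i)"
      using assms g by (cases i) (auto simp: graded_matrix_def graded_free_resolution_def)
    show "{v \<in> carrier_vec (length (case_nat [0] D (Suc i))).
        case_nat (mat_of_row g) \<phi> i *\<^sub>v v = 0\<^sub>v (length (case_nat [0] D i))} =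
      (\<lambda>w. case_nat (mat_of_row g) \<phi> (Suc i) *\<^sub>v w) ` carrier_vec (length (case_nat [0] D (Suc (Suc i))))"
      using assms zero by (cases i) (simp_all add: graded_free_resolution_def)
  next
    have "(\<lambda>v. mat_of_row g *\<^sub>v v) ` carrier_vec (length (D 0)) =
      (\<lambda>p. vec 1 (\<lambda>_. p)) ` (\<lambda>v. g \<bullet> v) ` carrier_vec (length (D 0))"
      unfolding row image_image ..
    also have "(\<lambda>v. g \<bullet> v) ` carrier_vec (length (D 0)) = I"
      using assms by (simp add: graded_free_resolution_def)
    finally show "(\<lambda>v. case_nat (mat_of_row g) \<phi> 0 *\<^sub>v v) ` carrier_vec (length (case_nat [0] D 1)) =
      {vec 1 (\<lambda>_. p) | p. p \<in> I}" by auto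
  qed simp
qed


lemma zero_mat_mult_vec: "v \<in> carrier_vec b \<Longrightarrow> 0\<^sub>m a b *\<^sub>v v = (0\<^sub>v a :: 'a::comm_ring_1 vec)"
  by (intro eq_vecI) (auto simp: scalar_prod_def)

lemma mat_mult_zero_vec: "A \<in> carrier_mat a b \<Longrightarrow> A *\<^sub>v 0\<^sub>v b = (0\<^sub>v a :: 'a::comm_ring_1 vec)"
  by (intro eq_vecI) (auto simp: scalar_prod_def)

lemma mat_add_diff_cancel:
  "A \<in> carrier_mat a b \<Longrightarrow> B \<in> carrier_mat a b \<Longrightarrow> A + B - A = (B :: 'a::comm_ring_1 mat)"
  by (intro eq_matI) auto

lemma augmented_resolution_carrier:
  "augmented_resolution I D d \<Longrightarrow> d i \<in> carrier_mat (length (D i)) (length (D (Suc i)))"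
  by (simp add: augmented_resolution_def graded_matrix_def)

lemma augmented_resolution_exact:
  assumes "augmented_resolution I D d" "v \<in> carrier_vec (length (D (Suc i)))" "d i *\<^sub>v v = 0\<^sub>v (length (D i))"
  shows "v \<in> (\<lambda>w. d (Suc i) *\<^sub>v w) ` carrier_vec (length (D (Suc (Suc i))))"
  using assms unfolding augmented_resolution_def by blast

lemma augmented_resolution_complex:
  assumes "augmented_resolution I D d"
  shows "d i * d (Suc i) = 0\<^sub>m (length (D i)) (length (D (Suc (Suc i))))"
proof (rule mat_eq_by_mult_vec)
  note car = augmented_resolution_carrier[OF assms]
  show "d i * d (Suc i) \<in> carrier_mat (length (D i)) (length (D (Suc (Suc i))))"
    using car[of i] car[of "Suc i"] by simp
  fix v :: "('a, 'b) polynomial vec" assume v: "v \<in> carrier_vec (length (D (Suc (Suc i))))"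
  then have "d (Suc i) *\<^sub>v v \<in> {v \<in> carrier_vec (length (D (Suc i))). d i *\<^sub>v v = 0\<^sub>v (length (D i))}"
    using assms unfolding augmented_resolution_def by blast
  then show "(d i * d (Suc i)) *\<^sub>v v = 0\<^sub>m (length (D i)) (length (D (Suc (Suc i)))) *\<^sub>v v"
    using car[of i] car[of "Suc i"] v by (simp add: assoc_mult_mat_vec zero_mat_mult_vec)
qed simp

text \<open>
  The maps \<open>f\<close> and \<open>h\<close> are the components of mutually lifting chain maps and \<open>s\<close> is the homotopy
  from \<open>h * f\<close> to the identity; all three are constructed together by induction.
\<close>

lemma comparison_maps:
  fixes I :: "('v::finite, 'k::field) polynomial set"
  assumes res: "augmented_resolution I D d" and res': "augmented_resolution I D' d'"
    and min: "\<And>i. matrix_in irrelevant_ideal (d (Suc i))"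
  defines "n \<equiv> \<lambda>i. length (D i)" and "n' \<equiv> \<lambda>i. length (D' i)"
  shows "\<exists>f h s. graded_matrix (D' i) (D i) f \<and> h \<in> carrier_mat (n i) (n' i) \<and>
    s \<in> carrier_mat (n (Suc i)) (n i) \<and>
    (\<forall>v\<in>carrier_vec (n (Suc i)). f *\<^sub>v (d i *\<^sub>v v) \<in> (\<lambda>w. d' i *\<^sub>v w) ` carrier_vec (n' (Suc i))) \<and>
    (\<forall>v\<in>carrier_vec (n' (Suc i)). h *\<^sub>v (d' i *\<^sub>v v) \<in> (\<lambda>w. d i *\<^sub>v w) ` carrier_vec (n (Suc i))) \<and>
    (h * f - 1\<^sub>m (n i) - d i * s) * d i = 0\<^sub>m (n i) (n (Suc i)) \<and>
    matrix_in irrelevant_ideal (s * d i) \<and>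
    (i > 0 \<longrightarrow> matrix_in irrelevant_ideal (h * f - 1\<^sub>m (n i)))"
proof -
  have d: "d i \<in> carrier_mat (n i) (n (Suc i))" for i
    using augmented_resolution_carrier[OF res] by (simp add: n_def)
  have d': "d' i \<in> carrier_mat (n' i) (n' (Suc i))" for i
    using augmented_resolution_carrier[OF res'] by (simp add: n'_def)
  have dd: "d i * d (Suc i) = 0\<^sub>m (n i) (n (Suc (Suc i)))" for i
    using augmented_resolution_complex[OF res] by (simp add: n_def)
  have dd': "d' i * d' (Suc i) = 0\<^sub>m (n' i) (n' (Suc (Suc i)))" for i
    using augmented_resolution_complex[OF res'] by (simp add: n'_def)
  have ex: "v \<in> (\<lambda>w. d (Suc i) *\<^sub>v w) ` carrier_vec (n (Suc (Suc i)))"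
    if "v \<in> carrier_vec (n (Suc i))" "d i *\<^sub>v v = 0\<^sub>v (n i)" for v i
    using augmented_resolution_exact[OF res] that by (simp add: n_def)
  have ex': "v \<in> (\<lambda>w. d' (Suc i) *\<^sub>v w) ` carrier_vec (n' (Suc (Suc i)))"
    if "v \<in> carrier_vec (n' (Suc i))" "d' i *\<^sub>v v = 0\<^sub>v (n' i)" for v i
    using augmented_resolution_exact[OF res'] that by (simp add: n'_def)
  have grd: "graded_matrix (D i) (D (Suc i)) (d i)" "graded_matrix (D' i) (D' (Suc i)) (d' i)" for i
    using res res' by (simp_all add: augmented_resolution_def)
  show ?thesis
  proof (induction i)
    case 0
    have D0: "D 0 = [0]" "D' 0 = [0]" using res res' by (simp_all add: augmented_resolution_def)
    have n0: "n 0 = 1" "n' 0 = 1" by (simp_all add: n_def n'_def D0)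
    have im: "(\<lambda>w. d 0 *\<^sub>v w) ` carrier_vec (n 1) = (\<lambda>w. d' 0 *\<^sub>v w) ` carrier_vec (n' 1)"
      using res res' by (simp add: augmented_resolution_def n_def n'_def)
    show ?case
    proof (intro exI conjI ballI)
      show "graded_matrix (D' 0) (D 0) (1\<^sub>m 1)"
        by (simp add: graded_matrix_def D0 homogeneous_def total_degree_def)
      show "1\<^sub>m 1 \<in> carrier_mat (n 0) (n' 0)" by (simp add: n0)
      \<comment> \<open>The homotopy starts at zero. This keeps the product with the augmentation in
        the irrelevant ideal even when the augmentation itself has unit entries.\<close>
      show s: "0\<^sub>m (n (Suc 0)) (n 0) \<in> carrier_mat (n (Suc 0)) (n 0)" by simp
      show "(1\<^sub>m 1 * 1\<^sub>m 1 - 1\<^sub>m (n 0) - d 0 * 0\<^sub>m (n (Suc 0)) (n 0)) * d 0 = 0\<^sub>m (n 0) (n (Suc 0))"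
      proof -
        have "1\<^sub>m 1 * 1\<^sub>m 1 - 1\<^sub>m (n 0) - d 0 * 0\<^sub>m (n (Suc 0)) (n 0) = 0\<^sub>m (n 0) (n 0)"
          using right_mult_zero_mat[OF d[of 0], of "n 0"] by (intro eq_matI) (simp_all add: n0)
        then show ?thesis using left_mult_zero_mat[OF d[of 0]] by simp
      qed
      have "0\<^sub>m (n (Suc 0)) (n 0) * d 0 = 0\<^sub>m (n (Suc 0)) (n (Suc 0))"
        using left_mult_zero_mat[OF d[of 0]] by simp
      then show "matrix_in irrelevant_ideal (0\<^sub>m (n (Suc 0)) (n 0) * d 0)"
        by (simp add: matrix_in_def irrelevant_ideal_def ideal.span_zero)
      fix v :: "('v, 'k) polynomial vec" assume v: "v \<in> carrier_vec (n (Suc 0))"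
      have "1\<^sub>m 1 *\<^sub>v (d 0 *\<^sub>v v) = d 0 *\<^sub>v v" using mult_mat_vec_carrier[OF d[of 0] v] n0 by simp
      then show "1\<^sub>m 1 *\<^sub>v (d 0 *\<^sub>v v) \<in> (\<lambda>w. d' 0 *\<^sub>v w) ` carrier_vec (n' (Suc 0))"
        using v im by auto
    next
      fix v :: "('v, 'k) polynomial vec" assume v: "v \<in> carrier_vec (n' (Suc 0))"
      have "1\<^sub>m 1 *\<^sub>v (d' 0 *\<^sub>v v) = d' 0 *\<^sub>v v" using mult_mat_vec_carrier[OF d'[of 0] v] n0 by simp
      then show "1\<^sub>m 1 *\<^sub>v (d' 0 *\<^sub>v v) \<in> (\<lambda>w. d 0 *\<^sub>v w) ` carrier_vec (n (Suc 0))"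
        using v im by auto
    qed simp
  next
    case (Suc i)
    then obtain f h s where grf: "graded_matrix (D' i) (D i) f" and h: "h \<in> carrier_mat (n i) (n' i)"
      and s: "s \<in> carrier_mat (n (Suc i)) (n i)"
      and I1: "\<And>v. v \<in> carrier_vec (n (Suc i)) \<Longrightarrow> f *\<^sub>v (d i *\<^sub>v v) \<in> (\<lambda>w. d' i *\<^sub>v w) ` carrier_vec (n' (Suc i))"
      and I2: "\<And>v. v \<in> carrier_vec (n' (Suc i)) \<Longrightarrow> h *\<^sub>v (d' i *\<^sub>v v) \<in> (\<lambda>w. d i *\<^sub>v w) ` carrier_vec (n (Suc i))"
      and I3: "(h * f - 1\<^sub>m (n i) - d i * s) * d i = 0\<^sub>m (n i) (n (Suc i))"
      and I5: "matrix_in irrelevant_ideal (s * d i)" by blast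
    have f: "f \<in> carrier_mat (n' i) (n i)" using grf by (simp add: graded_matrix_def n_def n'_def)
    note d0 = d[of i] and d1 = d[of "Suc i"] and d0' = d'[of i] and d1' = d'[of "Suc i"]
    obtain f' where f': "graded_matrix (D' (Suc i)) (D (Suc i)) f'" "d' i * f' = f * d i"
    proof -
      have "\<exists>f'. graded_matrix (D' (Suc i)) (D (Suc i)) f' \<and> d' i * f' = f * d i"
      proof (rule graded_mat_lift[OF grd(2) graded_matrix_mult[OF grf grd(1)]])
        fix v :: "('v, 'k) polynomial vec" assume "v \<in> carrier_vec (length (D (Suc i)))"
        then show "(f * d i) *\<^sub>v v \<in> (\<lambda>w. d' i *\<^sub>v w) ` carrier_vec (length (D' (Suc i)))"
          using I1[of v] assoc_mult_mat_vec[OF f d0, of v] by (simp add: n_def n'_def)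
      qed
      then show ?thesis using that by blast
    qed
    have fc': "f' \<in> carrier_mat (n' (Suc i)) (n (Suc i))" using f'(1) by (simp add: graded_matrix_def n_def n'_def)
    obtain h' where h': "h' \<in> carrier_mat (n (Suc i)) (n' (Suc i))" "d i * h' = h * d' i"
    proof -
      have "\<exists>h'\<in>carrier_mat (n (Suc i)) (n' (Suc i)). d i * h' = h * d' i"
      proof (rule mat_lift[OF d0])
        show "h * d' i \<in> carrier_mat (n i) (n' (Suc i))" using h d0' by simp
        fix v :: "('v, 'k) polynomial vec" assume "v \<in> carrier_vec (n' (Suc i))"
        then show "(h * d' i) *\<^sub>v v \<in> (\<lambda>w. d i *\<^sub>v w) ` carrier_vec (n (Suc i))"
          using I2[of v] assoc_mult_mat_vec[OF h d0', of v] by simp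
      qed
      then show ?thesis using that by blast
    qed
    let ?u = "h' * f' - 1\<^sub>m (n (Suc i))"
    have u: "?u \<in> carrier_mat (n (Suc i)) (n (Suc i))" by (rule minus_carrier_mat[OF one_carrier_mat])
    have sd: "s * d i \<in> carrier_mat (n (Suc i)) (n (Suc i))" using s d0 by simp
    \<comment> \<open>As \<open>f'\<close> and \<open>h'\<close> lift \<open>f\<close> and
      \<open>h\<close>, this reduces to \<open>I3\<close>. By exactness the difference then factors
      through \<open>d (Suc i)\<close>, and the factor is the next homotopy.\<close>
    have kill: "d i * (?u - s * d i) = 0\<^sub>m (n i) (n (Suc i))"
    proof -
      have "d i * (?u - s * d i) = d i * ?u - d i * (s * d i)"
        by (rule mult_minus_distrib_mat[OF d0 u sd])
      also have "d i * ?u = d i * (h' * f') - d i"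
        using mult_minus_distrib_mat[OF d0, of "h' * f'" "n (Suc i)" "1\<^sub>m (n (Suc i))"] h' fc' d0 by simp
      also have "d i * (h' * f') = h * f * d i"
      proof -
        have "d i * (h' * f') = h * d' i * f'"
          using assoc_mult_mat[OF d0 h'(1) fc'] h'(2) by simp
        also have "\<dots> = h * (d' i * f')" by (rule assoc_mult_mat[OF h d0' fc'])
        also have "\<dots> = h * f * d i" using assoc_mult_mat[OF h f d0] f'(2) by simp
        finally show ?thesis .
      qed
      also have "d i * (s * d i) = d i * s * d i" using assoc_mult_mat[OF d0 s d0] by simp
      also have "h * f * d i - d i - d i * s * d i = (h * f - 1\<^sub>m (n i) - d i * s) * d i"
      proof -
        have hf: "h * f \<in> carrier_mat (n i) (n i)" and ds: "d i * s \<in> carrier_mat (n i) (n i)"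
          using h f d0 s by auto
        have "(h * f - 1\<^sub>m (n i)) * d i = h * f * d i - d i"
          using minus_mult_distrib_mat[OF hf one_carrier_mat d0] d0 by simp
        moreover have "(h * f - 1\<^sub>m (n i) - d i * s) * d i = (h * f - 1\<^sub>m (n i)) * d i - d i * s * d i"
          by (rule minus_mult_distrib_mat[OF minus_carrier_mat[OF one_carrier_mat] ds d0])
        ultimately show ?thesis by simp
      qed
      finally show ?thesis using I3 by simp
    qed
    obtain s' where s': "s' \<in> carrier_mat (n (Suc (Suc i))) (n (Suc i))" "d (Suc i) * s' = ?u - s * d i"
    proof -
      have us: "?u - s * d i \<in> carrier_mat (n (Suc i)) (n (Suc i))" using sd by (rule minus_carrier_mat)
      have "\<exists>s'\<in>carrier_mat (n (Suc (Suc i))) (n (Suc i)). d (Suc i) * s' = ?u - s * d i"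
      proof (rule mat_lift[OF d1 us])
        fix v :: "('v, 'k) polynomial vec" assume v: "v \<in> carrier_vec (n (Suc i))"
        show "(?u - s * d i) *\<^sub>v v \<in> (\<lambda>w. d (Suc i) *\<^sub>v w) ` carrier_vec (n (Suc (Suc i)))"
        proof (rule ex)
          show "(?u - s * d i) *\<^sub>v v \<in> carrier_vec (n (Suc i))" using us v by (rule mult_mat_vec_carrier)
          show "d i *\<^sub>v ((?u - s * d i) *\<^sub>v v) = 0\<^sub>v (n i)"
            using assoc_mult_mat_vec[OF d0 us v] v by (simp add: kill zero_mat_mult_vec)
        qed
      qed
      then show ?thesis using that by blast
    qed
    \<comment> \<open>Both summands have entries in the irrelevant ideal, the first by minimality of
      \<open>d\<close>, the second by \<open>I5\<close>; so \<open>h' * f'\<close> is the identity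
      modulo that ideal.\<close>
    have u_eq: "?u = d (Suc i) * s' + s * d i"
      using s'(2) u sd by (intro eq_matI) auto
    show ?case
    proof (intro exI conjI ballI impI)
      show "graded_matrix (D' (Suc i)) (D (Suc i)) f'" by (rule f'(1))
      show "h' \<in> carrier_mat (n (Suc i)) (n' (Suc i))" by (rule h'(1))
      show "s' \<in> carrier_mat (n (Suc (Suc i))) (n (Suc i))" by (rule s'(1))
      show "f' *\<^sub>v (d (Suc i) *\<^sub>v v) \<in> (\<lambda>w. d' (Suc i) *\<^sub>v w) ` carrier_vec (n' (Suc (Suc i)))"
        if v: "v \<in> carrier_vec (n (Suc (Suc i)))" for v
      proof (rule ex')
        have dv: "d (Suc i) *\<^sub>v v \<in> carrier_vec (n (Suc i))" using d1 v by simp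
        then show "f' *\<^sub>v (d (Suc i) *\<^sub>v v) \<in> carrier_vec (n' (Suc i))" using fc' by simp
        have "d' i *\<^sub>v (f' *\<^sub>v (d (Suc i) *\<^sub>v v)) = (f * d i) *\<^sub>v (d (Suc i) *\<^sub>v v)"
          using assoc_mult_mat_vec[OF d0' fc' dv] f'(2) by simp
        also have "\<dots> = f *\<^sub>v ((d i * d (Suc i)) *\<^sub>v v)"
          using assoc_mult_mat_vec[OF f d0 dv] assoc_mult_mat_vec[OF d0 d1 v] by simp
        also have "\<dots> = 0\<^sub>v (n' i)" using v f by (simp add: dd zero_mat_mult_vec mat_mult_zero_vec)
        finally show "d' i *\<^sub>v (f' *\<^sub>v (d (Suc i) *\<^sub>v v)) = 0\<^sub>v (n' i)" .
      qed
      show "h' *\<^sub>v (d' (Suc i) *\<^sub>v v) \<in> (\<lambda>w. d (Suc i) *\<^sub>v w) ` carrier_vec (n (Suc (Suc i)))"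
        if v: "v \<in> carrier_vec (n' (Suc (Suc i)))" for v
      proof (rule ex)
        have dv: "d' (Suc i) *\<^sub>v v \<in> carrier_vec (n' (Suc i))" using d1' v by simp
        then show "h' *\<^sub>v (d' (Suc i) *\<^sub>v v) \<in> carrier_vec (n (Suc i))" using h' by simp
        have "d i *\<^sub>v (h' *\<^sub>v (d' (Suc i) *\<^sub>v v)) = (h * d' i) *\<^sub>v (d' (Suc i) *\<^sub>v v)"
          using assoc_mult_mat_vec[OF d0 h'(1) dv] h'(2) by simp
        also have "\<dots> = h *\<^sub>v ((d' i * d' (Suc i)) *\<^sub>v v)"
          using assoc_mult_mat_vec[OF h d0' dv] assoc_mult_mat_vec[OF d0' d1' v] by simp
        also have "\<dots> = 0\<^sub>v (n i)" using v h by (simp add: dd' zero_mat_mult_vec mat_mult_zero_vec)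
        finally show "d i *\<^sub>v (h' *\<^sub>v (d' (Suc i) *\<^sub>v v)) = 0\<^sub>v (n i)" .
      qed
      \<comment> \<open>This is \<open>I3\<close> one step further: only \<open>s * d i\<close> is
        left, and it composes with \<open>d (Suc i)\<close> to zero.\<close>
      have "?u - d (Suc i) * s' = s * d i"
        unfolding u_eq using d1 s'(1) sd by (intro mat_add_diff_cancel) auto
      then have "(?u - d (Suc i) * s') * d (Suc i) = s * (d i * d (Suc i))"
        using assoc_mult_mat[OF s d0 d1] by simp
      then show "(?u - d (Suc i) * s') * d (Suc i) = 0\<^sub>m (n (Suc i)) (n (Suc (Suc i)))"
        using s by (simp add: dd)
      show "matrix_in irrelevant_ideal (s' * d (Suc i))"
        using matrix_in_mult[OF _ s'(1) d1] min by blast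
      show "matrix_in irrelevant_ideal ?u"
        unfolding u_eq
        using matrix_in_mult[OF _ d1 s'(1)] min I5 d1 s'(1) sd by (intro matrix_in_add) auto
    qed
  qed
qed

lemma constant_coeff_sum: "Poly_Mapping.lookup (\<Sum>i\<in>A. p i) 0 \<noteq> 0 \<Longrightarrow> \<exists>i\<in>A. Poly_Mapping.lookup (p i) 0 \<noteq> 0"
  unfolding lookup_sum by (rule ccontr) simp

text \<open>Modulo the irrelevant ideal \<open>h * f\<close> is the identity, so column
  \<open>l\<close> of \<open>f\<close> has an entry with nonzero constant coefficient. That entry is
  homogeneous, hence of degree 0, and the two basis elements that it connects have equal
  degrees.\<close>

theorem minimal_resolution_degrees:
  fixes I :: "('v::finite, 'k::field) polynomial set"
  assumes min: "minimal_graded_free_resolution I D g \<phi>" and res: "graded_free_resolution I D' g' \<phi>'"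
  shows "set (D i) \<subseteq> set (D' i)"
proof
  fix j assume "j \<in> set (D i)"
  then obtain l where l: "l < length (D i)" "D i ! l = j" by (auto simp: in_set_conv_nth)
  have aug: "augmented_resolution I (case_nat [0] D) (case_nat (mat_of_row g) \<phi>)"
    using min augmented_resolutionI unfolding minimal_graded_free_resolution_def by blast
  have irr: "matrix_in irrelevant_ideal (case_nat (mat_of_row g) \<phi> (Suc i))" for i
  proof -
    have "\<phi> i \<in> carrier_mat (length (D i)) (length (D (Suc i)))"
      using min by (simp add: minimal_graded_free_resolution_def graded_free_resolution_def)
    then show ?thesis using min by (auto simp: minimal_graded_free_resolution_def matrix_in_def)
  qed
  obtain f h :: "('v, 'k) polynomial mat" where f: "graded_matrix (D' i) (D i) f" and h: "h \<in> carrier_mat (length (D i)) (length (D' i))"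
    and hf: "matrix_in irrelevant_ideal (h * f - 1\<^sub>m (length (D i)))"
    using comparison_maps[OF aug augmented_resolutionI[OF res] irr, of "Suc i"] by auto
  have fc: "f \<in> carrier_mat (length (D' i)) (length (D i))" using f by (simp add: graded_matrix_def)
  have "(h * f - 1\<^sub>m (length (D i))) $$ (l, l) \<in> irrelevant_ideal"
  proof -
    have "l < dim_row (h * f - 1\<^sub>m (length (D i)))" "l < dim_col (h * f - 1\<^sub>m (length (D i)))"
      using l(1) by simp_all
    then show ?thesis using hf unfolding matrix_in_def by blast
  qed
  then have "Poly_Mapping.lookup ((h * f) $$ (l, l) - 1) 0 = 0"
    using h fc l irrelevant_ideal_constant_coeff by simp
  then have "Poly_Mapping.lookup ((h * f) $$ (l, l)) 0 \<noteq> 0" by (simp add: lookup_minus)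
  then have "\<exists>k\<in>{..<length (D' i)}. Poly_Mapping.lookup (h $$ (l, k) * f $$ (k, l)) 0 \<noteq> 0"
    unfolding mult_mat_index[OF h fc l(1) l(1)] by (rule constant_coeff_sum)
  then obtain k where k: "k < length (D' i)" "Poly_Mapping.lookup (h $$ (l, k) * f $$ (k, l)) 0 \<noteq> 0"
    by (elim bexE) simp
  then have "0 \<in> Poly_Mapping.keys (f $$ (k, l))" by (auto simp: constant_coeff_mult in_keys_iff)
  moreover have "f $$ (k, l) \<in> homogeneous (D i ! l - D' i ! k)"
    using f k(1) l(1) by (simp add: graded_matrix_def)
  ultimately have "D i ! l = D' i ! k" by (force simp: homogeneous_def total_degree_def)
  then show "j \<in> set (D' i)" using k l by auto
qed

section \<open>Squarefree powers of edge ideals\<close>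

lemma subspace_monomial_ideal:
  fixes U :: "'v::finite set set"
  assumes "upclosed U"
  shows "ideal.subspace (monomial_ideal U :: ('v, 'k::field) polynomial set)"
proof (rule ideal.subspaceI)
  show "0 \<in> monomial_ideal U" by (simp add: monomial_ideal_def)
next
  fix p q :: "('v, 'k) polynomial" assume "p \<in> monomial_ideal U" "q \<in> monomial_ideal U"
  then show "p + q \<in> monomial_ideal U" using keys_add[of p q] by (auto simp: monomial_ideal_def)
next
  fix c p :: "('v, 'k) polynomial" assume p: "p \<in> monomial_ideal U"
  show "c * p \<in> monomial_ideal U"
    unfolding monomial_ideal_def
  proof (intro CollectI ballI)
    fix a assume "a \<in> Poly_Mapping.keys (c * p)"
    then obtain b b' where b: "a = b + b'" "b' \<in> Poly_Mapping.keys p" using keys_mult by blast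
    then have "Poly_Mapping.keys b' \<in> U" using p by (simp add: monomial_ideal_def)
    moreover have "Poly_Mapping.keys b' \<subseteq> Poly_Mapping.keys a" unfolding b(1) keys_monomial_add by simp
    ultimately show "Poly_Mapping.keys a \<in> U" using assms unfolding upclosed_def by blast
  qed
qed

text \<open>The monomials of \<open>I(G)\<^sup>s\<close> are the multiples of products of \<open>s\<close> edges, possibly repeated.\<close>

primrec edge_product_multiple :: "'v::finite set set \<Rightarrow> nat \<Rightarrow> 'v monomial \<Rightarrow> bool" where
  "edge_product_multiple E 0 a \<longleftrightarrow> True"
| "edge_product_multiple E (Suc s) a \<longleftrightarrow>
     (\<exists>e\<in>E. \<exists>b. a = squarefree_monomial e + b \<and> edge_product_multiple E s b)"

lemma edge_product_multiple_add: "edge_product_multiple E s a \<Longrightarrow> edge_product_multiple E s (a + b)"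
proof (induction s arbitrary: a)
  case (Suc s)
  then show ?case by (auto simp: add.assoc) (metis Suc.IH add.assoc)
qed simp

lemma variable_mult_edge:
  assumes "simple_graph E" "{x, y} \<in> E"
  shows "variable x * variable y = Poly_Mapping.single (squarefree_monomial {x, y}) (1 :: 'k::field)"
proof -
  have "x \<noteq> y" using edge_neq[OF assms] .
  then have "squarefree_monomial {x, y} = Poly_Mapping.single x 1 + Poly_Mapping.single y 1"
    by (simp add: squarefree_monomial_def)
  then show ?thesis by (simp add: variable_def mult_single)
qed

lemma keys_edge_ideal:
  assumes E: "simple_graph E" and p: "p \<in> (edge_ideal E :: ('v::finite, 'k::field) polynomial set)"
    and a: "a \<in> Poly_Mapping.keys p"
  shows "\<exists>e\<in>E. \<exists>b. a = squarefree_monomial e + b"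
proof -
  let ?J = "{p :: ('v, 'k) polynomial. \<forall>a\<in>Poly_Mapping.keys p. \<exists>e\<in>E. \<exists>b. a = squarefree_monomial e + b}"
  have "edge_ideal E \<subseteq> ?J"
    unfolding edge_ideal_def
  proof (rule ideal.span_minimal)
    show "{variable x * variable y |x y. {x, y} \<in> E} \<subseteq> ?J"
    proof
      fix p :: "('v, 'k) polynomial" assume "p \<in> {variable x * variable y |x y. {x, y} \<in> E}"
      then obtain x y where xy: "p = variable x * variable y" "{x, y} \<in> E" by blast
      have p: "p = Poly_Mapping.single (squarefree_monomial {x, y}) 1"
        unfolding xy(1) by (rule variable_mult_edge[OF E xy(2)])
      have "squarefree_monomial {x, y} = squarefree_monomial {x, y} + 0" by simp
      then have "\<exists>e\<in>E. \<exists>b. squarefree_monomial {x, y} = squarefree_monomial e + b" using xy(2) by blast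
      then show "p \<in> ?J" unfolding p by simp
    qed
    show "ideal.subspace ?J"
    proof (rule ideal.subspaceI)
      fix p q assume "p \<in> ?J" "q \<in> ?J"
      then show "p + q \<in> ?J" using keys_add[of p q] by blast
    next
      fix c p assume p: "p \<in> ?J"
      have "\<exists>e\<in>E. \<exists>b. a = squarefree_monomial e + b" if "a \<in> Poly_Mapping.keys (c * p)" for a
      proof -
        obtain b b' where b: "a = b + b'" "b' \<in> Poly_Mapping.keys p" using keys_mult \<open>a \<in> _\<close> by blast
        then obtain e b'' where "e \<in> E" "b' = squarefree_monomial e + b''" using p by blast
        then show ?thesis unfolding b(1) by (intro bexI[of _ e] exI[of _ "b + b''"]) (simp_all add: ac_simps)
      qed
      then show "c * p \<in> ?J" by blast
    qed simp
  qed
  then show ?thesis using p a by blast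
qed

lemma keys_ideal_power:
  assumes E: "simple_graph E" and p: "p \<in> ideal_power (edge_ideal E :: ('v::finite, 'k::field) polynomial set) s"
    and a: "a \<in> Poly_Mapping.keys p"
  shows "edge_product_multiple E s a"
  using p a
proof (induction s arbitrary: p a)
  case (Suc s)
  let ?J = "{p :: ('v, 'k) polynomial. \<forall>a\<in>Poly_Mapping.keys p. edge_product_multiple E (Suc s) a}"
  have "ideal_power (edge_ideal E :: ('v, 'k) polynomial set) (Suc s) \<subseteq> ?J"
    unfolding ideal_power.simps
  proof (rule ideal.span_minimal)
    show "{a * b |a b. a \<in> edge_ideal E \<and> b \<in> ideal_power (edge_ideal E) s} \<subseteq> ?J"
    proof (intro subsetI CollectI ballI)
      fix p :: "('v, 'k) polynomial" and a
      assume "p \<in> {a * b |a b. a \<in> edge_ideal E \<and> b \<in> ideal_power (edge_ideal E) s}"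
        and a: "a \<in> Poly_Mapping.keys p"
      then obtain q r where qr: "p = q * r" "q \<in> edge_ideal E" "r \<in> ideal_power (edge_ideal E) s" by blast
      then obtain b c where bc: "a = b + c" "b \<in> Poly_Mapping.keys q" "c \<in> Poly_Mapping.keys r"
        using keys_mult[of q r] a by blast
      then obtain e b' where e: "e \<in> E" "b = squarefree_monomial e + b'" using keys_edge_ideal[OF E qr(2)] by blast
      have "edge_product_multiple E s (c + b')" using Suc.IH[OF qr(3) bc(3)] edge_product_multiple_add by blast
      moreover have "a = squarefree_monomial e + (c + b')" using bc(1) e(2) by (simp add: ac_simps)
      ultimately show "edge_product_multiple E (Suc s) a" using e(1) by auto
    qed
    show "ideal.subspace ?J"
    proof (rule ideal.subspaceI)
      fix p q assume "p \<in> ?J" "q \<in> ?J"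
      then show "p + q \<in> ?J" using keys_add[of p q] by blast
    next
      fix c p assume p: "p \<in> ?J"
      have "edge_product_multiple E (Suc s) a" if a: "a \<in> Poly_Mapping.keys (c * p)" for a
      proof -
        obtain b b' where "a = b + b'" and b': "b' \<in> Poly_Mapping.keys p" using keys_mult[of c p] a by blast
        then have b: "a = b' + b" by (simp only: add.commute)
        have "edge_product_multiple E (Suc s) b'" using p b' by blast
        then show ?thesis unfolding b by (rule edge_product_multiple_add)
      qed
      then show "c * p \<in> ?J" by blast
    qed simp
  qed
  then show ?case using Suc.prems by blast
qed simp

text \<open>In a squarefree product no vertex occurs twice, so each edge that is split off is
  disjoint from the support of the remaining factor and the edges form a matching.\<close>

lemma edge_product_multiple_squarefree:
  assumes E: "simple_graph E" and "edge_product_multiple E s a" "\<forall>x. Poly_Mapping.lookup a x \<le> 1"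
  shows "Poly_Mapping.keys a \<in> matchable E s"
  using assms(2,3)
proof (induction s arbitrary: a)
  case 0
  then show ?case using matchable_0[OF E] by simp
next
  case (Suc s)
  then obtain e b where e: "e \<in> E" "a = squarefree_monomial e + b" "edge_product_multiple E s b" by auto
  have le: "(if x \<in> e then 1 else 0) + Poly_Mapping.lookup b x \<le> 1" for x
    using Suc.prems(2)[rule_format, of x] unfolding e(2) lookup_add by simp
  have "\<forall>x. Poly_Mapping.lookup b x \<le> 1" using le by (meson add_leD2)
  then have b: "Poly_Mapping.keys b \<in> matchable E s" using Suc.IH e(3) by blast
  have "x \<notin> Poly_Mapping.keys b" if "x \<in> e" for x using le[of x] that by (simp add: in_keys_iff)
  then have "Poly_Mapping.keys a - e = Poly_Mapping.keys b" unfolding e(2) keys_monomial_add by auto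
  then show ?case
    unfolding matchable_Suc_iff[OF E] using e(1) b
    by (intro bexI[of _ e]) (auto simp: e(2) keys_monomial_add)
qed

lemma single_in_ideal_power:
  assumes E: "simple_graph E" and "F \<in> matchable E s"
  shows "Poly_Mapping.single (squarefree_monomial F) 1 \<in> ideal_power (edge_ideal E :: ('v::finite, 'k::field) polynomial set) s"
  using assms(2)
proof (induction s arbitrary: F)
  case (Suc s)
  then obtain e where e: "e \<in> E" "e \<subseteq> F" "F - e \<in> matchable E s" using matchable_Suc_iff[OF E] by blast
  then obtain x where "x \<in> e" using edge_nonempty[OF E] by blast
  then obtain y where y: "e = {x, y}" using edge_doubleton[OF E e(1)] by metis
  have "variable x * variable y \<in> (edge_ideal E :: ('v, 'k) polynomial set)"
    unfolding edge_ideal_def using e(1) y by (intro ideal.span_base) auto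
  moreover have "variable x * variable y = Poly_Mapping.single (squarefree_monomial e) (1 :: 'k)"
    unfolding y by (rule variable_mult_edge[OF E]) (use e(1) y in simp)
  ultimately have "Poly_Mapping.single (squarefree_monomial e) 1 \<in> (edge_ideal E :: ('v, 'k) polynomial set)"
    by simp
  moreover have "Poly_Mapping.single (squarefree_monomial (F - e)) 1 \<in> ideal_power (edge_ideal E :: ('v, 'k) polynomial set) s"
    using Suc.IH e(3) by blast
  moreover have "squarefree_monomial F = squarefree_monomial e + squarefree_monomial (F - e)"
    by (rule poly_mapping_eqI) (use e(2) in \<open>auto simp: lookup_add\<close>)
  then have "Poly_Mapping.single (squarefree_monomial F) (1::'k) =
    Poly_Mapping.single (squarefree_monomial e) 1 * Poly_Mapping.single (squarefree_monomial (F - e)) 1"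
    by (simp add: mult_single)
  ultimately show ?case unfolding ideal_power.simps by (intro ideal.span_base) blast
qed simp

lemma polynomial_eq_sum: "p = (\<Sum>a\<in>Poly_Mapping.keys p. Poly_Mapping.single a (Poly_Mapping.lookup p a))"
proof (rule poly_mapping_eqI)
  fix m
  have "Poly_Mapping.lookup (\<Sum>a\<in>Poly_Mapping.keys p. Poly_Mapping.single a (Poly_Mapping.lookup p a)) m =
    (\<Sum>a\<in>Poly_Mapping.keys p. if a = m then Poly_Mapping.lookup p m else 0)"
    unfolding lookup_sum by (intro sum.cong) (auto simp: lookup_single when_def)
  then show "Poly_Mapping.lookup p m =
    Poly_Mapping.lookup (\<Sum>a\<in>Poly_Mapping.keys p. Poly_Mapping.single a (Poly_Mapping.lookup p a)) m"
    by (auto simp: in_keys_iff)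
qed

lemma squarefree_power_eq_monomial_ideal:
  assumes E: "simple_graph E"
  shows "squarefree_power (edge_ideal E) s = (monomial_ideal (matchable E s) :: ('v::finite, 'k::field) polynomial set)"
proof
  show "squarefree_power (edge_ideal E) s \<subseteq> (monomial_ideal (matchable E s) :: ('v, 'k) polynomial set)"
    unfolding squarefree_power_def
  proof (rule ideal.span_minimal[OF _ subspace_monomial_ideal[OF upclosed_matchable]], clarify)
    fix m assume m: "\<forall>x. Poly_Mapping.lookup m x \<le> 1"
      "Poly_Mapping.single m 1 \<in> ideal_power (edge_ideal E :: ('v, 'k) polynomial set) s"
    have "edge_product_multiple E s m" using keys_ideal_power[OF E m(2)] by simp
    then have "Poly_Mapping.keys m \<in> matchable E s" using edge_product_multiple_squarefree[OF E] m(1) by blast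
    then show "Poly_Mapping.single m 1 \<in> (monomial_ideal (matchable E s) :: ('v, 'k) polynomial set)"
      by (simp add: monomial_ideal_def)
  qed
  show "(monomial_ideal (matchable E s) :: ('v, 'k) polynomial set) \<subseteq> squarefree_power (edge_ideal E) s"
  proof
    fix p :: "('v, 'k) polynomial" assume p: "p \<in> monomial_ideal (matchable E s)"
    have "Poly_Mapping.single a (Poly_Mapping.lookup p a) \<in> squarefree_power (edge_ideal E) s"
      if "a \<in> Poly_Mapping.keys p" for a
    proof -
      \<comment> \<open>Each monomial of \<open>p\<close> is a multiple of the squarefree monomial
        on its support, which is one of the generators.\<close>
      let ?F = "Poly_Mapping.keys a"
      have "?F \<in> matchable E s" using p that by (simp add: monomial_ideal_def)
      from single_in_ideal_power[OF E this]
      have "Poly_Mapping.single (squarefree_monomial ?F) 1 \<in> squarefree_power (edge_ideal E :: ('v, 'k) polynomial set) s"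
        unfolding squarefree_power_def
        by (intro ideal.span_base CollectI exI[of _ "squarefree_monomial ?F"]) auto
      then have "Poly_Mapping.single (a - squarefree_monomial ?F) (Poly_Mapping.lookup p a) *
        Poly_Mapping.single (squarefree_monomial ?F) 1 \<in> squarefree_power (edge_ideal E :: ('v, 'k) polynomial set) s"
        unfolding squarefree_power_def by (rule ideal.span_scale)
      moreover have "a - squarefree_monomial ?F + squarefree_monomial ?F = a"
        using squarefree_monomial_add_diff[of ?F a] by (simp add: add.commute)
      ultimately show ?thesis by (simp add: mult_single)
    qed
    then show "p \<in> squarefree_power (edge_ideal E) s"
      by (subst polynomial_eq_sum) (simp add: squarefree_power_def ideal.span_sum)
  qed
qed

text \<open>\<open>Max\<close> says something only about a finite nonempty set, and the set here
  comes from a resolution picked by \<open>SOME\<close>. Both properties and the bound are obtained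
  by comparing its degrees with those of the constructed resolution.\<close>

lemma regularity_monomial_ideal_le:
  fixes U :: "'v::finite set set"
  assumes U: "upclosed U" and UNIV: "UNIV \<in> U"
    and reg: "\<And>F. regular_at TYPE('k::field) U F r"
  shows "regularity (monomial_ideal U :: ('v, 'k) polynomial set) \<le> int r"
proof -
  let ?I = "monomial_ideal U :: ('v, 'k) polynomial set"
  obtain D' g' \<phi>' where res': "minimal_graded_free_resolution ?I D' g' \<phi>'"
    and acyc: "\<And>i j. j \<in> set (D' i) \<Longrightarrow> \<exists>F. j = int (card F) \<and> \<not> acyclic_at TYPE('k) U F i"
    using minimal_resolution_monomial_ideal[OF U] by blast
  define D where "D = (SOME D. \<exists>g \<phi>. minimal_graded_free_resolution ?I D g \<phi>)"
  have "\<exists>g \<phi>. minimal_graded_free_resolution ?I D g \<phi>"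
    using someI_ex[of "\<lambda>D. \<exists>g \<phi>. minimal_graded_free_resolution ?I D g \<phi>"] res' unfolding D_def by blast
  then obtain g \<phi> where res: "minimal_graded_free_resolution ?I D g \<phi>" by blast
  let ?S = "{j - int i | i j. graded_betti ?I i j \<noteq> 0}"
  have betti: "graded_betti ?I i j \<noteq> 0 \<longleftrightarrow> j \<in> set (D i)" for i j
    unfolding graded_betti_def D_def[symmetric] by (simp add: count_list_0_iff)
  \<comment> \<open>Each degree that occurs is the size of some \<open>F\<close> with homology in
    position \<open>i\<close>. A chain of degree \<open>i\<close> needs \<open>i\<close> vertices of
    \<open>F\<close>, which bounds \<open>i\<close> and makes the set finite.\<close>
  have bounds: "i \<le> card (UNIV :: 'v set) \<and> 0 \<le> j \<and> j \<le> int (card (UNIV :: 'v set)) \<and> j - int i \<le> int r" if "j \<in> set (D i)" for i j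
  proof -
    have "j \<in> set (D' i)"
      using minimal_resolution_degrees[OF res] res' that unfolding minimal_graded_free_resolution_def by blast
    then obtain F where F: "j = int (card F)" "\<not> acyclic_at TYPE('k) U F i" using acyc by blast
    have "\<not> i + r < card F" using reg[of F] F(2) unfolding regular_at_def by blast
    moreover have "i \<le> card F" using F(2) acyclic_at_large by (metis not_le)
    moreover have "card F \<le> card (UNIV :: 'v set)" by (simp add: card_mono)
    ultimately show ?thesis using F(1) by linarith
  qed
  have "?S \<subseteq> (\<lambda>(i, j). j - int i) ` ({..card (UNIV :: 'v set)} \<times> {0..int (card (UNIV :: 'v set))})"
    using bounds unfolding betti by force
  then have fin: "finite ?S" by (rule finite_subset) simp
  \<comment> \<open>With no generators the ideal would be zero, but it contains the product of all
    variables.\<close>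
  have "D 0 \<noteq> []"
  proof
    assume "D 0 = []"
    moreover have img: "(\<lambda>v. g \<bullet> v) ` carrier_vec (length (D 0)) = ?I" "g \<in> carrier_vec (length (D 0))"
      using res by (simp_all add: minimal_graded_free_resolution_def graded_free_resolution_def)
    ultimately have "?I \<subseteq> {0}" by (auto simp: scalar_prod_def)
    moreover have "Poly_Mapping.single (squarefree_monomial UNIV) 1 \<in> ?I" using UNIV by (simp add: monomial_ideal_def)
    moreover have "Poly_Mapping.single (squarefree_monomial UNIV) (1::'k) \<noteq> 0"
      by (metis lookup_single_eq lookup_zero zero_neq_one)
    ultimately show False by blast
  qed
  then have "hd (D 0) - int 0 \<in> ?S" unfolding betti by (metis (mono_tags, lifting) hd_in_set mem_Collect_eq)
  then have "Max ?S \<in> ?S" using fin by (intro Max_in) auto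
  then show ?thesis unfolding regularity_def using bounds unfolding betti by force
qed

theorem corollary3p8:
  fixes E :: "'v::finite set set" and s :: nat
  assumes "simple_graph E"
    and "card (UNIV :: 'v set) \<le> 9"
    and "1 \<le> s"
    and "s \<le> match_number E"
  shows "regularity (squarefree_power (edge_ideal E :: ('v, 'k::field) polynomial set) s)
           \<le> int (match_number E + s)"
  unfolding squarefree_power_eq_monomial_ideal[OF assms(1)]
proof (rule regularity_monomial_ideal_le[OF upclosed_matchable])
  show "UNIV \<in> matchable E s" using assms(4) by (simp add: matchable_iff match_number_on_UNIV)
  fix F :: "'v set"
  have "card F \<le> 9" using card_mono[of UNIV F] assms(2) by simp
  then have "regular_at TYPE('k) (matchable E s) F (match_number_on E F + s)"
    by (rule regular_at_matchable[OF assms(1) _ assms(3)])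
  then show "regular_at TYPE('k) (matchable E s) F (match_number E + s)"
    by (rule regular_at_mono) (use match_number_on_mono[of F UNIV E] in \<open>simp add: match_number_on_UNIV\<close>)
qed

end
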